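(* Let $(\tau_e)$ be i.i.d. nonnegative continuous passage times on the edges of $\mathbb Z^\ell$ satisfying $\mathbb E e^{\alpha\tau_e}<\infty$ for some $\alpha>0$. For $t>0$ let $B(t)=\{y\in\mathbb Z^\ell:T(0,y)<t\}$, let $d_t(x/t,y/t)=t^{-1}T(x,y)$ for $x,y\in B(t)$, and let $\mu_t$ be the uniform probability measure on the finite set $B(t)/t$. Let $\mathcal B_0\subset\mathbb R^\ell$ be the asymptotic shape given by the shape theorem, $\|\cdot\|_\tau$ the associated norm, $\|x\|_\tau=\lim_{n\to\infty}\frac1nT(0,nx)$, and $d(s,s')=\|s-s'\|_\tau$ for $s,s'\in\mathbb R^\ell$. Let $\mu$ be the uniform probability measure on $\mathcal B_0$. Then, almost surely, as $t\to\infty$, $$(B(t)/t,\,d_t,\,\mu_t)\ \longrightarrow\ (\mathcal B_0,\,d,\,\mu)$$ in the measured Gromov–Hausdorff sense.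
   Context: First passage percolation: points $x,y\in\mathbb Z^\ell$ are joined by an edge iff $|x-y|_1=1$. The common law of the passage times $\tau_e\ge0$ has a density with respect to Lebesgue measure. A path from $x$ to $y$ is a finite sequence of consecutive edges joining $x$ to $y$; its cost is the sum of the $\tau_e$ over its edges; $T(x,y)$ is the infimum of the costs of all paths from $x$ to $y$ ($T(x,x)=0$). The limit defining $\|x\|_\tau$ exists almost surely and is deterministic for $x\in\mathbb Z^\ell$, and it extends uniquely to a norm on $\mathbb R^\ell$; $\mathcal B_0=\{x\in\mathbb R^\ell:\|x\|_\tau\le1\}$ is the compact convex symmetric limit shape of $B(t)/t$. The uniform measure on $\mathcal B_0$ is normalized Lebesgue measure. A map $h\colon(\mathbb X,d_{\mathbb X})\to(\mathbb Y,d_{\mathbb Y})$ is an $\varepsilon$-isometry if $|d_{\mathbb X}(x,x')-d_{\mathbb Y}(h(x),h(x'))|<\varepsilon$ for all $x,x'$, and $d_{\mathbb Y}(y,h(\mathbb X))<\varepsilon$ for all $y\in\mathbb Y$. Compact metric spaces with probability measures $(\mathbb X_t,d_t,\mu_t)$ converge to $(\mathbb X,d,\mu)$ in the measured Gromov–Hausdorff sense as $t\to\infty$ if there are $\varepsilon_t\to0$ and (Borel measurable) $\varepsilon_t$-isometries $h_t\colon\mathbb X_t\to\mathbb X$ with $(h_t)_{\#}\mu_t\to\mu$ weakly. *)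

theory Defs
  imports "HOL-Probability.Probability"
begin

section \<open>First passage percolation on the integer lattice\<close>

definition adjacent :: "int ^ 'n \<Rightarrow> int ^ 'n \<Rightarrow> bool" where
  "adjacent x y \<longleftrightarrow> (\<Sum>i\<in>UNIV. \<bar>x $ i - y $ i\<bar>) = 1"

definition lattice_edges :: "(int ^ 'n) set set" where
  "lattice_edges = {{x, y} |x y. adjacent x y}"

text \<open>A path is encoded by the non-empty list of the vertices it visits, so the trivial path
  from \<open>x\<close> to \<open>x\<close> is \<open>[x]\<close>, of cost \<open>0\<close>. Edges may be repeated, and count with multiplicity.\<close>

definition lattice_path :: "int ^ 'n \<Rightarrow> (int ^ 'n) list \<Rightarrow> int ^ 'n \<Rightarrow> bool" where
  "lattice_path x p y \<longleftrightarrow> p \<noteq> [] \<and> hd p = x \<and> last p = y \<and> successively adjacent p"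

definition path_cost :: "((int ^ 'n) set \<Rightarrow> real) \<Rightarrow> (int ^ 'n) list \<Rightarrow> real" where
  "path_cost w p = (\<Sum>i<length p - 1. w {p ! i, p ! Suc i})"

definition passage_time :: "((int ^ 'n) set \<Rightarrow> real) \<Rightarrow> int ^ 'n \<Rightarrow> int ^ 'n \<Rightarrow> real" where
  "passage_time w x y = Inf {path_cost w p |p. lattice_path x p y}"

definition real_vec :: "int ^ 'n \<Rightarrow> real ^ 'n" where
  "real_vec x = (\<chi> i. real_of_int (x $ i))"

definition fpp_ball :: "((int ^ 'n) set \<Rightarrow> real) \<Rightarrow> real \<Rightarrow> (int ^ 'n) set" where
  "fpp_ball w t = {y. passage_time w 0 y < t}"

definition rescale :: "real \<Rightarrow> int ^ 'n \<Rightarrow> real ^ 'n" where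
  "rescale t x = (1 / t) *\<^sub>R real_vec x"

text \<open>The three components of the rescaled ball, for \<open>t > 0\<close>. Then \<open>rescale t\<close> is injective, so
  that \<open>rescaled_dist w t (rescale t x) (rescale t y) = passage_time w x y / t\<close>. The values of
  \<open>rescaled_dist\<close> at points which are not rescaled lattice points are irrelevant.\<close>

definition rescaled_ball :: "((int ^ 'n) set \<Rightarrow> real) \<Rightarrow> real \<Rightarrow> (real ^ 'n) set" where
  "rescaled_ball w t = rescale t ` fpp_ball w t"

definition rescaled_dist ::
    "((int ^ 'n) set \<Rightarrow> real) \<Rightarrow> real \<Rightarrow> real ^ 'n \<Rightarrow> real ^ 'n \<Rightarrow> real" where
  "rescaled_dist w t s s' =
     passage_time w (inv (rescale t) s) (inv (rescale t) s') / t"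

definition rescaled_measure :: "((int ^ 'n) set \<Rightarrow> real) \<Rightarrow> real \<Rightarrow> (real ^ 'n) measure" where
  "rescaled_measure w t = uniform_count_measure (rescaled_ball w t)"

section \<open>The asymptotic norm and the limit shape\<close>

definition is_norm :: "('a::real_vector \<Rightarrow> real) \<Rightarrow> bool" where
  "is_norm N \<longleftrightarrow>
     (\<forall>x. 0 \<le> N x) \<and> (\<forall>x. N x = 0 \<longleftrightarrow> x = 0) \<and>
     (\<forall>c x. N (c *\<^sub>R x) = \<bar>c\<bar> * N x) \<and>
     (\<forall>x y. N (x + y) \<le> N x + N y)"

text \<open>The norm on the Euclidean space that extends the almost sure limits along the lattice rays.
  There is at most one, as a norm is determined by its values at lattice points (by homogeneity
  at rational points, then by continuity); that there is one is part of the shape theorem.\<close>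

definition fpp_norm :: "'w measure \<Rightarrow> ((int ^ 'n) set \<Rightarrow> 'w \<Rightarrow> real) \<Rightarrow> real ^ 'n \<Rightarrow> real" where
  "fpp_norm M \<tau> =
     (THE N. is_norm N \<and>
        (\<forall>x. AE \<omega> in M.
           (\<lambda>n. passage_time (\<lambda>e. \<tau> e \<omega>) 0 (of_nat n *s x) / real n)
             \<longlonglongrightarrow> N (real_vec x)))"

definition limit_shape :: "'w measure \<Rightarrow> ((int ^ 'n) set \<Rightarrow> 'w \<Rightarrow> real) \<Rightarrow> (real ^ 'n) set" where
  "limit_shape M \<tau> = {x. fpp_norm M \<tau> x \<le> 1}"

definition limit_dist ::
    "'w measure \<Rightarrow> ((int ^ 'n) set \<Rightarrow> 'w \<Rightarrow> real) \<Rightarrow> real ^ 'n \<Rightarrow> real ^ 'n \<Rightarrow> real" where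
  "limit_dist M \<tau> s s' = fpp_norm M \<tau> (s - s')"

definition limit_measure ::
    "'w measure \<Rightarrow> ((int ^ 'n) set \<Rightarrow> 'w \<Rightarrow> real) \<Rightarrow> (real ^ 'n) measure" where
  "limit_measure M \<tau> =
     uniform_measure (restrict_space lborel (limit_shape M \<tau>)) (limit_shape M \<tau>)"

section \<open>Measured Gromov--Hausdorff convergence\<close>

definition compact_metric_prob_space :: "'a set \<Rightarrow> ('a \<Rightarrow> 'a \<Rightarrow> real) \<Rightarrow> 'a measure \<Rightarrow> bool" where
  "compact_metric_prob_space X d \<mu> \<longleftrightarrow>
     Metric_space X d \<and> compact_space (Metric_space.mtopology X d) \<and>
     prob_space \<mu> \<and> space \<mu> = X \<and>
     sets \<mu> = sigma_sets X {U. openin (Metric_space.mtopology X d) U}"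

text \<open>The last clause says that every \<open>y \<in> Y\<close> has distance less than \<open>\<epsilon>\<close> from the set \<open>h ` X\<close>:
  the infimum of the distances to the points of \<open>h ` X\<close> is less than \<open>\<epsilon>\<close> iff one of them is.\<close>

definition eps_isometry ::
    "real \<Rightarrow> 'a set \<Rightarrow> ('a \<Rightarrow> 'a \<Rightarrow> real) \<Rightarrow> 'b set \<Rightarrow> ('b \<Rightarrow> 'b \<Rightarrow> real) \<Rightarrow> ('a \<Rightarrow> 'b) \<Rightarrow> bool"
where
  "eps_isometry \<epsilon> X dX Y dY h \<longleftrightarrow>
     h ` X \<subseteq> Y \<and>
     (\<forall>x\<in>X. \<forall>x'\<in>X. \<bar>dX x x' - dY (h x) (h x')\<bar> < \<epsilon>) \<and>
     (\<forall>y\<in>Y. \<exists>x\<in>X. dY y (h x) < \<epsilon>)"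

definition weakly_converges ::
    "'b topology \<Rightarrow> (real \<Rightarrow> 'b measure) \<Rightarrow> 'b measure \<Rightarrow> bool" where
  "weakly_converges T \<nu> \<mu> \<longleftrightarrow>
     (\<forall>f. continuous_map T euclideanreal f \<and> bounded (f ` topspace T) \<longrightarrow>
        ((\<lambda>t. integral\<^sup>L (\<nu> t) f) \<longlongrightarrow> integral\<^sup>L \<mu> f) at_top)"

text \<open>Convergence as \<open>t \<rightarrow> \<infinity>\<close> of a family indexed by the real numbers \<open>t > 0\<close>. The first two
  clauses make it a relation between compact metric spaces with Borel probability measures.\<close>

definition mGH_converges ::
    "(real \<Rightarrow> 'a set) \<Rightarrow> (real \<Rightarrow> 'a \<Rightarrow> 'a \<Rightarrow> real) \<Rightarrow> (real \<Rightarrow> 'a measure) \<Rightarrow>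
     'b set \<Rightarrow> ('b \<Rightarrow> 'b \<Rightarrow> real) \<Rightarrow> 'b measure \<Rightarrow> bool" where
  "mGH_converges X dX \<mu>X Y dY \<mu>Y \<longleftrightarrow>
     (\<forall>t>0. compact_metric_prob_space (X t) (dX t) (\<mu>X t)) \<and>
     compact_metric_prob_space Y dY \<mu>Y \<and>
     (\<exists>\<epsilon> h. (\<epsilon> \<longlongrightarrow> 0) at_top \<and>
        (\<forall>t>0. eps_isometry (\<epsilon> t) (X t) (dX t) Y dY (h t) \<and>
               h t \<in> measurable (\<mu>X t) \<mu>Y) \<and>
        weakly_converges (Metric_space.mtopology Y dY)
          (\<lambda>t. distr (\<mu>X t) \<mu>Y (h t)) \<mu>Y)"

end

theory Submission
  imports Defs
begin

text \<open>No ergodic theorem is needed: the shape theorem is derived from moment bounds. As the law of the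
  weights has no atom at \<open>0\<close>, a Chernoff bound and path counting show that long self-avoiding paths
  are expensive, so \<open>T (n a) (n b)\<close> is attained on self-avoiding paths with at most \<open>K n\<close> edges. By the
  Efron--Stein inequality the minimum over such paths has variance \<open>O(n)\<close>, and its mean is subadditive in
  \<open>n\<close>. Hence \<open>T (n a) (n b) / n\<close> converges almost surely along squares, and along all \<open>n\<close> since passage
  times are at most linear in the distance, by a second Chernoff bound. The same linear bound makes
  the convergence uniform on boxes of size \<open>O(t)\<close> simultaneously for all pairs of points. Given a
  uniformly good configuration of weights, the radial retraction onto the unit ball of the norm
  provides the almost isometries.\<close>

section \<open>Lattice paths and passage times\<close>

text \<open>Distances between arbitrary points of the ball must converge, so growth from the origin
  is not enough. Translation invariance holds only in law and says nothing almost surely about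
  moving starting points. Hence convergence is proved along all pairs of rays \<open>n *s a\<close>,
  \<open>n *s (a + v)\<close>, and a grid of finitely many such pairs, with mesh a small multiple of
  \<open>t\<close>, controls all other pairs.

  \<open>passage_time\<close> depends on infinitely many weights, whereas the variance inequality
  lives on a finite product. The factor \<open>K\<close> comes from playing the two exponential
  bounds against each other: the time is at most \<open>C * l1 v * n\<close>, and a path with more
  than \<open>K * n\<close> edges costs more than \<open>c * K * n\<close>, so
  \<open>K \<ge> C * l1 v / c\<close> excludes long paths.

  All probability is confined to the constants \<open>c\<close>, \<open>C\<close> and to the limits
  \<open>NZ\<close> along lattice directions, none of which depends on the realisation. The norm is
  built from \<open>NZ\<close> alone by deterministic arguments, hence is the same for almost every
  realisation. The lower bound by \<open>c\<close> is what makes it a norm instead of a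
  seminorm.\<close>

definition l1 :: "int ^ 'n \<Rightarrow> nat" where
  "l1 x = (\<Sum>i\<in>UNIV. nat \<bar>x $ i\<bar>)"

lemma l1_0 [simp]: "l1 0 = 0"
  by (simp add: l1_def)

lemma l1_eq_0_iff [simp]: "l1 x = 0 \<longleftrightarrow> x = 0"
  by (auto simp: l1_def vec_eq_iff)

lemma l1_minus_commute: "l1 (x - y) = l1 (y - x)"
  by (simp add: l1_def abs_minus_commute)

lemma l1_triangle: "l1 (x + y) \<le> l1 x + l1 y"
  unfolding l1_def sum.distrib[symmetric] by (intro sum_mono) auto

lemma l1_triangle_diff: "l1 (x - z) \<le> l1 (x - y) + l1 (y - z)"
  using l1_triangle[of "x - y" "y - z"] by simp

lemma l1_minus: "l1 (- x) = l1 x"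
  by (simp add: l1_def)

lemma l1_smult: "l1 (of_nat n *s x) = n * l1 x"
  by (simp add: l1_def sum_distrib_left abs_mult nat_mult_distrib)

lemma adjacent_iff_l1: "adjacent x y \<longleftrightarrow> l1 (x - y) = 1"
proof -
  have "int (l1 (x - y)) = (\<Sum>i\<in>UNIV. \<bar>x $ i - y $ i\<bar>)"
    unfolding l1_def by (simp add: of_nat_sum)
  thus ?thesis unfolding adjacent_def by linarith
qed

lemma adjacent_commute: "adjacent x y \<longleftrightarrow> adjacent y x"
  by (simp add: adjacent_iff_l1 l1_minus_commute)

lemma adjacent_imp_edge: "adjacent x y \<Longrightarrow> {x, y} \<in> lattice_edges"
  by (auto simp: lattice_edges_def)

lemma path_cost_single [simp]: "path_cost w [x] = 0"
  by (simp add: path_cost_def)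

lemma path_cost_Cons [simp]: "path_cost w (x # y # p) = w {x, y} + path_cost w (y # p)"
  by (simp add: path_cost_def sum.lessThan_Suc_shift del: sum.lessThan_Suc)

lemma path_cost_append:
  "p \<noteq> [] \<Longrightarrow> last p = hd q \<Longrightarrow> q \<noteq> [] \<Longrightarrow> path_cost w (p @ tl q) = path_cost w p + path_cost w q"
proof (induction p)
  case (Cons x p)
  show ?case
  proof (cases p)
    case Nil
    with Cons show ?thesis by (cases q) auto
  next
    case (Cons y p')
    with Cons.IH Cons.prems show ?thesis by auto
  qed
qed auto

lemma successively_append_tl:
  "successively R p \<Longrightarrow> successively R q \<Longrightarrow> p \<noteq> [] \<Longrightarrow> q \<noteq> [] \<Longrightarrow> last p = hd q \<Longrightarrow>
    successively R (p @ tl q)"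
  by (cases q; cases "tl q") (auto simp: successively_append_iff)

lemma lattice_path_append:
  assumes "lattice_path x p y" "lattice_path y q z"
  shows "lattice_path x (p @ tl q) z"
    and "path_cost w (p @ tl q) = path_cost w p + path_cost w q"
    and "length (p @ tl q) = length p + length q - 1"
proof -
  show "lattice_path x (p @ tl q) z"
    using assms successively_append_tl[of adjacent p q] unfolding lattice_path_def
    by (cases q) (auto simp: last_append)
  show "path_cost w (p @ tl q) = path_cost w p + path_cost w q"
    using assms by (auto simp: lattice_path_def path_cost_append)
  show "length (p @ tl q) = length p + length q - 1"
    using assms by (cases q) (auto simp: lattice_path_def)
qed

lemma lattice_path_refl [simp]: "lattice_path x [x] x"
  by (simp add: lattice_path_def)

lemma lattice_path_Cons: "adjacent x y \<Longrightarrow> lattice_path y p z \<Longrightarrow> lattice_path x (x # p) z"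
  by (cases p) (auto simp: lattice_path_def)

lemma lattice_path_rev: "lattice_path x p y \<Longrightarrow> lattice_path y (rev p) x"
  by (auto simp: lattice_path_def hd_rev last_rev adjacent_commute intro: successively_mono)

lemma path_cost_rev: "p \<noteq> [] \<Longrightarrow> path_cost w (rev p) = path_cost w p"
proof (induction p)
  case (Cons x p)
  show ?case
  proof (cases p)
    case Nil
    then show ?thesis by simp
  next
    case (Cons y p')
    have "path_cost w (rev p @ tl [y, x]) = path_cost w (rev p) + path_cost w [y, x]"
      using Cons by (intro path_cost_append) auto
    then show ?thesis using Cons Cons.IH by (simp add: insert_commute)
  qed
qed auto

lemma path_cost_nonneg:
  assumes "\<And>e. e \<in> lattice_edges \<Longrightarrow> 0 \<le> w e" "successively adjacent p"
  shows "0 \<le> path_cost w p"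
  unfolding path_cost_def
proof (rule sum_nonneg)
  fix i assume "i \<in> {..<length p - 1}"
  hence "adjacent (p ! i) (p ! Suc i)"
    using assms(2) by (auto simp: successively_conv_nth)
  thus "0 \<le> w {p ! i, p ! Suc i}" by (intro assms(1) adjacent_imp_edge)
qed

lemma l1_lattice_path_le: "lattice_path x p y \<Longrightarrow> l1 (x - y) \<le> length p - 1"
proof (induction p arbitrary: x)
  case (Cons a p)
  show ?case
  proof (cases p)
    case Nil
    then show ?thesis using Cons.prems by (auto simp: lattice_path_def)
  next
    case (Cons b q)
    have "adjacent a b" "lattice_path b p y" "a = x"
      using Cons.prems Cons by (auto simp: lattice_path_def)
    thus ?thesis using Cons.IH[of b] l1_triangle_diff[of x y b] Cons
      by (auto simp: adjacent_iff_l1)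
  qed
qed (auto simp: lattice_path_def)

lemma lattice_path_exists:
  fixes x y :: "int ^ 'n"
  shows "\<exists>p. lattice_path x p y \<and> length p = Suc (l1 (x - y))"
proof (induction "l1 (x - y)" arbitrary: x)
  case 0
  then show ?case by (intro exI[of _ "[x]"]) auto
next
  case (Suc k)
  then obtain i where i: "x $ i \<noteq> y $ i" by (metis l1_eq_0_iff nat.simps(3) right_minus_eq vec_eq_iff)
  \<comment> \<open>One unit step towards \<open>y\<close> in a coordinate where the points
    differ.\<close>
  define z where "z = (\<chi> j. if j = i then x $ i - sgn (x $ i - y $ i) else x $ j)"
  have *: "l1 v = nat \<bar>v $ i\<bar> + (\<Sum>j\<in>UNIV - {i}. nat \<bar>v $ j\<bar>)" for v :: "int ^ 'n"
    unfolding l1_def by (subst sum.remove[of _ i]) auto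
  have "l1 (x - z) = 1"
    using i by (subst *) (auto simp: z_def sgn_if)
  moreover have "l1 (x - y) = Suc (l1 (z - y))"
  proof -
    have "(\<Sum>j\<in>UNIV - {i}. nat \<bar>(x - y) $ j\<bar>) = (\<Sum>j\<in>UNIV - {i}. nat \<bar>(z - y) $ j\<bar>)"
      by (intro sum.cong) (auto simp: z_def)
    moreover have "nat \<bar>(x - y) $ i\<bar> = Suc (nat \<bar>(z - y) $ i\<bar>)"
      using i by (auto simp: z_def sgn_if)
    ultimately show ?thesis unfolding *[of "x - y"] *[of "z - y"] by simp
  qed
  ultimately obtain p where p: "lattice_path z p y" "length p = Suc (l1 (z - y))" "adjacent x z"
    using Suc.hyps(1)[of z] Suc.hyps(2) by (auto simp: adjacent_iff_l1)
  then show ?case using \<open>l1 (x - y) = Suc (l1 (z - y))\<close>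
    by (intro exI[of _ "x # p"]) (auto intro: lattice_path_Cons)
qed

text \<open>The piece between two visits of a vertex is a closed path of nonnegative cost, and
  cutting it out shortens the path. Self-avoiding paths matter because they use each edge once:
  their cost is a sum of independent weights without multiplicities.\<close>

lemma loop_erasure:
  assumes w: "\<And>e. e \<in> lattice_edges \<Longrightarrow> 0 \<le> w e" and "lattice_path x p y"
  shows "\<exists>q. lattice_path x q y \<and> distinct q \<and> length q \<le> length p \<and> path_cost w q \<le> path_cost w p"
  using assms(2)
proof (induction "length p" arbitrary: p rule: less_induct)
  case less
  show ?case
  proof (cases "distinct p")
    case True
    then show ?thesis using less.prems by auto
  next
    case False
    then obtain xs ys zs a where p: "p = xs @ [a] @ ys @ [a] @ zs"
      using not_distinct_decomp by blast
    have s: "successively adjacent (xs @ [a])" "successively adjacent (a # ys @ [a])" 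
      "successively adjacent (a # zs)"
      using less.prems unfolding p lattice_path_def
      by (simp_all add: successively_append_iff successively_Cons) (cases ys; auto simp: successively_append_iff successively_Cons)+
    have c: "path_cost w p = path_cost w (xs @ [a]) + path_cost w (a # ys @ [a]) + path_cost w (a # zs)"
    
      using path_cost_append[of "xs @ [a]" "a # ys @ [a] @ zs" w] path_cost_append[of "a # ys @ [a]" "a # zs" w]
      unfolding p by simp
    define q where "q = (xs @ [a]) @ tl (a # zs)"
    have "path_cost w q = path_cost w (xs @ [a]) + path_cost w (a # zs)"
      unfolding q_def by (rule path_cost_append) auto
    with c path_cost_nonneg[OF w s(2)] have "path_cost w q \<le> path_cost w p" by simp
    moreover have "lattice_path x q y"
      using less.prems successively_append_tl[OF s(1) s(3)] unfolding q_def p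
      by (auto simp: lattice_path_def hd_append split: if_splits)
    moreover have "length q < length p" by (simp add: q_def p)
    ultimately obtain q' where "lattice_path x q' y \<and> distinct q' \<and> length q' \<le> length q \<and> path_cost w q' \<le> path_cost w q"
      using less.hyps by blast
    thus ?thesis using \<open>length q < length p\<close> \<open>path_cost w q \<le> path_cost w p\<close> by (intro exI[of _ q']) auto
  qed
qed

definition path_edges :: "(int ^ 'n) list \<Rightarrow> (int ^ 'n) set set" where
  "path_edges p = (\<lambda>i. {p ! i, p ! Suc i}) ` {..<length p - 1}"

text \<open>Equality of two edges as sets leaves two orientations. Equal orientation gives equal
  indices; opposite orientation would require \<open>i = Suc j\<close> and
  \<open>Suc i = j\<close>.\<close>

lemma inj_on_path_edges:
  assumes "distinct p"
  shows "inj_on (\<lambda>i. {p ! i, p ! Suc i}) {..<length p - 1}"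
proof (rule inj_onI)
  fix i j assume ij: "i \<in> {..<length p - 1}" "j \<in> {..<length p - 1}"
    and eq: "{p ! i, p ! Suc i} = {p ! j, p ! Suc j}"
  have "p ! i = p ! j \<and> p ! Suc i = p ! Suc j \<or> p ! i = p ! Suc j \<and> p ! Suc i = p ! j"
    using eq by (auto simp: doubleton_eq_iff)
  thus "i = j"
  proof
    assume "p ! i = p ! j \<and> p ! Suc i = p ! Suc j"
    thus ?thesis using assms ij nth_eq_iff_index_eq[of p i j] by auto
  next
    assume "p ! i = p ! Suc j \<and> p ! Suc i = p ! j"
    hence "i = Suc j" "Suc i = j"
      using assms ij nth_eq_iff_index_eq[of p i "Suc j"] nth_eq_iff_index_eq[of p "Suc i" j] by auto
    thus ?thesis by simp
  qed
qed

lemma path_cost_eq_sum_edges: "distinct p \<Longrightarrow> path_cost w p = sum w (path_edges p)"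
  unfolding path_cost_def path_edges_def by (subst sum.reindex[OF inj_on_path_edges]) auto

lemma card_path_edges: "distinct p \<Longrightarrow> card (path_edges p) = length p - 1"
  unfolding path_edges_def by (subst card_image[OF inj_on_path_edges]) auto

lemma finite_path_edges [simp]: "finite (path_edges p)"
  by (simp add: path_edges_def)

lemma path_edges_subset: "successively adjacent p \<Longrightarrow> path_edges p \<subseteq> lattice_edges"
  by (auto simp: path_edges_def successively_conv_nth intro!: adjacent_imp_edge)

section \<open>Passage times as a pseudometric\<close>

locale lattice_weights =
  fixes w :: "(int ^ 'n) set \<Rightarrow> real"
  assumes w_nonneg: "\<And>e. e \<in> lattice_edges \<Longrightarrow> 0 \<le> w e"
begin

abbreviation "T \<equiv> passage_time w"

lemma cost_nonneg: "lattice_path x p y \<Longrightarrow> 0 \<le> path_cost w p"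
  using path_cost_nonneg[of w p] w_nonneg by (auto simp: lattice_path_def)

lemma T_le: "lattice_path x p y \<Longrightarrow> T x y \<le> path_cost w p"
  unfolding passage_time_def
  by (intro cInf_lower) (auto simp: bdd_below_def intro!: exI[of _ 0] cost_nonneg)

lemma T_greatest:
  assumes "\<And>p. lattice_path x p y \<Longrightarrow> c \<le> path_cost w p"
  shows "c \<le> T x y"
  unfolding passage_time_def
  using lattice_path_exists[of x y] assms by (intro cInf_greatest) auto

lemma T_greatest_distinct:
  assumes "\<And>p. lattice_path x p y \<Longrightarrow> distinct p \<Longrightarrow> c \<le> path_cost w p"
  shows "c \<le> T x y"
proof (rule T_greatest)
  fix p assume "lattice_path x p y"
  thus "c \<le> path_cost w p" using loop_erasure[of w x p y] w_nonneg assms by (meson order_trans)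
qed

lemma T_lessE:
  assumes "T x y < c"
  obtains p where "lattice_path x p y" "distinct p" "path_cost w p < c"
  using T_greatest_distinct[of x y c] assms by force

lemma T_nonneg [simp]: "0 \<le> T x y"
  by (intro T_greatest cost_nonneg)

lemma T_refl [simp]: "T x x = 0"
  using T_le[of x "[x]" x] T_nonneg[of x x] by simp

lemma T_triangle: "T x z \<le> T x y + T y z"
proof -
  \<comment> \<open>As the infima need not be attained, the bound is proved for pairs of paths and
    the infimum is taken over one path at a time.\<close>
  have "T x z \<le> path_cost w p + path_cost w q" if "lattice_path x p y" "lattice_path y q z" for p q
    using T_le lattice_path_append[OF that] by metis
  hence "T x z - path_cost w p \<le> T y z" if "lattice_path x p y" for p
    using that by (intro T_greatest) (simp add: algebra_simps, metis add.commute)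
  hence "T x z - T y z \<le> T x y"
    by (intro T_greatest) (simp add: algebra_simps)
  thus ?thesis by simp
qed

lemma T_commute: "T x y = T y x"
proof -
  have "T x y \<le> T y x" for x y
  proof (rule T_greatest)
    fix p assume p: "lattice_path y p x"
    hence "T x y \<le> path_cost w (rev p)" by (intro T_le lattice_path_rev)
    also have "\<dots> = path_cost w p" using p by (simp add: path_cost_rev lattice_path_def)
    finally show "T x y \<le> path_cost w p" .
  qed
  thus ?thesis by (simp add: antisym)
qed

lemma T_diff_le: "\<bar>T x y - T x' y'\<bar> \<le> T x x' + T y y'"
  using T_triangle[of x y x'] T_triangle[of x' y y'] T_triangle[of x' y' x] T_triangle[of x y' y]
    T_commute[of x x'] T_commute[of y y'] by linarith

end

text \<open>The ball lies in a cube of side \<open>2 * m + 1\<close>. A polynomial bound of any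
  degree is good enough for union bounds over events of geometrically small probability.\<close>

lemma card_l1_ball:
  shows "finite {x :: int ^ 'n. l1 x \<le> m} \<and> card {x :: int ^ 'n. l1 x \<le> m} \<le> (2 * m + 1) ^ CARD('n)"
proof -
  let ?P = "Pi\<^sub>E (UNIV :: 'n set) (\<lambda>_. {- int m..int m})"
  have sub: "vec_nth ` {x :: int ^ 'n. l1 x \<le> m} \<subseteq> ?P"
  proof
    fix f assume "f \<in> vec_nth ` {x :: int ^ 'n. l1 x \<le> m}"
    then obtain x :: "int ^ 'n" where x: "f = vec_nth x" "l1 x \<le> m" by auto
    have "nat \<bar>x $ i\<bar> \<le> l1 x" for i unfolding l1_def by (rule member_le_sum) auto
    hence "\<bar>x $ i\<bar> \<le> int m" for i using x(2) by (metis nat_le_iff order_trans)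
    hence "- int m \<le> x $ i \<and> x $ i \<le> int m" for i by (simp add: abs_le_iff minus_le_iff)
    thus "f \<in> ?P" using x(1) by auto
  qed
  have inj: "inj_on vec_nth {x :: int ^ 'n. l1 x \<le> m}" by (auto intro!: inj_onI simp: vec_nth_inject)
  have fin: "finite ?P" by (intro finite_PiE) auto
  have "finite {x :: int ^ 'n. l1 x \<le> m}"
    using inj finite_subset[OF sub fin] by (rule finite_imageD[rotated])
  moreover {have "card {x :: int ^ 'n. l1 x \<le> m} = card (vec_nth ` {x :: int ^ 'n. l1 x \<le> m})"
    by (simp add: card_image inj)
  also have "\<dots> \<le> card ?P" by (intro card_mono fin sub)
  also have "\<dots> = (2 * m + 1) ^ CARD('n)" by (simp add: card_PiE nat_add_distrib nat_mult_distrib)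
  finally have "card {x :: int ^ 'n. l1 x \<le> m} \<le> (2 * m + 1) ^ CARD('n)" .}
  ultimately show ?thesis by blast
qed

lemmas finite_l1_ball = card_l1_ball[THEN conjunct1]

context lattice_weights
begin

text \<open>Positive weights alone do not make the infimum over infinitely many paths positive. But
  every path from \<open>x\<close> to another vertex begins with one of the finitely many edges at
  \<open>x\<close>, and the least of their weights is a lower bound.\<close>

lemma T_pos:
  assumes pos: "\<And>e. e \<in> lattice_edges \<Longrightarrow> 0 < w e" and "x \<noteq> y"
  shows "0 < T x y"
proof -
  define S where "S = (\<lambda>v. w {x, x + v}) ` {v. l1 v = 1}"
  have "finite {v :: int ^ 'n. l1 v = 1}" by (rule finite_subset[OF _ finite_l1_ball[of 1]]) auto
  hence "finite S" by (simp add: S_def)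
  have S_pos: "\<forall>s\<in>S. 0 < s"
    by (auto simp: S_def adjacent_iff_l1 l1_minus intro!: pos adjacent_imp_edge)
  obtain c where c: "0 < c" "\<forall>s\<in>S. c \<le> s"
  proof (cases "S = {}")
    case True
    thus ?thesis using that[of 1] by auto
  next
    case False
    thus ?thesis using that[of "Min S"] S_pos \<open>finite S\<close> by auto
  qed
  have "c \<le> path_cost w p" if "lattice_path x p y" for p
  proof -
    from that \<open>x \<noteq> y\<close> obtain z q where p: "p = x # z # q" "adjacent x z" "lattice_path z (z # q) y"
      by (cases p rule: remdups_adj.cases) (auto simp: lattice_path_def)
    have "w {x, z} \<in> S"
      unfolding S_def using p(2) by (intro image_eqI[of _ _ "z - x"]) (auto simp: adjacent_iff_l1 l1_minus_commute)
    with c have "c \<le> w {x, z}" by auto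
    thus ?thesis using p cost_nonneg[OF p(3)] by simp
  qed
  hence "c \<le> T x y" by (rule T_greatest)
  with c show ?thesis by simp
qed

end

section \<open>Paths with boundedly many edges\<close>

definition simple_paths :: "nat \<Rightarrow> int ^ 'n \<Rightarrow> int ^ 'n \<Rightarrow> (int ^ 'n) list set" where
  "simple_paths m x y = {p. lattice_path x p y \<and> distinct p \<and> length p \<le> Suc m}"

text \<open>Bounding the number of edges makes the minimum depend on finitely many edges, while concatenation
  still gives subadditivity. The value is meaningless if \<open>l1 (x - y) > m\<close>.\<close>

definition bounded_time :: "((int ^ 'n) set \<Rightarrow> real) \<Rightarrow> nat \<Rightarrow> int ^ 'n \<Rightarrow> int ^ 'n \<Rightarrow> real" where
  "bounded_time w m x y = Min (path_cost w ` simple_paths m x y)"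

text \<open>Self-avoidance is left out here so that walks can be counted by removing the first step;
  it is added where it is needed. A walk with \<open>k\<close> edges visits \<open>Suc k\<close>
  vertices, the same shift as in \<open>simple_paths\<close>.\<close>

definition walks :: "nat \<Rightarrow> int ^ 'n \<Rightarrow> (int ^ 'n) list set" where
  "walks k x = {p. p \<noteq> [] \<and> hd p = x \<and> successively adjacent p \<and> length p = Suc k}"

definition lattice_degree :: "'n::finite itself \<Rightarrow> nat" where
  "lattice_degree _ = card {v :: int ^ 'n. l1 v = 1}"

lemma finite_walks: "finite (walks k (x :: int ^ 'n))"
  and card_walks: "card (walks k (x :: int ^ 'n)) \<le> lattice_degree TYPE('n) ^ k"
proof -
  have fin: "finite {v :: int ^ 'n. l1 v = 1}" by (rule finite_subset[OF _ finite_l1_ball[of 1]]) auto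
  have "finite (walks k x) \<and> card (walks k x) \<le> lattice_degree TYPE('n) ^ k" for x :: "int ^ 'n"
  proof (induction k arbitrary: x)
    case 0
    have "walks 0 x \<subseteq> {[x]}" by (auto simp: walks_def length_Suc_conv)
    thus ?case using card_mono[of "{[x]}" "walks 0 x"] finite_subset by auto
  next
    case (Suc k)
    have sub: "walks (Suc k) x \<subseteq> (\<Union>v\<in>{v. l1 v = 1}. (#) x ` walks k (x + v))"
    proof
      fix p assume "p \<in> walks (Suc k) x"
      then obtain z q where p: "p = x # z # q" "adjacent x z" "z # q \<in> walks k z"
        by (cases p rule: remdups_adj.cases) (auto simp: walks_def)
      thus "p \<in> (\<Union>v\<in>{v. l1 v = 1}. (#) x ` walks k (x + v))"
        by (intro UN_I[of "z - x"]) (auto simp: adjacent_iff_l1 l1_minus_commute)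
    qed
    have "finite (\<Union>v\<in>{v. l1 v = 1}. (#) x ` walks k (x + v))"
      using Suc fin by auto
    moreover have "card (\<Union>v\<in>{v. l1 v = 1}. (#) x ` walks k (x + v)) \<le> lattice_degree TYPE('n) ^ Suc k"
    proof -
      have "card (\<Union>v\<in>{v. l1 v = 1}. (#) x ` walks k (x + v)) \<le> (\<Sum>v\<in>{v. l1 v = 1}. card ((#) x ` walks k (x + v)))"
        by (rule card_UN_le[OF fin])
      also have "\<dots> \<le> (\<Sum>v\<in>{v :: int ^ 'n. l1 v = 1}. lattice_degree TYPE('n) ^ k)"
      proof (rule sum_mono)
        fix v :: "int ^ 'n"
        show "card ((#) x ` walks k (x + v)) \<le> lattice_degree TYPE('n) ^ k"
          using Suc[of "x + v"] card_image_le[of "walks k (x + v)" "(#) x"] by linarith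
      qed
      also have "\<dots> = lattice_degree TYPE('n) ^ Suc k" by (simp add: lattice_degree_def)
      finally show ?thesis .
    qed
    ultimately show ?case using sub by (meson card_mono finite_subset order_trans)
  qed
  thus "finite (walks k x)" "card (walks k x) \<le> lattice_degree TYPE('n) ^ k" by auto
qed

lemma finite_simple_paths [simp]: "finite (simple_paths m x y)"
proof (rule finite_subset)
  show "simple_paths m x y \<subseteq> (\<Union>k\<le>m. walks k x)"
  proof
    fix p assume "p \<in> simple_paths m x y"
    thus "p \<in> (\<Union>k\<le>m. walks k x)"
      by (intro UN_I[of "length p - 1"]) (auto simp: walks_def simple_paths_def lattice_path_def)
  qed
qed (auto simp: finite_walks)

lemma simple_paths_nonempty:
  assumes "l1 (x - y) \<le> m"
  shows "simple_paths m x y \<noteq> {}"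
proof -
  obtain p where p: "lattice_path x p y" "length p = Suc (l1 (x - y))" using lattice_path_exists by blast
  \<comment> \<open>With all weights \<open>0\<close>, loop erasure serves only to make the path
    distinct without lengthening it.\<close>
  obtain q where "lattice_path x q y" "distinct q" "length q \<le> length p"
    using loop_erasure[of "\<lambda>_. 0" x p y] p by auto
  thus ?thesis using p assms by (auto simp: simple_paths_def)
qed

context lattice_weights
begin

lemma bounded_time_in:
  assumes "l1 (x - y) \<le> m"
  obtains p where "p \<in> simple_paths m x y" "bounded_time w m x y = path_cost w p"
proof -
  have "bounded_time w m x y \<in> path_cost w ` simple_paths m x y"
    unfolding bounded_time_def using simple_paths_nonempty[OF assms] by (intro Min_in) auto
  thus ?thesis using that by auto
qed

lemma bounded_time_le: "p \<in> simple_paths m x y \<Longrightarrow> bounded_time w m x y \<le> path_cost w p"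
  by (simp add: bounded_time_def)

lemma bounded_time_nonneg: "l1 (x - y) \<le> m \<Longrightarrow> 0 \<le> bounded_time w m x y"
  by (rule bounded_time_in[of x y m]) (auto simp: simple_paths_def cost_nonneg)

lemma bounded_time_triangle:
  assumes "l1 (x - y) \<le> m" "l1 (y - z) \<le> n"
  shows "bounded_time w (m + n) x z \<le> bounded_time w m x y + bounded_time w n y z"
proof -
  obtain p where p: "p \<in> simple_paths m x y" "bounded_time w m x y = path_cost w p"
    using bounded_time_in[OF assms(1)] .
  obtain q where q: "q \<in> simple_paths n y z" "bounded_time w n y z = path_cost w q"
    using bounded_time_in[OF assms(2)] .
  have pq: "lattice_path x p y" "lattice_path y q z" using p q by (auto simp: simple_paths_def)
  obtain r where r: "lattice_path x r z" "distinct r" "length r \<le> length (p @ tl q)"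
    "path_cost w r \<le> path_cost w (p @ tl q)"
    using loop_erasure[of w, OF w_nonneg lattice_path_append(1)[OF pq]] by blast
  have "length (p @ tl q) \<le> Suc (m + n)"
    using p(1) q(1) unfolding lattice_path_append(3)[OF pq] by (auto simp: simple_paths_def)
  hence "r \<in> simple_paths (m + n) x z" using r by (auto simp: simple_paths_def)
  thus ?thesis
    using r bounded_time_le[of r "m + n" x z] p(2) q(2) lattice_path_append(2)[OF pq, of w] by simp
qed

text \<open>Paths with more than \<open>m\<close> edges cost at least \<open>c\<close>, which
  exceeds the infimum, so they may be dropped from it.\<close>

lemma bounded_time_eq_T:
  assumes "l1 (x - y) \<le> m" "T x y < c"
    and "\<And>p. lattice_path x p y \<Longrightarrow> distinct p \<Longrightarrow> length p > Suc m \<Longrightarrow> c \<le> path_cost w p"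
  shows "bounded_time w m x y = T x y"
proof (rule antisym)
  \<comment> \<open>The minimum with \<open>c\<close> is below every path cost, long paths included;
    \<open>T x y < c\<close> then decides which of the two terms is the smaller.\<close>
  have "min c (bounded_time w m x y) \<le> T x y"
  proof (rule T_greatest_distinct)
    fix p assume "lattice_path x p y" "distinct p"
    thus "min c (bounded_time w m x y) \<le> path_cost w p"
      using assms(3)[of p] bounded_time_le[of p m x y]
      by (cases "length p > Suc m") (auto simp: simple_paths_def)
  qed
  thus "bounded_time w m x y \<le> T x y" using assms(2) by simp
  show "T x y \<le> bounded_time w m x y"
    using assms(1) by (rule bounded_time_in) (auto simp: simple_paths_def T_le)
qed

end

lemma lattice_path_translate:
  "lattice_path x p y \<Longrightarrow> lattice_path (x + z) (map (\<lambda>v. v + z) p) (y + z)"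
  by (auto simp: lattice_path_def hd_map last_map successively_map adjacent_iff_l1)

lemma simple_paths_translate:
  "simple_paths m (x + z) (y + z) = map (\<lambda>v. v + z) ` simple_paths m x y"
proof (intro equalityI subsetI)
  fix p assume "p \<in> simple_paths m (x + z) (y + z)"
  hence "map (\<lambda>v. v + - z) p \<in> simple_paths m x y"
    using lattice_path_translate[of "x + z" p "y + z" "- z"]
    by (auto simp: simple_paths_def distinct_map intro: inj_onI)
  moreover have "p = map (\<lambda>v. v + z) (map (\<lambda>v. v + - z) p)" by (simp add: o_def)
  ultimately show "p \<in> map (\<lambda>v. v + z) ` simple_paths m x y" by (rule image_eqI[rotated])
qed (auto simp: simple_paths_def distinct_map intro!: inj_onI lattice_path_translate)

lemma path_cost_translate:
  "path_cost w (map (\<lambda>v. v + z) p) = path_cost (\<lambda>e. w ((\<lambda>v. v + z) ` e)) p"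
  by (auto simp: path_cost_def intro!: sum.cong)

lemma bounded_time_translate:
  "bounded_time w m (x + z) (y + z) = bounded_time (\<lambda>e. w ((\<lambda>v. v + z) ` e)) m x y"
  by (simp add: bounded_time_def simple_paths_translate image_image path_cost_translate)

lemma translate_edge_iff [simp]: "(\<lambda>v. v + z) ` e \<in> lattice_edges \<longleftrightarrow> e \<in> lattice_edges"
proof -
  have *: "(\<lambda>v. v + z) ` e \<in> lattice_edges" if "e \<in> lattice_edges" for e and z :: "int ^ 'n"
    using that by (fastforce simp: lattice_edges_def adjacent_iff_l1)
  have "e = (\<lambda>v. v + - z) ` (\<lambda>v. v + z) ` e" by (simp add: image_image)
  thus ?thesis using * by metis
qed

section \<open>Efron--Stein inequality and subadditive sequences\<close>

text \<open>This pointwise inequality replaces the convexity argument in the tensorization of the variance, so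
  that no integrability is needed.\<close>

lemma quadrilateral_inequality:
  fixes a b c d :: real
  shows "(a - d)\<^sup>2 + (b - c)\<^sup>2 \<le> (a - b)\<^sup>2 + (c - d)\<^sup>2 + (a - c)\<^sup>2 + (b - d)\<^sup>2"
proof -
  have "0 \<le> (a - b - c + d)\<^sup>2" by simp
  thus ?thesis by (simp add: power2_eq_square algebra_simps)
qed

text \<open>For square integrable \<open>F\<close> the left-hand side is twice the variance, written
  with an independent copy so that everything stays in nonnegative integrals. Induction on
  \<open>E\<close>: after splitting off coordinate \<open>i\<close>, the two points are
  \<open>x(i := u)\<close> and \<open>y(i := v)\<close>. The integral does not change when
  \<open>u\<close> and \<open>v\<close> are exchanged, and the sum of the two versions is bounded
  through the quadrilateral inequality by terms in which only one of the two parts varies.\<close>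

lemma (in prob_space) efron_stein:
  fixes F :: "('i \<Rightarrow> 'a) \<Rightarrow> real"
  assumes "finite E" "F \<in> borel_measurable (Pi\<^sub>M E (\<lambda>_. M))"
  shows "(\<integral>\<^sup>+x. \<integral>\<^sup>+y. ennreal ((F x - F y)\<^sup>2) \<partial>Pi\<^sub>M E (\<lambda>_. M) \<partial>Pi\<^sub>M E (\<lambda>_. M))
      \<le> (\<Sum>e\<in>E. \<integral>\<^sup>+x. \<integral>\<^sup>+u. ennreal ((F x - F (x(e := u)))\<^sup>2) \<partial>M \<partial>Pi\<^sub>M E (\<lambda>_. M))"
  using assms
proof (induction E arbitrary: F rule: finite_induct)
  case empty
  show ?case by (simp add: PiM_empty nn_integral_count_space_finite)
next
  case (insert i I)
  interpret P: product_sigma_finite "\<lambda>_. M" by standard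
  interpret I: prob_space "Pi\<^sub>M I (\<lambda>_. M)" by (intro prob_space_PiM prob_space_axioms)
  interpret S: pair_sigma_finite "Pi\<^sub>M I (\<lambda>_. M)" M ..
  interpret S2: pair_sigma_finite M "Pi\<^sub>M I (\<lambda>_. M)" ..
  interpret SI: pair_sigma_finite "Pi\<^sub>M I (\<lambda>_. M)" "Pi\<^sub>M I (\<lambda>_. M)" ..
  interpret SM: pair_sigma_finite M M ..
  note F[measurable] = insert.prems
  have upd[measurable]: "(\<lambda>(x, u). x(i := u)) \<in> Pi\<^sub>M I (\<lambda>_. M) \<Otimes>\<^sub>M M \<rightarrow>\<^sub>M Pi\<^sub>M (insert i I) (\<lambda>_. M)"
    by (rule measurable_add_dim)
  let ?P = "Pi\<^sub>M I (\<lambda>_. M)" and ?P' = "Pi\<^sub>M (insert i I) (\<lambda>_. M)"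
  define G where "G x u = F (x(i := u))" for x u
  have G[measurable]: "(\<lambda>z. G (fst z) (snd z)) \<in> borel_measurable (?P \<Otimes>\<^sub>M M)"
    unfolding G_def using measurable_compose[OF upd F] by (simp add: case_prod_beta)
  have G'[measurable (raw)]: "(\<lambda>z. G (f z) (g z)) \<in> borel_measurable N"
    if "f \<in> N \<rightarrow>\<^sub>M ?P" "g \<in> N \<rightarrow>\<^sub>M M" for N :: "'z measure" and f g
    using measurable_compose[OF measurable_Pair[OF that] G] by simp
  have split: "(\<integral>\<^sup>+z. h z \<partial>?P') = (\<integral>\<^sup>+x. \<integral>\<^sup>+u. h (x(i := u)) \<partial>M \<partial>?P)"
    if "h \<in> borel_measurable ?P'" for h
    using P.product_nn_integral_insert[OF insert.hyps(1,2) that] .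
  define Q where "Q x y u v = ennreal ((G x u - G y v)\<^sup>2)" for x y u v
  have Q_meas[measurable (raw)]: "(\<lambda>z. Q (f z) (f' z) (g z) (g' z)) \<in> borel_measurable N"
    if "f \<in> N \<rightarrow>\<^sub>M ?P" "f' \<in> N \<rightarrow>\<^sub>M ?P" "g \<in> N \<rightarrow>\<^sub>M M" "g' \<in> N \<rightarrow>\<^sub>M M" for N :: "'z measure" and f f' g g'
    using that unfolding Q_def by measurable
  have "(\<integral>\<^sup>+x. \<integral>\<^sup>+y. ennreal ((F x - F y)\<^sup>2) \<partial>?P' \<partial>?P') = (\<integral>\<^sup>+x. \<integral>\<^sup>+u. \<integral>\<^sup>+y. \<integral>\<^sup>+v. Q x y u v \<partial>M \<partial>?P \<partial>M \<partial>?P)"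
  proof -
    have "(\<integral>\<^sup>+y. ennreal ((c - F y)\<^sup>2) \<partial>?P') = (\<integral>\<^sup>+y. \<integral>\<^sup>+v. ennreal ((c - G y v)\<^sup>2) \<partial>M \<partial>?P)" for c
      unfolding G_def by (subst split) simp_all
    thus ?thesis unfolding Q_def by (subst split) (simp_all add: G_def)
  qed
  also have "\<dots> = (\<integral>\<^sup>+x. \<integral>\<^sup>+y. \<integral>\<^sup>+u. \<integral>\<^sup>+v. Q x y u v \<partial>M \<partial>M \<partial>?P \<partial>?P)" (is "_ = ?L")
    by (intro nn_integral_cong S2.Fubini'[symmetric]) measurable
  finally have L: "(\<integral>\<^sup>+x. \<integral>\<^sup>+y. ennreal ((F x - F y)\<^sup>2) \<partial>?P' \<partial>?P') = ?L" .
  \<comment> \<open>The exchange of \<open>u\<close> and \<open>v\<close> that symmetrises the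
    integrand.\<close>
  have L': "?L = (\<integral>\<^sup>+x. \<integral>\<^sup>+y. \<integral>\<^sup>+u. \<integral>\<^sup>+v. Q x y v u \<partial>M \<partial>M \<partial>?P \<partial>?P)"
    by (intro nn_integral_cong SM.Fubini') measurable
  \<comment> \<open>\<open>A\<close> resamples only coordinate \<open>i\<close>; \<open>B\<close>
    resamples all the others and keeps \<open>i\<close> fixed.\<close>
  define A where "A = (\<integral>\<^sup>+x. \<integral>\<^sup>+u. \<integral>\<^sup>+v. Q x x u v \<partial>M \<partial>M \<partial>?P)"
  define B where "B = (\<integral>\<^sup>+x. \<integral>\<^sup>+y. \<integral>\<^sup>+u. Q x y u u \<partial>M \<partial>?P \<partial>?P)"
  have one: "emeasure M (space M) = 1" "emeasure ?P (space ?P) = 1"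
    by (rule emeasure_space_1, rule I.emeasure_space_1)
  have add4: "(\<integral>\<^sup>+x. \<integral>\<^sup>+y. \<integral>\<^sup>+u. \<integral>\<^sup>+v. f (x, y, u, v) + g (x, y, u, v) \<partial>M \<partial>M \<partial>?P \<partial>?P)
      = (\<integral>\<^sup>+x. \<integral>\<^sup>+y. \<integral>\<^sup>+u. \<integral>\<^sup>+v. f (x, y, u, v) \<partial>M \<partial>M \<partial>?P \<partial>?P)
        + (\<integral>\<^sup>+x. \<integral>\<^sup>+y. \<integral>\<^sup>+u. \<integral>\<^sup>+v. g (x, y, u, v) \<partial>M \<partial>M \<partial>?P \<partial>?P)"
    if [measurable]: "f \<in> borel_measurable (?P \<Otimes>\<^sub>M ?P \<Otimes>\<^sub>M M \<Otimes>\<^sub>M M)"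
      "g \<in> borel_measurable (?P \<Otimes>\<^sub>M ?P \<Otimes>\<^sub>M M \<Otimes>\<^sub>M M)" for f g :: "_ \<Rightarrow> ennreal"
    by (simp add: nn_integral_add cong: nn_integral_cong_simp)
  have Qm: "(\<lambda>(x, y, u, v). Q x y u v) \<in> borel_measurable (?P \<Otimes>\<^sub>M ?P \<Otimes>\<^sub>M M \<Otimes>\<^sub>M M)"
    "(\<lambda>(x, y, u, v). Q x y v u) \<in> borel_measurable (?P \<Otimes>\<^sub>M ?P \<Otimes>\<^sub>M M \<Otimes>\<^sub>M M)"
    "(\<lambda>(x, y, u, v). Q x x u v) \<in> borel_measurable (?P \<Otimes>\<^sub>M ?P \<Otimes>\<^sub>M M \<Otimes>\<^sub>M M)"
    "(\<lambda>(x, y, u, v). Q y y u v) \<in> borel_measurable (?P \<Otimes>\<^sub>M ?P \<Otimes>\<^sub>M M \<Otimes>\<^sub>M M)"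
    "(\<lambda>(x, y, u, v). Q x y u u) \<in> borel_measurable (?P \<Otimes>\<^sub>M ?P \<Otimes>\<^sub>M M \<Otimes>\<^sub>M M)"
    "(\<lambda>(x, y, u, v). Q x y v v) \<in> borel_measurable (?P \<Otimes>\<^sub>M ?P \<Otimes>\<^sub>M M \<Otimes>\<^sub>M M)"
    by measurable
  have upd2: "(\<lambda>x. (f x)(e := g x)) \<in> N \<rightarrow>\<^sub>M Pi\<^sub>M J (\<lambda>_. M)"
    if "e \<in> J" "f \<in> N \<rightarrow>\<^sub>M Pi\<^sub>M J (\<lambda>_. M)" "g \<in> N \<rightarrow>\<^sub>M M" for e J N f g
    using that by (intro measurable_fun_upd[of J J]) auto
  have "?L + ?L = (\<integral>\<^sup>+x. \<integral>\<^sup>+y. \<integral>\<^sup>+u. \<integral>\<^sup>+v. Q x y u v + Q x y v u \<partial>M \<partial>M \<partial>?P \<partial>?P)"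
  proof -
    have "?L + ?L = ?L + (\<integral>\<^sup>+x. \<integral>\<^sup>+y. \<integral>\<^sup>+u. \<integral>\<^sup>+v. Q x y v u \<partial>M \<partial>M \<partial>?P \<partial>?P)" using L' by simp
    also have "\<dots> = (\<integral>\<^sup>+x. \<integral>\<^sup>+y. \<integral>\<^sup>+u. \<integral>\<^sup>+v. Q x y u v + Q x y v u \<partial>M \<partial>M \<partial>?P \<partial>?P)"
      using add4[OF Qm(1,2)] unfolding prod.case by (rule sym)
    finally show ?thesis .
  qed
  also have "\<dots> \<le> (\<integral>\<^sup>+x. \<integral>\<^sup>+y. \<integral>\<^sup>+u. \<integral>\<^sup>+v. (Q x x u v + Q y y u v) + (Q x y u u + Q x y v v) \<partial>M \<partial>M \<partial>?P \<partial>?P)"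
  proof (intro nn_integral_mono)
    fix x y u v
    \<comment> \<open>In the quadrilateral of the values at \<open>(x, u)\<close>,
      \<open>(x, v)\<close>, \<open>(y, v)\<close>, \<open>(y, u)\<close>, the left-hand side
      consists of the diagonals and the right-hand side of the four sides.\<close>
    show "Q x y u v + Q x y v u \<le> (Q x x u v + Q y y u v) + (Q x y u u + Q x y v v)"
      using quadrilateral_inequality[of "G x u" "G y v" "G x v" "G y u"]
      unfolding Q_def by (simp add: ennreal_plus[symmetric] algebra_simps del: ennreal_plus)
  qed
  also have "\<dots> = ((\<integral>\<^sup>+x. \<integral>\<^sup>+y. \<integral>\<^sup>+u. \<integral>\<^sup>+v. Q x x u v \<partial>M \<partial>M \<partial>?P \<partial>?P) + (\<integral>\<^sup>+x. \<integral>\<^sup>+y. \<integral>\<^sup>+u. \<integral>\<^sup>+v. Q y y u v \<partial>M \<partial>M \<partial>?P \<partial>?P))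
      + ((\<integral>\<^sup>+x. \<integral>\<^sup>+y. \<integral>\<^sup>+u. \<integral>\<^sup>+v. Q x y u u \<partial>M \<partial>M \<partial>?P \<partial>?P) + (\<integral>\<^sup>+x. \<integral>\<^sup>+y. \<integral>\<^sup>+u. \<integral>\<^sup>+v. Q x y v v \<partial>M \<partial>M \<partial>?P \<partial>?P))"
    using add4[OF borel_measurable_add[OF Qm(3,4)] borel_measurable_add[OF Qm(5,6)]]
    unfolding add4[OF Qm(3,4), unfolded prod.case] add4[OF Qm(5,6), unfolded prod.case] prod.case .
  also have "\<dots> = (A + A) + (B + B)"
    unfolding A_def B_def by (simp only: nn_integral_const one mult_1_right)
  finally have "?L + ?L \<le> (A + B) + (A + B)" by (simp add: algebra_simps)
  hence "?L \<le> A + B"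
    unfolding mult_2[symmetric] by (subst (asm) ennreal_mult_le_mult_iff) auto
  moreover have "A = (\<integral>\<^sup>+x. \<integral>\<^sup>+u. ennreal ((F x - F (x(i := u)))\<^sup>2) \<partial>M \<partial>?P')"
  proof -
    note [measurable (raw)] = upd2[OF insertI1]
    show ?thesis unfolding A_def Q_def G_def by (subst split) simp_all
  qed
  moreover have "B \<le> (\<Sum>e\<in>I. \<integral>\<^sup>+x. \<integral>\<^sup>+u. ennreal ((F x - F (x(e := u)))\<^sup>2) \<partial>M \<partial>?P')"
  proof -
    \<comment> \<open>With \<open>u\<close> integrated outermost, the induction hypothesis applies
      to \<open>\<lambda>x. G x u\<close> for each fixed \<open>u\<close>.\<close>
    have "B = (\<integral>\<^sup>+u. \<integral>\<^sup>+x. \<integral>\<^sup>+y. Q x y u u \<partial>?P \<partial>?P \<partial>M)"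
    proof -
      have "B = (\<integral>\<^sup>+x. \<integral>\<^sup>+u. \<integral>\<^sup>+y. Q x y u u \<partial>?P \<partial>M \<partial>?P)"
        unfolding B_def by (intro nn_integral_cong S2.Fubini') measurable
      also have "\<dots> = (\<integral>\<^sup>+u. \<integral>\<^sup>+x. \<integral>\<^sup>+y. Q x y u u \<partial>?P \<partial>?P \<partial>M)"
        by (intro S.Fubini'[symmetric]) measurable
      finally show ?thesis .
    qed
    also have "\<dots> \<le> (\<integral>\<^sup>+u. (\<Sum>e\<in>I. \<integral>\<^sup>+x. \<integral>\<^sup>+v. ennreal ((G x u - G (x(e := v)) u)\<^sup>2) \<partial>M \<partial>?P) \<partial>M)"
      unfolding Q_def by (intro nn_integral_mono insert.IH) measurable
    also have "\<dots> = (\<Sum>e\<in>I. \<integral>\<^sup>+u. \<integral>\<^sup>+x. \<integral>\<^sup>+v. ennreal ((G x u - G (x(e := v)) u)\<^sup>2) \<partial>M \<partial>?P \<partial>M)"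
    proof (intro nn_integral_sum)
      fix e assume e: "e \<in> I"
      note [measurable (raw)] = upd2[OF e]
      show "(\<lambda>u. \<integral>\<^sup>+x. \<integral>\<^sup>+v. ennreal ((G x u - G (x(e := v)) u)\<^sup>2) \<partial>M \<partial>?P) \<in> borel_measurable M"
        by measurable
    qed
    also have "\<dots> = (\<Sum>e\<in>I. \<integral>\<^sup>+x. \<integral>\<^sup>+u. ennreal ((F x - F (x(e := u)))\<^sup>2) \<partial>M \<partial>?P')"
    proof (intro sum.cong refl)
      fix e assume e: "e \<in> I"
      note [measurable (raw)] = upd2[OF e] upd2[OF insertI2[OF e]]
      have "e \<noteq> i" using e insert.hyps by auto
      hence "(\<integral>\<^sup>+x. \<integral>\<^sup>+u. ennreal ((F x - F (x(e := u)))\<^sup>2) \<partial>M \<partial>?P')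
        = (\<integral>\<^sup>+x. \<integral>\<^sup>+u. \<integral>\<^sup>+v. ennreal ((G x u - G (x(e := v)) u)\<^sup>2) \<partial>M \<partial>M \<partial>?P)"
        unfolding G_def by (subst split) (measurable, simp add: fun_upd_twist)
      also have "\<dots> = (\<integral>\<^sup>+u. \<integral>\<^sup>+x. \<integral>\<^sup>+v. ennreal ((G x u - G (x(e := v)) u)\<^sup>2) \<partial>M \<partial>?P \<partial>M)"
        by (intro S.Fubini'[symmetric]) measurable
      finally show "(\<integral>\<^sup>+u. \<integral>\<^sup>+x. \<integral>\<^sup>+v. ennreal ((G x u - G (x(e := v)) u)\<^sup>2) \<partial>M \<partial>?P \<partial>M)
        = (\<integral>\<^sup>+x. \<integral>\<^sup>+u. ennreal ((F x - F (x(e := u)))\<^sup>2) \<partial>M \<partial>?P')" ..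
    qed
    finally show ?thesis .
  qed
  ultimately show ?case unfolding L sum.insert[OF insert.hyps]
    by (metis (no_types, lifting) add_left_mono order_trans)
qed

text \<open>Exchanging the old and the new value of coordinate \<open>e\<close> preserves the
  product measure, so both signs of the increment contribute equally. Keeping only increases is
  essential for passage times: an increase requires that \<open>e\<close> lie on every optimal path,
  whereas a decrease can be caused by any of the many edges off the optimal path.\<close>

lemma (in prob_space) efron_stein_positive_part:
  fixes F :: "('i \<Rightarrow> 'a) \<Rightarrow> real"
  assumes "finite E" and F[measurable]: "F \<in> borel_measurable (Pi\<^sub>M E (\<lambda>_. M))"
  shows "(\<integral>\<^sup>+x. \<integral>\<^sup>+y. ennreal ((F x - F y)\<^sup>2) \<partial>Pi\<^sub>M E (\<lambda>_. M) \<partial>Pi\<^sub>M E (\<lambda>_. M))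
      \<le> 2 * (\<Sum>e\<in>E. \<integral>\<^sup>+x. \<integral>\<^sup>+u. ennreal ((max 0 (F (x(e := u)) - F x))\<^sup>2) \<partial>M \<partial>Pi\<^sub>M E (\<lambda>_. M))"
proof -
  interpret P: product_sigma_finite "\<lambda>_. M" by standard
  interpret SM: pair_sigma_finite M M ..
  let ?P = "Pi\<^sub>M E (\<lambda>_. M)"
  have "(\<integral>\<^sup>+x. \<integral>\<^sup>+u. ennreal ((F x - F (x(e := u)))\<^sup>2) \<partial>M \<partial>?P)
    = 2 * (\<integral>\<^sup>+x. \<integral>\<^sup>+u. ennreal ((max 0 (F (x(e := u)) - F x))\<^sup>2) \<partial>M \<partial>?P)"
    if e: "e \<in> E" for e
  proof -
    let ?P' = "Pi\<^sub>M (E - {e}) (\<lambda>_. M)"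
    have upd[measurable (raw)]: "(\<lambda>x. (f x)(e := g x)) \<in> N \<rightarrow>\<^sub>M ?P"
      if "f \<in> N \<rightarrow>\<^sub>M ?P" "g \<in> N \<rightarrow>\<^sub>M M" for N f g
      using that e by (intro measurable_fun_upd[of E E]) auto
    have upd'[measurable (raw)]: "(\<lambda>x. (f x)(e := g x)) \<in> N \<rightarrow>\<^sub>M ?P"
      if "f \<in> N \<rightarrow>\<^sub>M ?P'" "g \<in> N \<rightarrow>\<^sub>M M" for N f g
      using that e by (intro measurable_fun_upd[of E "E - {e}"]) auto
    have split: "(\<integral>\<^sup>+z. h z \<partial>?P) = (\<integral>\<^sup>+x. \<integral>\<^sup>+u. h (x(e := u)) \<partial>M \<partial>?P')"
      if "h \<in> borel_measurable (?P)" for h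
      using P.product_nn_integral_insert[of "E - {e}" e h] that \<open>finite E\<close> e by (simp add: insert_absorb)
    define G where "G x u = F (x(e := u))" for x u
    have G[measurable (raw)]: "(\<lambda>z. G (f z) (g z)) \<in> borel_measurable N"
      if "f \<in> N \<rightarrow>\<^sub>M ?P'" "g \<in> N \<rightarrow>\<^sub>M M" for N :: "'z measure" and f g
      using that unfolding G_def by measurable
    have "(\<integral>\<^sup>+x. \<integral>\<^sup>+u. ennreal ((F x - F (x(e := u)))\<^sup>2) \<partial>M \<partial>?P)
      = (\<integral>\<^sup>+x. \<integral>\<^sup>+v. \<integral>\<^sup>+u. ennreal ((G x v - G x u)\<^sup>2) \<partial>M \<partial>M \<partial>?P')"
      by (subst split) (simp_all add: G_def)
    also have "\<dots> = (\<integral>\<^sup>+x. (\<integral>\<^sup>+v. \<integral>\<^sup>+u. ennreal ((max 0 (G x u - G x v))\<^sup>2) \<partial>M \<partial>M)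
        + (\<integral>\<^sup>+v. \<integral>\<^sup>+u. ennreal ((max 0 (G x v - G x u))\<^sup>2) \<partial>M \<partial>M) \<partial>?P')"
    proof (intro nn_integral_cong)
      fix x assume x: "x \<in> space (?P')"
      have H[measurable]: "G x \<in> borel_measurable M"
        using x unfolding G_def by measurable
      have "(\<integral>\<^sup>+v. \<integral>\<^sup>+u. ennreal ((G x v - G x u)\<^sup>2) \<partial>M \<partial>M)
        = (\<integral>\<^sup>+v. \<integral>\<^sup>+u. ennreal ((max 0 (G x u - G x v))\<^sup>2) + ennreal ((max 0 (G x v - G x u))\<^sup>2) \<partial>M \<partial>M)"
        by (intro nn_integral_cong) (auto simp: max_def power2_commute)
      also have "\<dots> = (\<integral>\<^sup>+v. \<integral>\<^sup>+u. ennreal ((max 0 (G x u - G x v))\<^sup>2) \<partial>M \<partial>M)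
        + (\<integral>\<^sup>+v. \<integral>\<^sup>+u. ennreal ((max 0 (G x v - G x u))\<^sup>2) \<partial>M \<partial>M)"
        by (simp add: nn_integral_add)
      finally show "(\<integral>\<^sup>+v. \<integral>\<^sup>+u. ennreal ((G x v - G x u)\<^sup>2) \<partial>M \<partial>M) = \<dots>" .
    qed
    also have "\<dots> = (\<integral>\<^sup>+x. 2 * (\<integral>\<^sup>+v. \<integral>\<^sup>+u. ennreal ((max 0 (G x u - G x v))\<^sup>2) \<partial>M \<partial>M) \<partial>?P')"
    proof (intro nn_integral_cong)
      fix x assume [measurable]: "x \<in> space (?P')"
      have "(\<integral>\<^sup>+v. \<integral>\<^sup>+u. ennreal ((max 0 (G x v - G x u))\<^sup>2) \<partial>M \<partial>M)
        = (\<integral>\<^sup>+v. \<integral>\<^sup>+u. ennreal ((max 0 (G x u - G x v))\<^sup>2) \<partial>M \<partial>M)"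
        by (intro SM.Fubini') measurable
      thus "(\<integral>\<^sup>+v. \<integral>\<^sup>+u. ennreal ((max 0 (G x u - G x v))\<^sup>2) \<partial>M \<partial>M)
        + (\<integral>\<^sup>+v. \<integral>\<^sup>+u. ennreal ((max 0 (G x v - G x u))\<^sup>2) \<partial>M \<partial>M)
        = 2 * (\<integral>\<^sup>+v. \<integral>\<^sup>+u. ennreal ((max 0 (G x u - G x v))\<^sup>2) \<partial>M \<partial>M)" by (simp add: mult_2)
    qed
    also have "\<dots> = 2 * (\<integral>\<^sup>+x. \<integral>\<^sup>+v. \<integral>\<^sup>+u. ennreal ((max 0 (G x u - G x v))\<^sup>2) \<partial>M \<partial>M \<partial>?P')"
      by (intro nn_integral_cmult) measurable
    also have "(\<integral>\<^sup>+x. \<integral>\<^sup>+v. \<integral>\<^sup>+u. ennreal ((max 0 (G x u - G x v))\<^sup>2) \<partial>M \<partial>M \<partial>?P')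
      = (\<integral>\<^sup>+x. \<integral>\<^sup>+u. ennreal ((max 0 (F (x(e := u)) - F x))\<^sup>2) \<partial>M \<partial>?P)"
      by (subst split) (simp_all add: G_def)
    finally show ?thesis .
  qed
  thus ?thesis using efron_stein[OF assms] by (simp add: sum_distrib_left)
qed

text \<open>Fekete's lemma. Division with remainder by a nearly optimal \<open>m\<close> leaves
  remainders \<open>r < m\<close>, whose values \<open>g r\<close> are bounded by a constant and
  disappear after division by \<open>n\<close>.\<close>

lemma fekete:
  fixes g :: "nat \<Rightarrow> real"
  assumes sub: "\<And>m n. g (m + n) \<le> g m + g n" and nonneg: "\<And>n. 0 \<le> g n"
  shows "convergent (\<lambda>n. g n / real n)"
proof -
  define L where "L = (INF n\<in>{1..}. g n / real n)"
  have bdd: "bdd_below ((\<lambda>n. g n / real n) ` {1..})"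
    using nonneg by (intro bdd_belowI[of _ 0]) auto
  have mult: "g (q * m + r) \<le> real q * g m + g r" for q m r
  proof (induction q)
    case (Suc q)
    have "g (Suc q * m + r) \<le> g m + g (q * m + r)" using sub[of m "q * m + r"] by (simp add: algebra_simps)
    with Suc show ?case by (simp add: algebra_simps)
  qed simp
  have "(\<lambda>n. g n / real n) \<longlonglongrightarrow> L"
  proof (rule LIMSEQ_I)
    fix e :: real assume "0 < e"
    have "\<exists>x\<in>(\<lambda>n. g n / real n) ` {1..}. x < L + e / 2"
      unfolding L_def using \<open>0 < e\<close> by (subst cInf_less_iff[symmetric]) (use bdd in auto)
    then obtain m where m: "1 \<le> m" "g m / real m < L + e / 2" by auto
    define C where "C = Max (g ` {..<m})"
    have C: "g r \<le> C" if "r < m" for r unfolding C_def using that by (intro Max_ge) auto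
    have "0 \<le> C" using C[of 0] nonneg[of 0] m by linarith
    obtain n0 :: nat where n0: "C / (e / 2) < real n0" using reals_Archimedean2 by blast
    show "\<exists>no. \<forall>n\<ge>no. norm (g n / real n - L) < e"
    proof (intro exI[of _ "Suc n0"] allI impI)
      fix n assume n: "Suc n0 \<le> n"
      have "g n \<le> real (n div m) * g m + g (n mod m)" using mult[of "n div m" m "n mod m"] by simp
      also have "\<dots> \<le> real n / real m * g m + C"
        using m C[of "n mod m"] nonneg[of m] by (intro add_mono mult_right_mono) (auto simp: of_nat_div_le_of_nat)
      finally have "g n / real n \<le> (real n / real m * g m + C) / real n"
        using n by (intro divide_right_mono) auto
      also have "\<dots> = g m / real m + C / real n" using n by (simp add: field_simps)
      also have "C / real n < e / 2" using n0 n \<open>0 < e\<close> by (simp add: field_simps) (smt (verit) mult_mono of_nat_mono \<open>0 \<le> C\<close> mult_left_mono of_nat_Suc)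
      finally have "g n / real n < L + e" using m(2) by simp
      moreover have "L \<le> g n / real n" unfolding L_def using n by (intro cINF_lower bdd) auto
      ultimately show "norm (g n / real n - L) < e" by simp
    qed
  qed
  thus ?thesis by (auto simp: convergent_def)
qed

section \<open>Exponential bounds for path costs\<close>

text \<open>The term of degree \<open>m\<close> in the exponential series bounds the polynomial by a
  multiple of \<open>exp (1/4) ^ k\<close>, and \<open>exp (1/4) < 2\<close>.\<close>

lemma summable_poly_geometric: "summable (\<lambda>k. (real k + 1) ^ m * (1 / 2) ^ k)"
proof (rule summable_comparison_test)
  define C :: real where "C = fact m * 4 ^ m * exp (1/4)"
  show "\<exists>N. \<forall>k\<ge>N. norm ((real k + 1) ^ m * (1 / 2) ^ k) \<le> C * (exp (1/4) / 2) ^ k"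
  proof (intro exI allI impI)
    fix k :: nat
    have "((real k + 1) / 4) ^ m / fact m \<le> exp ((real k + 1) / 4)"
    proof -
      have "(\<Sum>i\<in>{m}. ((real k + 1) / 4) ^ i /\<^sub>R fact i) \<le> (\<Sum>i. ((real k + 1) / 4) ^ i /\<^sub>R fact i)"
        by (intro sum_le_suminf summable_exp_generic) auto
      moreover have "z ^ m / fact m = (\<Sum>i\<in>{m}. z ^ i /\<^sub>R fact i)" for z :: real
        by (simp add: divide_inverse)
      ultimately show ?thesis unfolding exp_def by presburger
    qed
    hence "(real k + 1) ^ m \<le> fact m * 4 ^ m * exp ((real k + 1) / 4)"
      by (simp add: power_divide field_simps)
    also have "exp ((real k + 1) / 4) = exp (1/4) * exp (1/4) ^ k"
      by (simp add: exp_of_nat_mult[symmetric] exp_add[symmetric] field_simps)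
    finally have "(real k + 1) ^ m \<le> C * exp (1/4) ^ k" by (simp add: C_def mult_ac)
    hence "(real k + 1) ^ m * (1/2) ^ k \<le> C * exp (1/4) ^ k * (1/2) ^ k" by (intro mult_right_mono) auto
    thus "norm ((real k + 1) ^ m * (1 / 2) ^ k) \<le> C * (exp (1/4) / 2) ^ k"
      by (simp add: power_divide)
  qed
  have "exp (1/4 :: real) < 2"
  proof -
    have "exp (1/4 :: real) \<le> exp (1/4) ^ 4" by (intro self_le_power) auto
    also have "exp (1/4 :: real) ^ 4 = exp 1" by (simp add: exp_of_nat_mult[symmetric])
    have "exp (1/4 :: real) \<le> 1 + 1/4 + (1/4)^2" by (rule exp_bound) auto
    thus ?thesis by (simp add: power2_eq_square)
  qed
  thus "summable (\<lambda>k. C * (exp (1/4) / 2) ^ k)"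
    by (intro summable_mult summable_geometric) auto
qed

text \<open>\<open>law_pos\<close> condenses what the density and nonnegativity give, since a
  density has no atom at \<open>0\<close>. It drives the lower bounds on path costs, and
  \<open>law_exp\<close> the upper ones.\<close>

locale iid_weights = prob_space M for M :: "'w measure" +
  fixes \<tau> :: "(int ^ 'n) set \<Rightarrow> 'w \<Rightarrow> real" and \<nu> :: "real measure" and \<alpha> :: real
  assumes indep: "indep_vars (\<lambda>_. borel) \<tau> lattice_edges"
    and law: "\<And>e. e \<in> lattice_edges \<Longrightarrow> distr M borel (\<tau> e) = \<nu>"
    and prob_law: "prob_space \<nu>" and sets_law [measurable_cong, simp]: "sets \<nu> = sets borel"
    and law_pos: "AE x in \<nu>. 0 < x"
    and alpha_pos: "0 < \<alpha>"
    and law_exp: "integrable \<nu> (\<lambda>x. exp (\<alpha> * x))"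
begin

lemma space_law [simp]: "space \<nu> = UNIV"
  using sets_eq_imp_space_eq[OF sets_law] by simp

lemma rv [measurable]: "e \<in> lattice_edges \<Longrightarrow> random_variable borel (\<tau> e)"
  using indep by (auto simp: indep_vars_def)

lemma AE_weights_pos: "AE \<omega> in M. \<forall>e\<in>lattice_edges. 0 < \<tau> e \<omega>"
proof -
  have "countable (lattice_edges :: (int ^ 'n) set set)"
  proof (rule countable_subset)
    show "lattice_edges \<subseteq> (\<lambda>(x, y). {x, y}) ` (UNIV :: ((int ^ 'n) \<times> (int ^ 'n)) set)"
      by (auto simp: lattice_edges_def)
  qed auto
  moreover have "AE \<omega> in M. 0 < \<tau> e \<omega>" if "e \<in> lattice_edges" for e
    using law_pos that unfolding law[OF that, symmetric] by (subst (asm) AE_distr_iff) auto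
  ultimately show ?thesis by (subst AE_ball_countable) auto
qed

lemma measurable_path_cost [measurable]:
  "successively adjacent p \<Longrightarrow> (\<lambda>\<omega>. path_cost (\<lambda>e. \<tau> e \<omega>) p) \<in> borel_measurable M"
  unfolding path_cost_def
  by (intro borel_measurable_sum rv adjacent_imp_edge) (auto simp: successively_conv_nth)

lemma nn_integral_exp_path_cost:
  assumes "successively adjacent p" "distinct p"
  shows "(\<integral>\<^sup>+\<omega>. ennreal (exp (\<theta> * path_cost (\<lambda>e. \<tau> e \<omega>) p)) \<partial>M)
    = (\<integral>\<^sup>+x. ennreal (exp (\<theta> * x)) \<partial>\<nu>) ^ (length p - 1)"
proof -
  have sub: "path_edges p \<subseteq> lattice_edges" using path_edges_subset[OF assms(1)] .
  have "(\<integral>\<^sup>+\<omega>. ennreal (exp (\<theta> * path_cost (\<lambda>e. \<tau> e \<omega>) p)) \<partial>M)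
    = (\<integral>\<^sup>+\<omega>. (\<Prod>e\<in>path_edges p. ennreal (exp (\<theta> * \<tau> e \<omega>))) \<partial>M)"
    by (intro nn_integral_cong)
      (simp add: path_cost_eq_sum_edges[OF assms(2)] sum_distrib_left exp_sum prod_ennreal)
  also have "\<dots> = (\<Prod>e\<in>path_edges p. \<integral>\<^sup>+\<omega>. ennreal (exp (\<theta> * \<tau> e \<omega>)) \<partial>M)"
    by (intro indep_vars_nn_integral indep_vars_compose2[OF indep_vars_subset[OF indep sub]]) auto
  also have "\<dots> = (\<Prod>e\<in>path_edges p. \<integral>\<^sup>+x. ennreal (exp (\<theta> * x)) \<partial>\<nu>)"
  proof (intro prod.cong refl)
    fix e assume "e \<in> path_edges p"
    hence e: "e \<in> lattice_edges" using sub by auto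
    show "(\<integral>\<^sup>+\<omega>. ennreal (exp (\<theta> * \<tau> e \<omega>)) \<partial>M) = (\<integral>\<^sup>+x. ennreal (exp (\<theta> * x)) \<partial>\<nu>)"
      unfolding law[OF e, symmetric] using e by (subst nn_integral_distr) auto
  qed
  finally show ?thesis by (simp add: card_path_edges[OF assms(2)])
qed

text \<open>Markov's inequality for \<open>exp (\<theta> * cost)\<close>. The sign of
  \<open>\<theta>\<close> is left open: negative values give the lower tail and positive ones the
  upper tail. The factor \<open>r\<close> is what remains per edge after the threshold
  \<open>c\<close> has been paid for.\<close>

lemma chernoff_path_cost:
  assumes "successively adjacent p" "distinct p" "length p = Suc k"
    and "(\<integral>\<^sup>+x. ennreal (exp (\<theta> * x)) \<partial>\<nu>) \<le> ennreal (exp (\<theta> * c) * r)" "0 \<le> r"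
  shows "measure M {\<omega> \<in> space M. \<theta> * (c * real k) \<le> \<theta> * path_cost (\<lambda>e. \<tau> e \<omega>) p} \<le> r ^ k"
proof -
  note [measurable] = measurable_path_cost[OF assms(1)]
  have "emeasure M {\<omega> \<in> space M. \<theta> * (c * real k) \<le> \<theta> * path_cost (\<lambda>e. \<tau> e \<omega>) p}
    = emeasure M {\<omega> \<in> space M. 1 \<le> ennreal (exp (- \<theta> * c) ^ k) * ennreal (exp (\<theta> * path_cost (\<lambda>e. \<tau> e \<omega>) p))}"
  proof (rule arg_cong[where f = "emeasure M"], rule Collect_cong, rule conj_cong[OF refl])
    fix \<omega>
    have "ennreal (exp (- \<theta> * c) ^ k) * ennreal (exp (\<theta> * path_cost (\<lambda>e. \<tau> e \<omega>) p))
      = ennreal (exp (\<theta> * path_cost (\<lambda>e. \<tau> e \<omega>) p - \<theta> * (c * real k)))"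
      by (simp add: ennreal_mult[symmetric] exp_of_nat_mult[symmetric] exp_add[symmetric] exp_minus field_simps exp_diff power_inverse)
    thus "\<theta> * (c * real k) \<le> \<theta> * path_cost (\<lambda>e. \<tau> e \<omega>) p \<longleftrightarrow>
       1 \<le> ennreal (exp (- \<theta> * c) ^ k) * ennreal (exp (\<theta> * path_cost (\<lambda>e. \<tau> e \<omega>) p))"
      by simp
  qed
  also have "\<dots> \<le> ennreal (exp (- \<theta> * c) ^ k) * (\<integral>\<^sup>+\<omega>. ennreal (exp (\<theta> * path_cost (\<lambda>e. \<tau> e \<omega>) p)) \<partial>M)"
  proof -
    have "emeasure M ({\<omega> \<in> space M. 1 \<le> ennreal (exp (- \<theta> * c) ^ k) * ennreal (exp (\<theta> * path_cost (\<lambda>e. \<tau> e \<omega>) p))})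
      \<le> ennreal (exp (- \<theta> * c) ^ k) * (\<integral>\<^sup>+\<omega>. ennreal (exp (\<theta> * path_cost (\<lambda>e. \<tau> e \<omega>) p)) * indicator (space M) \<omega> \<partial>M)"
      by (rule order_trans[OF _ nn_integral_Markov_inequality]) (auto intro!: emeasure_mono)
    also have "(\<integral>\<^sup>+\<omega>. ennreal (exp (\<theta> * path_cost (\<lambda>e. \<tau> e \<omega>) p)) * indicator (space M) \<omega> \<partial>M)
      = (\<integral>\<^sup>+\<omega>. ennreal (exp (\<theta> * path_cost (\<lambda>e. \<tau> e \<omega>) p)) \<partial>M)"
      by (intro nn_integral_cong) simp
    finally show ?thesis .
  qed
  also have "\<dots> \<le> ennreal (exp (- \<theta> * c) ^ k) * ennreal (exp (\<theta> * c) * r) ^ k"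
    unfolding nn_integral_exp_path_cost[OF assms(1,2)] assms(3) diff_Suc_1
    using assms(4) by (intro mult_left_mono power_mono) auto
  also have "\<dots> = ennreal (r ^ k)"
    using \<open>0 \<le> r\<close> by (simp add: ennreal_power ennreal_mult[symmetric] power_mult_distrib[symmetric] exp_add[symmetric] mult.assoc[symmetric])
  finally show ?thesis using \<open>0 \<le> r\<close> by (simp add: emeasure_eq_measure)
qed

text \<open>Borel-Cantelli for unions of bad events; both applications reduce to a polynomial factor
  times \<open>(1/2) ^ k\<close>. The clause \<open>\<omega> \<in> space M\<close> allows the
  complement of an event of the form \<open>{\<omega> \<in> space M. P \<omega>}\<close> to be
  unfolded.\<close>

lemma AE_union_bound:
  fixes W :: "nat \<Rightarrow> 'i set" and B :: "nat \<Rightarrow> 'i \<Rightarrow> 'w set"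
  assumes fin: "\<And>k. finite (W k)"
    and meas: "\<And>k i. i \<in> W k \<Longrightarrow> B k i \<in> sets M"
    and prob: "\<And>k i. i \<in> W k \<Longrightarrow> measure M (B k i) \<le> b k"
    and card: "\<And>k. real (card (W k)) * b k \<le> C * ((real k + 1) ^ m * (1 / 2) ^ k)"
  shows "AE \<omega> in M. eventually (\<lambda>k. \<omega> \<in> space M \<and> (\<forall>i\<in>W k. \<omega> \<notin> B k i)) sequentially"
proof -
  define A where "A k = (\<Union>i\<in>W k. B k i)" for k
  have A: "A k \<in> sets M" for k unfolding A_def using meas fin by auto
  have "measure M (A k) \<le> C * ((real k + 1) ^ m * (1 / 2) ^ k)" for k
  proof -
    have "measure M (A k) \<le> (\<Sum>i\<in>W k. measure M (B k i))"
      unfolding A_def using meas fin by (intro measure_UNION_le) auto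
    also have "\<dots> \<le> (\<Sum>i\<in>W k. b k)" by (intro sum_mono prob)
    also have "\<dots> \<le> C * ((real k + 1) ^ m * (1 / 2) ^ k)" using card by simp
    finally show ?thesis .
  qed
  hence "summable (\<lambda>k. measure M (A k))"
    by (intro summable_comparison_test[OF _ summable_mult[OF summable_poly_geometric]]) auto
  hence "AE \<omega> in M. eventually (\<lambda>k. \<omega> \<in> space M - A k) sequentially"
    using A by (intro borel_cantelli_AE1) (auto simp: emeasure_eq_measure)
  thus ?thesis by (simp add: A_def)
qed

text \<open>Dominated convergence with bound \<open>1\<close>: positivity of the weights makes
  \<open>exp (- n * x)\<close> tend to \<open>0\<close> almost everywhere. An atom at
  \<open>0\<close> would keep the transform away from \<open>0\<close>.\<close>

lemma laplace_small:
  assumes "0 < r"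
  obtains \<theta> where "0 < \<theta>" "(\<integral>\<^sup>+x. ennreal (exp (- \<theta> * x)) \<partial>\<nu>) \<le> ennreal r"
proof -
  interpret N: prob_space \<nu> by (rule prob_law)
  have int: "integrable \<nu> (\<lambda>x. exp (- (real (Suc n)) * x))" for n
  proof (rule Bochner_Integration.integrable_bound[of _ "\<lambda>_. 1 :: real"])
    show "AE x in \<nu>. norm (exp (- (real (Suc n)) * x)) \<le> norm (1 :: real)"
      using law_pos by eventually_elim (auto simp: mult_nonpos_nonneg)
  qed auto
  have "(\<lambda>n. \<integral>x. exp (- real (Suc n) * x) \<partial>\<nu>) \<longlonglongrightarrow> (\<integral>x. 0 \<partial>\<nu>)"
  proof (rule integral_dominated_convergence[where w = "\<lambda>_. 1"])
    show "AE x in \<nu>. (\<lambda>n. exp (- real (Suc n) * x)) \<longlonglongrightarrow> 0"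
      using law_pos
    proof eventually_elim
      case (elim x)
      have "(\<lambda>n. exp (- x) ^ Suc n) \<longlonglongrightarrow> 0"
        using elim by (intro LIMSEQ_Suc[of "\<lambda>n. exp (- x) ^ n"] LIMSEQ_power_zero) auto
      thus ?case by (simp only: exp_of_nat_mult[symmetric] mult_minus_right mult_minus_left)
    qed
    show "AE x in \<nu>. norm (exp (- real (Suc n) * x)) \<le> 1" for n
      using law_pos by eventually_elim (auto simp: mult_nonpos_nonneg)
  qed auto
  hence "eventually (\<lambda>n. (\<integral>x. exp (- real (Suc n) * x) \<partial>\<nu>) < r) sequentially"
    using assms by (intro order_tendstoD) auto
  then obtain n where n: "(\<integral>x. exp (- real (Suc n) * x) \<partial>\<nu>) < r" by (auto simp: eventually_sequentially)
  have "(\<integral>\<^sup>+x. ennreal (exp (- real (Suc n) * x)) \<partial>\<nu>) = ennreal (\<integral>x. exp (- real (Suc n) * x) \<partial>\<nu>)"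
    by (intro nn_integral_eq_integral int) auto
  also have "\<dots> \<le> ennreal r" using n by (intro ennreal_leI) simp
  finally show ?thesis using that[of "real (Suc n)"] by simp
qed

text \<open>Starting points range over a ball of radius \<open>k\<^sup>2\<close>: the union bound stays summable, and for large
  \<open>n\<close> this ball contains any fixed multiple of the \<open>n\<close>-ball as soon as \<open>k\<close> is of order \<open>n\<close>.\<close>

lemma AE_long_paths_expensive:
  obtains a where "0 < a"
    "AE \<omega> in M. eventually (\<lambda>k. \<forall>(x :: int ^ 'n) p. l1 x \<le> k\<^sup>2 \<longrightarrow> p \<in> walks k x \<longrightarrow> distinct p \<longrightarrow>
       a * real k \<le> path_cost (\<lambda>e. \<tau> e \<omega>) p) sequentially"
proof -
  define D where "D = real (lattice_degree TYPE('n)) + 1"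
  have D: "0 < D" by (simp add: D_def)
  obtain \<theta> where \<theta>: "0 < \<theta>" "(\<integral>\<^sup>+x. ennreal (exp (- \<theta> * x)) \<partial>\<nu>) \<le> ennreal (1 / (4 * D))"
    using laplace_small[of "1 / (4 * D)"] D by auto
  \<comment> \<open>The choice \<open>exp (- \<theta> * a) = 1/2\<close> spends a factor
    \<open>1/2\<close> of \<open>1 / (4 * D)\<close> on the threshold. Each edge keeps
    \<open>1 / (2 * D)\<close>, of which \<open>1 / D\<close> pays for the at most
    \<open>D ^ k\<close> walks and \<open>1/2\<close> is left for summability.\<close>
  define a where "a = ln 2 / \<theta>"
  have a: "0 < a" using \<theta> by (simp add: a_def)
  have bound: "(\<integral>\<^sup>+x. ennreal (exp (- \<theta> * x)) \<partial>\<nu>) \<le> ennreal (exp (- \<theta> * a) * (1 / (2 * D)))"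
    using \<theta> by (simp add: a_def exp_minus field_simps)
  define W where "W k = (SIGMA x:{x :: int ^ 'n. l1 x \<le> k\<^sup>2}. {p \<in> walks k x. distinct p})" for k
  have finW: "finite (W k)" for k
    unfolding W_def by (intro finite_SigmaI finite_l1_ball) (auto simp: finite_walks)
  define B where "B k xp = {\<omega> \<in> space M. path_cost (\<lambda>e. \<tau> e \<omega>) (snd xp) \<le> a * real k}"
    for k and xp :: "(int ^ 'n) \<times> (int ^ 'n) list"
  have B: "B k xp \<in> sets M" "measure M (B k xp) \<le> (1 / (2 * D)) ^ k" if "xp \<in> W k" for k xp
  proof -
    have p: "successively adjacent (snd xp)" "distinct (snd xp)" "length (snd xp) = Suc k"
      using that by (auto simp: W_def walks_def)
    have eq: "B k xp = {\<omega> \<in> space M. - \<theta> * (a * real k) \<le> - \<theta> * path_cost (\<lambda>e. \<tau> e \<omega>) (snd xp)}"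
      unfolding B_def using \<theta>(1) by (auto simp: mult_le_cancel_left)
    show "B k xp \<in> sets M" using measurable_path_cost[OF p(1)] unfolding B_def by measurable
    show "measure M (B k xp) \<le> (1 / (2 * D)) ^ k"
      unfolding eq using D by (intro chernoff_path_cost[OF p bound]) auto
  qed
  have cardW: "card (W k) \<le> (2 * k\<^sup>2 + 1) ^ CARD('n) * lattice_degree TYPE('n) ^ k" for k
  proof -
    have "card (W k) = (\<Sum>x\<in>{x :: int ^ 'n. l1 x \<le> k\<^sup>2}. card {p \<in> walks k x. distinct p})"
      unfolding W_def
      by (subst card_SigmaI) (auto intro: finite_l1_ball finite_subset[OF _ finite_walks])
    also have "\<dots> \<le> (\<Sum>x\<in>{x :: int ^ 'n. l1 x \<le> k\<^sup>2}. lattice_degree TYPE('n) ^ k)"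
      by (intro sum_mono order_trans[OF card_mono card_walks] finite_walks) auto
    also have "\<dots> \<le> (2 * k\<^sup>2 + 1) ^ CARD('n) * lattice_degree TYPE('n) ^ k"
      using card_l1_ball[where 'n = 'n, of "k\<^sup>2"] by simp
    finally show ?thesis .
  qed
  have small: "real (card (W k)) * (1 / (2 * D)) ^ k \<le> 2 ^ CARD('n) * ((real k + 1) ^ (2 * CARD('n)) * (1 / 2) ^ k)" for k
  proof -
    have "real (card (W k)) * (1 / (2 * D)) ^ k \<le> real ((2 * k\<^sup>2 + 1) ^ CARD('n) * lattice_degree TYPE('n) ^ k) * (1 / (2 * D)) ^ k"
      using D cardW by (intro mult_right_mono of_nat_mono) auto
    also have "\<dots> \<le> real ((2 * k\<^sup>2 + 1) ^ CARD('n)) * D ^ k * (1 / (2 * D)) ^ k"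
      using D by (intro mult_right_mono) (auto simp: D_def intro!: mult_left_mono power_mono)
    also have "\<dots> = (2 * (real k)\<^sup>2 + 1) ^ CARD('n) * (1 / 2) ^ k"
      using D by (simp add: power_mult_distrib[symmetric] mult.assoc add.commute)
    also have "\<dots> \<le> (2 * (real k + 1)\<^sup>2) ^ CARD('n) * (1 / 2) ^ k"
      by (intro mult_right_mono power_mono) (auto simp: power2_eq_square algebra_simps)
    finally show ?thesis by (simp add: power_mult_distrib power_mult mult.assoc)
  qed
  have "AE \<omega> in M. eventually (\<lambda>k. \<omega> \<in> space M \<and> (\<forall>i\<in>W k. \<omega> \<notin> B k i)) sequentially"
    by (rule AE_union_bound[OF finW B small])
  then have "AE \<omega> in M. eventually (\<lambda>k. \<forall>(x :: int ^ 'n) p. l1 x \<le> k\<^sup>2 \<longrightarrow> p \<in> walks k x \<longrightarrow> distinct p \<longrightarrow>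
       a * real k \<le> path_cost (\<lambda>e. \<tau> e \<omega>) p) sequentially"
  proof eventually_elim
    case (elim \<omega>)
    thus ?case
    proof eventually_elim
      case (elim k)
      show ?case
      proof (intro allI impI)
        fix x :: "int ^ 'n" and p assume "l1 x \<le> k\<^sup>2" "p \<in> walks k x" "distinct p"
        hence "(x, p) \<in> W k" by (auto simp: W_def)
        hence "\<omega> \<notin> B k (x, p)" using elim by blast
        thus "a * real k \<le> path_cost (\<lambda>e. \<tau> e \<omega>) p" using elim by (auto simp: B_def)
      qed
    qed
  qed
  thus ?thesis using that a by blast
qed

text \<open>An upper bound on \<open>T x y\<close> requires only one path per pair. For shortest
  paths the number of edges is exactly \<open>k\<close>, and the union bound runs over polynomially
  many pairs.\<close>

lemma AE_T_linear_bound: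
  obtains A where "0 < A"
    "AE \<omega> in M. eventually (\<lambda>k. \<forall>x y. l1 x \<le> k\<^sup>2 \<longrightarrow> l1 (y - x) = k \<longrightarrow>
       passage_time (\<lambda>e. \<tau> e \<omega>) x y \<le> A * real k) sequentially"
proof -
  interpret N: prob_space \<nu> by (rule prob_law)
  define m where "m = (\<integral>x. exp (\<alpha> * x) \<partial>\<nu>) + 1"
  have "0 \<le> (\<integral>x. exp (\<alpha> * x) \<partial>\<nu>)" by (intro integral_nonneg_AE) auto
  hence m: "1 \<le> m" by (simp add: m_def)
  \<comment> \<open>Chosen so that \<open>exp (\<alpha> * A) = 2 * m\<close>; the \<open>+ 1\<close>
    in \<open>m\<close> makes \<open>2 * m > 1\<close>, hence \<open>A\<close> positive.\<close>
  define A where "A = ln (2 * m) / \<alpha>"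
  have A: "0 < A" using m alpha_pos by (simp add: A_def)
  have "(\<integral>\<^sup>+x. ennreal (exp (\<alpha> * x)) \<partial>\<nu>) = ennreal (\<integral>x. exp (\<alpha> * x) \<partial>\<nu>)"
    by (intro nn_integral_eq_integral law_exp) auto
  also have "\<dots> \<le> ennreal m" by (intro ennreal_leI) (simp add: m_def)
  also have "m = exp (\<alpha> * A) * (1 / 2)" using m alpha_pos by (simp add: A_def)
  finally have bound: "(\<integral>\<^sup>+x. ennreal (exp (\<alpha> * x)) \<partial>\<nu>) \<le> ennreal (exp (\<alpha> * A) * (1 / 2))" .
  have "\<exists>p. lattice_path x p y \<and> distinct p \<and> length p = Suc (l1 (x - y))" for x y :: "int ^ 'n"
  proof -
    obtain p where p: "lattice_path x p y" "length p = Suc (l1 (x - y))" using lattice_path_exists by blast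
    obtain q where q: "lattice_path x q y" "distinct q" "length q \<le> length p"
      using loop_erasure[of "\<lambda>_. 0" x p y] p by auto
    have "length q = Suc (l1 (x - y))"
      using q p l1_lattice_path_le[OF q(1)] by (cases q) (auto simp: lattice_path_def)
    with q show ?thesis by blast
  qed
  then obtain P where P: "\<And>x y :: int ^ 'n. lattice_path x (P x y) y" "\<And>x y. distinct (P x y)"
    "\<And>x y. length (P x y) = Suc (l1 (x - y))" by metis
  define W where "W k = {x :: int ^ 'n. l1 x \<le> k\<^sup>2} \<times> {v :: int ^ 'n. l1 v \<le> k} \<inter> {(x, v). l1 v = k}" for k
  have finW: "finite (W k)" for k unfolding W_def using finite_l1_ball by auto
  define B where "B k xv = {\<omega> \<in> space M. A * real k \<le> path_cost (\<lambda>e. \<tau> e \<omega>) (P (fst xv) (fst xv + snd xv))}"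
    for k and xv :: "(int ^ 'n) \<times> (int ^ 'n)"
  have B: "B k xv \<in> sets M" "measure M (B k xv) \<le> (1 / 2) ^ k" if "xv \<in> W k" for k xv
  proof -
    define p where "p = P (fst xv) (fst xv + snd xv)"
    have p: "successively adjacent p" "distinct p" "length p = Suc k"
      using that P by (auto simp: W_def p_def lattice_path_def l1_minus)
    have eq: "B k xv = {\<omega> \<in> space M. \<alpha> * (A * real k) \<le> \<alpha> * path_cost (\<lambda>e. \<tau> e \<omega>) p}"
      unfolding B_def p_def using alpha_pos by (auto simp: mult_le_cancel_left)
    show "B k xv \<in> sets M" using measurable_path_cost[OF p(1)] unfolding B_def p_def by measurable
    show "measure M (B k xv) \<le> (1 / 2) ^ k"
      unfolding eq by (intro chernoff_path_cost[OF p bound]) auto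
  qed
  have cardW: "card (W k) \<le> (2 * k\<^sup>2 + 1) ^ CARD('n) * (2 * k + 1) ^ CARD('n)" for k
  proof -
    have "card (W k) \<le> card ({x :: int ^ 'n. l1 x \<le> k\<^sup>2} \<times> {v :: int ^ 'n. l1 v \<le> k})"
      unfolding W_def by (intro card_mono finite_cartesian_product finite_l1_ball) auto
    also have "\<dots> \<le> (2 * k\<^sup>2 + 1) ^ CARD('n) * (2 * k + 1) ^ CARD('n)"
      unfolding card_cartesian_product using card_l1_ball[where 'n = 'n] by (intro mult_mono) auto
    finally show ?thesis .
  qed
  have small: "real (card (W k)) * (1 / 2) ^ k \<le> 4 ^ CARD('n) * ((real k + 1) ^ (3 * CARD('n)) * (1 / 2) ^ k)" for k
  proof -
    have "real (card (W k)) * (1 / 2) ^ k \<le> real ((2 * k\<^sup>2 + 1) ^ CARD('n) * (2 * k + 1) ^ CARD('n)) * (1 / 2) ^ k"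
      using cardW by (intro mult_right_mono of_nat_mono) auto
    also have "\<dots> = (2 * (real k)\<^sup>2 + 1) ^ CARD('n) * (2 * real k + 1) ^ CARD('n) * (1 / 2) ^ k"
      by (simp add: add.commute)
    also have "\<dots> \<le> (2 * (real k + 1)\<^sup>2) ^ CARD('n) * (2 * (real k + 1)) ^ CARD('n) * (1 / 2) ^ k"
      by (intro mult_right_mono mult_mono power_mono) (auto simp: power2_eq_square algebra_simps)
    also have "\<dots> = (4 * (real k + 1) ^ 3) ^ CARD('n) * (1 / 2) ^ k"
    proof -
      have "2 * x\<^sup>2 * (2 * x) = 4 * x ^ 3" for x :: real by (simp add: power2_eq_square power3_eq_cube)
      thus ?thesis by (simp only: power_mult_distrib[symmetric])
    qed
    finally show ?thesis by (simp add: power_mult_distrib power_mult mult.assoc)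
  qed
  have "AE \<omega> in M. eventually (\<lambda>k. \<omega> \<in> space M \<and> (\<forall>i\<in>W k. \<omega> \<notin> B k i)) sequentially"
    by (rule AE_union_bound[OF finW B small])
  with AE_weights_pos have "AE \<omega> in M. eventually (\<lambda>k. \<forall>x y. l1 x \<le> k\<^sup>2 \<longrightarrow> l1 (y - x) = k \<longrightarrow>
       passage_time (\<lambda>e. \<tau> e \<omega>) x y \<le> A * real k) sequentially"
  proof eventually_elim
    case (elim \<omega>)
    interpret lattice_weights "\<lambda>e. \<tau> e \<omega>" using elim(1) by unfold_locales (auto intro: less_imp_le)
    from elim(2) show ?case
    proof eventually_elim
      case (elim k)
      show ?case
      proof (intro allI impI)
        fix x y :: "int ^ 'n" assume "l1 x \<le> k\<^sup>2" "l1 (y - x) = k"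
        hence "(x, y - x) \<in> W k" by (auto simp: W_def)
        hence "\<omega> \<notin> B k (x, y - x)" using elim by blast
        hence "path_cost (\<lambda>e. \<tau> e \<omega>) (P x y) \<le> A * real k" using elim by (auto simp: B_def)
        thus "T x y \<le> A * real k" using T_le[OF P(1)] by (rule order_trans[rotated])
      qed
    qed
  qed
  thus ?thesis using that A by blast
qed

end

section \<open>Variance of the time over bounded paths\<close>

text \<open>The additional edge makes the set nonempty, as required to identify the joint law of its weights.\<close>

definition time_edges :: "nat \<Rightarrow> int ^ 'n \<Rightarrow> int ^ 'n \<Rightarrow> (int ^ 'n) set set" where
  "time_edges m x y = insert {0, axis undefined 1} (\<Union>p\<in>simple_paths m x y. path_edges p)"

lemma finite_time_edges [simp]: "finite (time_edges m x y)"
  by (simp add: time_edges_def)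

lemma time_edges_nonempty [simp]: "time_edges m x y \<noteq> {}"
  by (simp add: time_edges_def)

lemma l1_axis [simp]: "l1 (axis i c :: int ^ 'n) = nat \<bar>c\<bar>"
proof -
  have "l1 (axis i c :: int ^ 'n) = (\<Sum>j\<in>{i}. nat \<bar>axis i c $ j\<bar>)"
    unfolding l1_def by (rule sum.mono_neutral_right) (auto simp: axis_def)
  thus ?thesis by simp
qed

lemma time_edges_subset: "time_edges m x y \<subseteq> lattice_edges"
  using path_edges_subset
  by (fastforce simp: time_edges_def simple_paths_def lattice_path_def adjacent_iff_l1 l1_minus intro!: adjacent_imp_edge)

lemma path_edges_subset_time_edges: "p \<in> simple_paths m x y \<Longrightarrow> path_edges p \<subseteq> time_edges m x y"
  by (auto simp: time_edges_def)

lemma path_cost_cong_edges: "(\<And>e. e \<in> path_edges p \<Longrightarrow> w e = w' e) \<Longrightarrow> path_cost w p = path_cost w' p"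
  by (auto simp: path_cost_def path_edges_def intro!: sum.cong)

lemma bounded_time_cong:
  assumes "\<And>e. e \<in> time_edges m x y \<Longrightarrow> w e = w' e"
  shows "bounded_time w m x y = bounded_time w' m x y"
  unfolding bounded_time_def
  using assms path_edges_subset_time_edges
  by (intro arg_cong[where f = Min] image_cong refl path_cost_cong_edges) blast

text \<open>On the product space the coordinates may be negative. With
  \<open>\<bar>w e\<bar>\<close> the weights are nonnegative everywhere, so that the lemmas on
  \<open>lattice_weights\<close> apply pointwise; for the actual weights the absolute value changes
  nothing almost surely.\<close>

lemma measurable_path_cost_PiM:
  assumes "path_edges p \<subseteq> E" "sets \<nu> = sets borel"
  shows "(\<lambda>w. path_cost (\<lambda>e. \<bar>w e\<bar>) p) \<in> borel_measurable (Pi\<^sub>M E (\<lambda>_. \<nu>))"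
  unfolding path_cost_def
proof (rule borel_measurable_sum)
  fix i assume "i \<in> {..<length p - 1}"
  hence "{p ! i, p ! Suc i} \<in> E" using assms(1) by (auto simp: path_edges_def)
  hence "(\<lambda>w. w {p ! i, p ! Suc i}) \<in> measurable (Pi\<^sub>M E (\<lambda>_. \<nu>)) \<nu>"
    by (rule measurable_component_singleton)
  hence "(\<lambda>w. w {p ! i, p ! Suc i}) \<in> borel_measurable (Pi\<^sub>M E (\<lambda>_. \<nu>))"
    using measurable_cong_sets[OF refl assms(2)] by blast
  thus "(\<lambda>w. \<bar>w {p ! i, p ! Suc i}\<bar>) \<in> borel_measurable (Pi\<^sub>M E (\<lambda>_. \<nu>))" by measurable
qed

lemma measurable_bounded_time_PiM:
  assumes "sets \<nu> = sets borel"
  shows "(\<lambda>w. bounded_time (\<lambda>e. \<bar>w e\<bar>) m x y) \<in> borel_measurable (Pi\<^sub>M (time_edges m x y) (\<lambda>_. \<nu>))"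
  unfolding bounded_time_def
  using measurable_path_cost_PiM[OF path_edges_subset_time_edges assms]
  by (intro borel_measurable_Min) auto

lemma path_cost_update_le:
  assumes "distinct p"
  shows "path_cost (\<lambda>e'. \<bar>(w(e := u)) e'\<bar>) p \<le> path_cost (\<lambda>e'. \<bar>w e'\<bar>) p + \<bar>u\<bar>"
proof -
  have "(\<Sum>e'\<in>path_edges p. \<bar>(w(e := u)) e'\<bar>) \<le> (\<Sum>e'\<in>path_edges p. \<bar>w e'\<bar> + (if e' = e then \<bar>u\<bar> else 0))"
    by (intro sum_mono) auto
  also have "\<dots> \<le> (\<Sum>e'\<in>path_edges p. \<bar>w e'\<bar>) + \<bar>u\<bar>" by (simp add: sum.distrib)
  finally show ?thesis by (simp add: path_cost_eq_sum_edges[OF assms])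
qed

text \<open>The weights for which all optimal paths use \<open>e\<close>. Raising the weight of \<open>e\<close> has no effect on the
  time otherwise, and at most \<open>m\<close> edges are pivotal at once; hence the variance is linear in \<open>m\<close>.\<close>

definition pivotal_weights :: "nat \<Rightarrow> int ^ 'n \<Rightarrow> int ^ 'n \<Rightarrow> (int ^ 'n) set \<Rightarrow> ((int ^ 'n) set \<Rightarrow> real) set" where
  "pivotal_weights m x y e = {w. \<forall>p\<in>simple_paths m x y. e \<notin> path_edges p \<longrightarrow>
     bounded_time (\<lambda>e. \<bar>w e\<bar>) m x y < path_cost (\<lambda>e. \<bar>w e\<bar>) p}"

text \<open>The bound uses the new weight \<open>\<bar>u\<bar>\<close> instead of the increment. As
  the pivotal event depends only on \<open>w\<close>, the integral over \<open>u\<close> then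
  factors out as a second moment.\<close>

lemma bounded_time_update_le:
  assumes "l1 (x - y) \<le> m"
  shows "max 0 (bounded_time (\<lambda>e'. \<bar>(w(e := u)) e'\<bar>) m x y - bounded_time (\<lambda>e'. \<bar>w e'\<bar>) m x y)
    \<le> \<bar>u\<bar> * indicator (pivotal_weights m x y e) w"
proof -
  interpret w: lattice_weights "\<lambda>e. \<bar>w e\<bar>" by unfold_locales auto
  interpret w': lattice_weights "\<lambda>e'. \<bar>(w(e := u)) e'\<bar>" by unfold_locales auto
  show ?thesis
  proof (cases "w \<in> pivotal_weights m x y e")
    case True
    obtain p where p: "p \<in> simple_paths m x y" "bounded_time (\<lambda>e. \<bar>w e\<bar>) m x y = path_cost (\<lambda>e. \<bar>w e\<bar>) p"
      using w.bounded_time_in[OF assms] .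
    thus ?thesis using path_cost_update_le[of p w e u] w'.bounded_time_le[OF p(1)] True
      by (auto simp: simple_paths_def)
  next
    case False
    then obtain p where p: "p \<in> simple_paths m x y" "e \<notin> path_edges p"
      "path_cost (\<lambda>e. \<bar>w e\<bar>) p \<le> bounded_time (\<lambda>e. \<bar>w e\<bar>) m x y"
      by (auto simp: pivotal_weights_def not_less)
    have "path_cost (\<lambda>e'. \<bar>(w(e := u)) e'\<bar>) p = path_cost (\<lambda>e'. \<bar>w e'\<bar>) p"
      using p(2) by (intro path_cost_cong_edges) auto
    thus ?thesis using w'.bounded_time_le[OF p(1)] p(3) False by auto
  qed
qed

text \<open>A pivotal edge lies on every optimal path, in particular on a single fixed one, which
  has at most \<open>m\<close> edges.\<close>

lemma sum_pivotal_le: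
  assumes "l1 (x - y) \<le> m"
  shows "(\<Sum>e\<in>time_edges m x y. indicator (pivotal_weights m x y e) w) \<le> (of_nat m :: ennreal)"
proof -
  interpret w: lattice_weights "\<lambda>e. \<bar>w e\<bar>" by unfold_locales auto
  obtain p where p: "p \<in> simple_paths m x y" "bounded_time (\<lambda>e. \<bar>w e\<bar>) m x y = path_cost (\<lambda>e. \<bar>w e\<bar>) p"
    using w.bounded_time_in[OF assms] .
  have "(\<Sum>e\<in>time_edges m x y. indicator (pivotal_weights m x y e) w) \<le>
      (\<Sum>e\<in>time_edges m x y. indicator (path_edges p) e :: ennreal)"
    using p by (intro sum_mono) (auto simp: pivotal_weights_def split: split_indicator)
  also have "\<dots> = of_nat (card (time_edges m x y \<inter> path_edges p))"
    unfolding indicator_def by (subst sum_of_bool_eq) auto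
  also have "card (time_edges m x y \<inter> path_edges p) \<le> card (path_edges p)" by (intro card_mono) auto
  also have "card (path_edges p) \<le> m" using p by (auto simp: simple_paths_def card_path_edges)
  finally show ?thesis by simp
qed

context iid_weights
begin

abbreviation "Time m x y \<omega> \<equiv> bounded_time (\<lambda>e. \<tau> e \<omega>) m x y"

lemma measurable_Time [measurable]: "Time m x y \<in> borel_measurable M"
  unfolding bounded_time_def
  by (intro borel_measurable_Min finite_simple_paths measurable_path_cost) (auto simp: simple_paths_def lattice_path_def)

lemma law_square: "integrable \<nu> (\<lambda>x. x\<^sup>2)"
proof (rule Bochner_Integration.integrable_bound)
  show "integrable \<nu> (\<lambda>x. 2 / \<alpha>\<^sup>2 * exp (\<alpha> * x))" using law_exp by simp
  show "AE x in \<nu>. norm (x\<^sup>2) \<le> norm (2 / \<alpha>\<^sup>2 * exp (\<alpha> * x))"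
    using law_pos
  proof eventually_elim
    case (elim x)
    have "1 + \<alpha> * x + (\<alpha> * x)\<^sup>2 / 2 \<le> exp (\<alpha> * x)"
      using elim alpha_pos by (intro exp_lower_Taylor_quadratic) auto
    moreover have "0 \<le> \<alpha> * x" using elim alpha_pos by simp
    ultimately have "(\<alpha> * x)\<^sup>2 \<le> 2 * exp (\<alpha> * x)" by linarith
    thus ?case using alpha_pos by (simp add: field_simps power_mult_distrib)
  qed
qed measurable

lemma integrable_weight_square: "e \<in> lattice_edges \<Longrightarrow> integrable M (\<lambda>\<omega>. (\<tau> e \<omega>)\<^sup>2)"
  using law_square law[of e] integrable_distr_eq[of "\<tau> e" M borel "\<lambda>x. x\<^sup>2"] by simp

lemma AE_lattice_weights: "AE \<omega> in M. lattice_weights (\<lambda>e. \<tau> e \<omega>)"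
  using AE_weights_pos by eventually_elim (auto simp: lattice_weights_def less_imp_le)

lemma integrable_Time_square:
  assumes "l1 (x - y) \<le> m"
  shows "integrable M (\<lambda>\<omega>. (Time m x y \<omega>)\<^sup>2)"
proof -
  obtain p where p: "p \<in> simple_paths m x y" using simple_paths_nonempty[OF assms] by auto
  have sub: "path_edges p \<subseteq> lattice_edges"
    using p path_edges_subset by (auto simp: simple_paths_def lattice_path_def)
  show ?thesis
  proof (rule Bochner_Integration.integrable_bound)
    show "integrable M (\<lambda>\<omega>. real (card (path_edges p)) * (\<Sum>e\<in>path_edges p. (\<tau> e \<omega>)\<^sup>2))"
      using sub by (intro integrable_mult_right Bochner_Integration.integrable_sum integrable_weight_square) auto
    show "AE \<omega> in M. norm ((Time m x y \<omega>)\<^sup>2) \<le> norm (real (card (path_edges p)) * (\<Sum>e\<in>path_edges p. (\<tau> e \<omega>)\<^sup>2))"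
      using AE_lattice_weights
    proof eventually_elim
      case (elim \<omega>)
      then interpret lattice_weights "\<lambda>e. \<tau> e \<omega>" .
      have "(Time m x y \<omega>)\<^sup>2 \<le> (\<Sum>e\<in>path_edges p. \<tau> e \<omega>)\<^sup>2"
        using bounded_time_le[OF p] bounded_time_nonneg[OF assms] p path_cost_eq_sum_edges
        by (intro power_mono) (auto simp: simple_paths_def path_cost_eq_sum_edges)
      also have "\<dots> \<le> real (card (path_edges p)) * (\<Sum>e\<in>path_edges p. (\<tau> e \<omega>)\<^sup>2)"
        using sum_squared_le_sum_of_squares[of "\<lambda>e. \<tau> e \<omega>" "path_edges p"] by (simp add: mult.commute)
      finally show ?case by (simp add: abs_mult sum_nonneg)
    qed
  qed measurable
qed

lemma integrable_Time: "l1 (x - y) \<le> m \<Longrightarrow> integrable M (Time m x y)"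
  by (rule square_integrable_imp_integrable[OF _ integrable_Time_square]) auto

lemma distr_weights:
  assumes "J \<noteq> {}" "J \<subseteq> lattice_edges"
  shows "distr M (Pi\<^sub>M J (\<lambda>_. borel)) (\<lambda>\<omega>. \<lambda>e\<in>J. \<tau> e \<omega>) = Pi\<^sub>M J (\<lambda>_. \<nu>)"
proof -
  have "distr M (Pi\<^sub>M J (\<lambda>_. borel)) (\<lambda>\<omega>. \<lambda>e\<in>J. \<tau> e \<omega>) = Pi\<^sub>M J (\<lambda>e. distr M borel (\<tau> e))"
    using assms indep_vars_subset[OF indep assms(2)]
    by (subst indep_vars_iff_distr_eq_PiM'[symmetric]) auto
  also have "\<dots> = Pi\<^sub>M J (\<lambda>_. \<nu>)" using assms law by (intro PiM_cong) auto
  finally show ?thesis .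
qed

definition time_weights where "time_weights m x y \<omega> = (\<lambda>e\<in>time_edges m x y. \<tau> e \<omega>)"

lemma distr_time_weights: "distr M (Pi\<^sub>M (time_edges m x y) (\<lambda>_. \<nu>)) (time_weights m x y) = Pi\<^sub>M (time_edges m x y) (\<lambda>_. \<nu>)"
proof -
  have "distr M (Pi\<^sub>M (time_edges m x y) (\<lambda>_. \<nu>)) (time_weights m x y)
    = distr M (Pi\<^sub>M (time_edges m x y) (\<lambda>_. borel)) (\<lambda>\<omega>. \<lambda>e\<in>time_edges m x y. \<tau> e \<omega>)"
    by (intro distr_cong sets_PiM_cong) (auto simp: time_weights_def)
  thus ?thesis using distr_weights[OF time_edges_nonempty time_edges_subset] by simp
qed

lemma measurable_time_weights [measurable]: "time_weights m x y \<in> M \<rightarrow>\<^sub>M Pi\<^sub>M (time_edges m x y) (\<lambda>_. \<nu>)"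
  unfolding time_weights_def[abs_def]
  using time_edges_subset[of m x y] by (intro measurable_restrict) (auto simp: measurable_cong_sets[OF refl sets_law] intro!: rv)

lemma AE_Time_eq: "AE \<omega> in M. Time m x y \<omega> = bounded_time (\<lambda>e. \<bar>time_weights m x y \<omega> e\<bar>) m x y"
  using AE_lattice_weights
  by eventually_elim
    (use time_edges_subset in \<open>force intro!: bounded_time_cong simp: time_weights_def lattice_weights_def\<close>)

lemma expectation_Time:
  "expectation (Time m x y) = (\<integral>w. bounded_time (\<lambda>e. \<bar>w e\<bar>) m x y \<partial>Pi\<^sub>M (time_edges m x y) (\<lambda>_. \<nu>))"
proof -
  note [measurable] = measurable_bounded_time_PiM[OF sets_law]
  have "expectation (Time m x y) = expectation (\<lambda>\<omega>. bounded_time (\<lambda>e. \<bar>time_weights m x y \<omega> e\<bar>) m x y)"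
    by (intro integral_cong_AE AE_Time_eq) measurable
  also have "\<dots> = (\<integral>w. bounded_time (\<lambda>e. \<bar>w e\<bar>) m x y \<partial>distr M (Pi\<^sub>M (time_edges m x y) (\<lambda>_. \<nu>)) (time_weights m x y))"
    by (subst integral_distr) measurable
  finally show ?thesis unfolding distr_time_weights .
qed

definition "second_moment = (\<integral>x. x\<^sup>2 \<partial>\<nu>)"

lemma second_moment_nonneg: "0 \<le> second_moment"
  unfolding second_moment_def by (intro integral_nonneg_AE) auto

text \<open>In the bound, \<open>m\<close> limits the number of simultaneously pivotal edges,
  \<open>second_moment\<close> is the mean square of the resampled weight, and \<open>2\<close> is
  the price of the positive part. The number of edges in \<open>time_edges\<close>, however large,
  does not enter.\<close>

lemma efron_stein_Time:
  assumes "l1 (x - y) \<le> m"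
  shows "(\<integral>\<^sup>+\<omega>. \<integral>\<^sup>+\<omega>'. ennreal ((Time m x y \<omega> - Time m x y \<omega>')\<^sup>2) \<partial>M \<partial>M) \<le> ennreal (2 * second_moment * real m)"
proof -
  interpret N: prob_space \<nu> by (rule prob_law)
  let ?E = "time_edges m x y"
  let ?P = "Pi\<^sub>M ?E (\<lambda>_. \<nu>)"
  interpret P: prob_space ?P by (intro prob_space_PiM prob_law)
  interpret PP: pair_sigma_finite ?P ?P ..
  define F where "F w = bounded_time (\<lambda>e. \<bar>w e\<bar>) m x y" for w
  have F[measurable]: "F \<in> borel_measurable ?P"
    unfolding F_def by (rule measurable_bounded_time_PiM) simp
  have piv[measurable]: "pivotal_weights m x y e \<inter> space ?P \<in> sets ?P" for e
  proof -
    have "pivotal_weights m x y e \<inter> space ?P = {w \<in> space ?P. \<forall>p\<in>{p \<in> simple_paths m x y. e \<notin> path_edges p}.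
       F w < path_cost (\<lambda>e. \<bar>w e\<bar>) p}" by (auto simp: pivotal_weights_def F_def)
    also have "\<dots> \<in> sets ?P"
      using measurable_path_cost_PiM[OF path_edges_subset_time_edges sets_law]
      by (intro sets.sets_Collect_finite_All borel_measurable_less F) auto
    finally show ?thesis .
  qed
  have ind[measurable]: "(indicator (pivotal_weights m x y e) :: _ \<Rightarrow> ennreal) \<in> borel_measurable ?P" for e
    using piv[of e] by (simp add: borel_measurable_indicator_iff)
  have F_rep: "AE \<omega> in M. Time m x y \<omega> = F (time_weights m x y \<omega>)"
    unfolding F_def by (rule AE_Time_eq)
  have "(\<integral>\<^sup>+\<omega>. \<integral>\<^sup>+\<omega>'. ennreal ((Time m x y \<omega> - Time m x y \<omega>')\<^sup>2) \<partial>M \<partial>M)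
    = (\<integral>\<^sup>+\<omega>. \<integral>\<^sup>+\<omega>'. ennreal ((F (time_weights m x y \<omega>) - F (time_weights m x y \<omega>'))\<^sup>2) \<partial>M \<partial>M)"
  proof (rule nn_integral_cong_AE, use F_rep in eventually_elim)
    fix \<omega> assume "Time m x y \<omega> = F (time_weights m x y \<omega>)"
    thus "(\<integral>\<^sup>+\<omega>'. ennreal ((Time m x y \<omega> - Time m x y \<omega>')\<^sup>2) \<partial>M)
      = (\<integral>\<^sup>+\<omega>'. ennreal ((F (time_weights m x y \<omega>) - F (time_weights m x y \<omega>'))\<^sup>2) \<partial>M)"
      by (intro nn_integral_cong_AE) (use F_rep in eventually_elim, simp)
  qed
  also have "\<dots> = (\<integral>\<^sup>+w. \<integral>\<^sup>+w'. ennreal ((F w - F w')\<^sup>2) \<partial>?P \<partial>?P)"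
  proof -
    have *: "(\<integral>\<^sup>+\<omega>. h (time_weights m x y \<omega>) \<partial>M) = (\<integral>\<^sup>+w. h w \<partial>?P)" if "h \<in> borel_measurable ?P" for h
      using nn_integral_distr[OF measurable_time_weights, of h m x y] that unfolding distr_time_weights by simp
    have "(\<integral>\<^sup>+\<omega>. \<integral>\<^sup>+\<omega>'. ennreal ((F (time_weights m x y \<omega>) - F (time_weights m x y \<omega>'))\<^sup>2) \<partial>M \<partial>M)
      = (\<integral>\<^sup>+\<omega>. \<integral>\<^sup>+w'. ennreal ((F (time_weights m x y \<omega>) - F w')\<^sup>2) \<partial>?P \<partial>M)"
      by (intro nn_integral_cong *) measurable
    also have "\<dots> = (\<integral>\<^sup>+w. \<integral>\<^sup>+w'. ennreal ((F w - F w')\<^sup>2) \<partial>?P \<partial>?P)"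
      by (rule *) measurable
    finally show ?thesis .
  qed
  also have "\<dots> \<le> 2 * (\<Sum>e\<in>?E. \<integral>\<^sup>+w. \<integral>\<^sup>+u. ennreal ((max 0 (F (w(e := u)) - F w))\<^sup>2) \<partial>\<nu> \<partial>?P)"
    by (rule N.efron_stein_positive_part) simp_all
  also have "\<dots> \<le> 2 * (\<Sum>e\<in>?E. \<integral>\<^sup>+w. \<integral>\<^sup>+u. ennreal (u\<^sup>2) * indicator (pivotal_weights m x y e) w \<partial>\<nu> \<partial>?P)"
  proof (intro mult_left_mono sum_mono nn_integral_mono)
    fix e w u
    have "(max 0 (F (w(e := u)) - F w))\<^sup>2 \<le> (\<bar>u\<bar> * indicator (pivotal_weights m x y e) w)\<^sup>2"
      unfolding F_def by (intro power_mono bounded_time_update_le assms) simp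
    also have "\<dots> = u\<^sup>2 * indicator (pivotal_weights m x y e) w"
      by (simp split: split_indicator)
    finally show "ennreal ((max 0 (F (w(e := u)) - F w))\<^sup>2) \<le> ennreal (u\<^sup>2) * indicator (pivotal_weights m x y e) w"
      by (simp split: split_indicator_asm split_indicator add: ennreal_leI)
  qed simp
  also have "\<dots> = 2 * (\<Sum>e\<in>?E. \<integral>\<^sup>+w. ennreal second_moment * indicator (pivotal_weights m x y e) w \<partial>?P)"
  proof -
    have "(\<integral>\<^sup>+u. ennreal (u\<^sup>2) * c \<partial>\<nu>) = ennreal second_moment * c" for c :: ennreal
      unfolding second_moment_def by (subst nn_integral_multc) (simp_all add: nn_integral_eq_integral law_square)
    thus ?thesis by simp
  qed
  also have "\<dots> = 2 * (ennreal second_moment * (\<integral>\<^sup>+w. (\<Sum>e\<in>?E. indicator (pivotal_weights m x y e) w) \<partial>?P))"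
    by (subst nn_integral_sum) (simp_all add: nn_integral_cmult sum_distrib_left)
  also have "\<dots> \<le> 2 * (ennreal second_moment * (\<integral>\<^sup>+w. of_nat m \<partial>?P))"
    by (intro mult_left_mono nn_integral_mono sum_pivotal_le assms) auto
  also have "\<dots> = ennreal (2 * second_moment * real m)"
    using second_moment_nonneg by (simp add: P.emeasure_space_1 ennreal_mult ennreal_of_nat_eq_real_of_nat mult.assoc)
  finally show ?thesis .
qed

text \<open>For fixed \<open>\<omega>\<close>, the second moment of
  \<open>Time m x y \<omega> - Time m x y \<omega>'\<close> in \<open>\<omega>'\<close> dominates
  the square of its mean; integrating over \<open>\<omega>\<close> compares the variance with the
  independent-copy form.\<close>

lemma variance_Time:
  assumes "l1 (x - y) \<le> m"
  shows "(\<integral>\<^sup>+\<omega>. ennreal ((Time m x y \<omega> - expectation (Time m x y))\<^sup>2) \<partial>M) \<le> ennreal (2 * second_moment * real m)"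
proof -
  have "ennreal ((Time m x y \<omega> - expectation (Time m x y))\<^sup>2)
    \<le> (\<integral>\<^sup>+\<omega>'. ennreal ((Time m x y \<omega> - Time m x y \<omega>')\<^sup>2) \<partial>M)" for \<omega>
  proof -
    let ?X = "\<lambda>\<omega>'. Time m x y \<omega> - Time m x y \<omega>'"
    have X: "integrable M ?X" by (intro Bochner_Integration.integrable_diff integrable_Time assms) simp
    have X2: "integrable M (\<lambda>\<omega>'. (?X \<omega>')\<^sup>2)"
      unfolding power2_diff using integrable_Time[OF assms] integrable_Time_square[OF assms] by simp
    have "expectation ?X = Time m x y \<omega> - expectation (Time m x y)"
      using integrable_Time[OF assms] by (simp add: prob_space)
    moreover have "0 \<le> expectation (\<lambda>\<omega>'. (?X \<omega>')\<^sup>2) - (expectation ?X)\<^sup>2"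
      using variance_positive[of ?X] unfolding variance_eq[OF X X2] .
    ultimately have "(Time m x y \<omega> - expectation (Time m x y))\<^sup>2 \<le> expectation (\<lambda>\<omega>'. (?X \<omega>')\<^sup>2)"
      by simp
    thus ?thesis using X2 by (simp add: nn_integral_eq_integral ennreal_leI)
  qed
  hence "(\<integral>\<^sup>+\<omega>. ennreal ((Time m x y \<omega> - expectation (Time m x y))\<^sup>2) \<partial>M)
    \<le> (\<integral>\<^sup>+\<omega>. \<integral>\<^sup>+\<omega>'. ennreal ((Time m x y \<omega> - Time m x y \<omega>')\<^sup>2) \<partial>M \<partial>M)"
    by (intro nn_integral_mono)
  thus ?thesis using efron_stein_Time[OF assms] by (rule order_trans)
qed

end

text \<open>The sum of the squares has finite expectation, hence is almost surely finite, hence its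
  terms tend to \<open>0\<close>. This does the work of Chebyshev and Borel-Cantelli in one
  step.\<close>

lemma AE_tendsto_0_of_summable_square:
  fixes X :: "nat \<Rightarrow> 'a \<Rightarrow> real"
  assumes [measurable]: "\<And>n. X n \<in> borel_measurable M"
    and bound: "\<And>n. (\<integral>\<^sup>+\<omega>. ennreal ((X n \<omega>)\<^sup>2) \<partial>M) \<le> ennreal (c n)"
    and c: "summable c" "\<And>n. 0 \<le> c n"
  shows "AE \<omega> in M. (\<lambda>n. X n \<omega>) \<longlonglongrightarrow> 0"
proof -
  have "(\<integral>\<^sup>+\<omega>. (\<Sum>n. ennreal ((X n \<omega>)\<^sup>2)) \<partial>M) = (\<Sum>n. \<integral>\<^sup>+\<omega>. ennreal ((X n \<omega>)\<^sup>2) \<partial>M)"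
    by (intro nn_integral_suminf) measurable
  also have "\<dots> \<le> (\<Sum>n. ennreal (c n))" by (intro suminf_le bound) auto
  also have "\<dots> = ennreal (\<Sum>n. c n)" using c by (intro suminf_ennreal2) auto
  also have "\<dots> < \<infinity>" by simp
  finally have "AE \<omega> in M. (\<Sum>n. ennreal ((X n \<omega>)\<^sup>2)) \<noteq> \<infinity>"
    by (intro nn_integral_PInf_AE) auto
  thus ?thesis
  proof eventually_elim
    case (elim \<omega>)
    hence "summable (\<lambda>n. (X n \<omega>)\<^sup>2)" by (intro summable_suminf_not_top) auto
    hence "(\<lambda>n. (X n \<omega>)\<^sup>2) \<longlonglongrightarrow> 0" by (rule summable_LIMSEQ_zero)
    hence "(\<lambda>n. sqrt ((X n \<omega>)\<^sup>2)) \<longlonglongrightarrow> sqrt 0" by (intro tendsto_real_sqrt)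
    thus ?case by (simp add: tendsto_rabs_zero_iff)
  qed
qed

context iid_weights
begin

text \<open>Shifted edges carry weights of the same joint law: the shift is injective on the finite
  edge set, so reindexing turns one product law into the other.\<close>

lemma expectation_Time_translate:
  "expectation (Time m (x + z) (y + z)) = expectation (Time m x y)"
proof -
  let ?J = "time_edges m x y" and ?s = "\<lambda>e. (\<lambda>v. v + z) ` e"
  let ?K = "?s ` ?J"
  let ?P = "Pi\<^sub>M ?J (\<lambda>_. \<nu>)"
  define F where "F w = bounded_time (\<lambda>e. \<bar>w e\<bar>) m x y" for w
  have F[measurable]: "F \<in> borel_measurable ?P"
    unfolding F_def by (rule measurable_bounded_time_PiM) simp
  have K: "?K \<noteq> {}" "?K \<subseteq> lattice_edges" using time_edges_subset[of m x y] by auto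
  have inj: "inj_on ?s ?J" by (intro inj_onI) (simp add: inj_image_eq_iff)
  define X where "X \<omega> = (\<lambda>e\<in>?J. \<tau> (?s e) \<omega>)" for \<omega>
  have X: "X \<in> M \<rightarrow>\<^sub>M ?P"
    unfolding X_def[abs_def] using K(2)
    by (intro measurable_restrict) (auto simp: measurable_cong_sets[OF refl sets_law] intro!: rv)
  have XK: "(\<lambda>\<omega>. \<lambda>e\<in>?K. \<tau> e \<omega>) \<in> M \<rightarrow>\<^sub>M Pi\<^sub>M ?K (\<lambda>_. borel)"
    using K(2) by (intro measurable_restrict rv) auto
  have re: "(\<lambda>w. \<lambda>e\<in>?J. w (?s e)) \<in> Pi\<^sub>M ?K (\<lambda>_. borel) \<rightarrow>\<^sub>M ?P"
    by (intro measurable_restrict) (auto simp: measurable_cong_sets[OF refl sets_law] intro!: measurable_component_singleton)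
  have "?P = distr (Pi\<^sub>M ?K (\<lambda>_. \<nu>)) ?P (\<lambda>w. \<lambda>e\<in>?J. w (?s e))"
    using prob_law inj by (intro distr_PiM_reindex[symmetric]) auto
  also have "\<dots> = distr M ?P X"
    unfolding distr_weights[OF K, symmetric] using XK re
    by (subst distr_distr) (auto intro!: arg_cong[where f = "distr M ?P"] simp: X_def fun_eq_iff)
  finally have P: "distr M ?P X = ?P" ..
  have "expectation (Time m (x + z) (y + z)) = expectation (\<lambda>\<omega>. F (X \<omega>))"
  proof (rule integral_cong_AE)
    show "AE \<omega> in M. Time m (x + z) (y + z) \<omega> = F (X \<omega>)"
      using AE_lattice_weights
    proof eventually_elim
      case (elim \<omega>)
      then interpret lattice_weights "\<lambda>e. \<tau> e \<omega>" .
      show ?case unfolding bounded_time_translate F_def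
        using K(2) by (intro bounded_time_cong) (auto simp: X_def w_nonneg)
    qed
  qed (use X in measurable)
  also have "\<dots> = (\<integral>w. F w \<partial>distr M ?P X)" using X F by (subst integral_distr) auto
  finally show ?thesis unfolding P expectation_Time F_def .
qed

text \<open>The edge budget \<open>K * n\<close> is additive in \<open>n\<close>, so the budgets
  match in the triangle inequality; translation invariance brings the second leg back to the
  origin.\<close>

lemma mean_time_converges:
  assumes "l1 v \<le> K"
  shows "convergent (\<lambda>n. expectation (Time (K * n) 0 (of_nat n *s v)) / real n)"
proof (rule fekete)
  have l: "l1 (0 - of_nat n *s v) \<le> K * n" for n
    using assms by (simp add: l1_minus l1_smult)
  show "0 \<le> expectation (Time (K * n) 0 (of_nat n *s v))" for n
    using AE_lattice_weights
    by (intro integral_nonneg_AE, eventually_elim) (auto intro!: lattice_weights.bounded_time_nonneg l)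
  fix m n
  have e: "of_nat (m + n) *s v = of_nat n *s v + of_nat m *s v" by (simp add: vec_eq_iff algebra_simps)
  have l': "l1 (of_nat m *s v - of_nat (m + n) *s v) \<le> K * n"
    using l[of n] unfolding e by simp
  have "expectation (Time (K * (m + n)) 0 (of_nat (m + n) *s v))
    \<le> expectation (\<lambda>\<omega>. Time (K * m) 0 (of_nat m *s v) \<omega> + Time (K * n) (of_nat m *s v) (of_nat (m + n) *s v) \<omega>)"
  proof (rule integral_mono_AE)
    show "AE \<omega> in M. Time (K * (m + n)) 0 (of_nat (m + n) *s v) \<omega> \<le>
      Time (K * m) 0 (of_nat m *s v) \<omega> + Time (K * n) (of_nat m *s v) (of_nat (m + n) *s v) \<omega>"
      using AE_lattice_weights unfolding distrib_left
      by eventually_elim (intro lattice_weights.bounded_time_triangle l l')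
  qed (intro Bochner_Integration.integrable_add integrable_Time l l')+
  also have "\<dots> = expectation (Time (K * m) 0 (of_nat m *s v)) + expectation (Time (K * n) (of_nat m *s v) (of_nat (m + n) *s v))"
    by (intro Bochner_Integration.integral_add integrable_Time l l')
  also have "expectation (Time (K * n) (of_nat m *s v) (of_nat (m + n) *s v)) = expectation (Time (K * n) 0 (of_nat n *s v))"
    unfolding e using expectation_Time_translate[of "K * n" 0 "of_nat m *s v" "of_nat n *s v"] by simp
  finally show "expectation (Time (K * (m + n)) 0 (of_nat (m + n) *s v))
    \<le> expectation (Time (K * m) 0 (of_nat m *s v)) + expectation (Time (K * n) 0 (of_nat n *s v))" .
qed

text \<open>A priori the value depends on \<open>K\<close>. For \<open>K\<close> large enough in
  terms of \<open>v\<close> it is the limit of the passage times themselves.\<close>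

definition mean_limit :: "int ^ 'n \<Rightarrow> nat \<Rightarrow> real" where
  "mean_limit v K = lim (\<lambda>n. expectation (Time (K * n) 0 (of_nat n *s v)) / real n)"

text \<open>A variance of order \<open>n\<close> makes the deviations summable only along a subsequence such as the squares.\<close>

lemma AE_Time_squares:
  assumes "l1 v \<le> K"
  shows "AE \<omega> in M. (\<lambda>k. Time (K * k\<^sup>2) (of_nat (k\<^sup>2) *s a) (of_nat (k\<^sup>2) *s (a + v)) \<omega> / real (k\<^sup>2)) \<longlonglongrightarrow> mean_limit v K"
proof -
  \<comment> \<open>The index starts at \<open>1\<close>, in line with the summable bound
    \<open>inverse (real (Suc k) ^ 2)\<close>; the shift is undone at the end.\<close>
  define X where "X k \<omega> = Time (K * (Suc k)\<^sup>2) (of_nat ((Suc k)\<^sup>2) *s a) (of_nat ((Suc k)\<^sup>2) *s (a + v)) \<omega>" for k \<omega>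
  define g where "g n = expectation (Time (K * n) 0 (of_nat n *s v))" for n
  have l: "l1 (of_nat n *s a - of_nat n *s (a + v)) \<le> K * n" for n
  proof -
    have "of_nat n *s a - of_nat n *s (a + v) = - (of_nat n *s v)" by (simp add: vec_eq_iff algebra_simps)
    thus ?thesis using assms by (simp add: l1_minus l1_smult)
  qed
  have EX: "expectation (X k) = g ((Suc k)\<^sup>2)" for k
  proof -
    let ?n = "(Suc k)\<^sup>2"
    have "of_nat ?n *s (a + v) = of_nat ?n *s v + of_nat ?n *s a" by (simp add: vec_eq_iff algebra_simps)
    thus ?thesis unfolding X_def[abs_def] g_def
      using expectation_Time_translate[of "K * ?n" 0 "of_nat ?n *s a" "of_nat ?n *s v"] by (simp add: add.commute)
  qed
  have "AE \<omega> in M. (\<lambda>k. (X k \<omega> - g ((Suc k)\<^sup>2)) / real ((Suc k)\<^sup>2)) \<longlonglongrightarrow> 0"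
  proof (rule AE_tendsto_0_of_summable_square)
    show "(\<lambda>\<omega>. (X k \<omega> - g ((Suc k)\<^sup>2)) / real ((Suc k)\<^sup>2)) \<in> borel_measurable M" for k
      unfolding X_def by measurable
    show "(\<integral>\<^sup>+\<omega>. ennreal (((X k \<omega> - g ((Suc k)\<^sup>2)) / real ((Suc k)\<^sup>2))\<^sup>2) \<partial>M)
      \<le> ennreal (2 * second_moment * real K * inverse (real (Suc k) ^ 2))" for k
    proof -
      let ?n = "(Suc k)\<^sup>2"
      have "(\<integral>\<^sup>+\<omega>. ennreal (((X k \<omega> - g ?n) / real ?n)\<^sup>2) \<partial>M)
        = (\<integral>\<^sup>+\<omega>. ennreal ((X k \<omega> - g ?n)\<^sup>2) * ennreal (1 / (real ?n)\<^sup>2) \<partial>M)"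
        by (intro nn_integral_cong) (simp add: power_divide ennreal_mult[symmetric])
      also have "\<dots> = (\<integral>\<^sup>+\<omega>. ennreal ((X k \<omega> - g ?n)\<^sup>2) \<partial>M) * ennreal (1 / (real ?n)\<^sup>2)"
        unfolding X_def by (intro nn_integral_multc) measurable
      also have "\<dots> \<le> ennreal (2 * second_moment * real (K * ?n)) * ennreal (1 / (real ?n)\<^sup>2)"
        using variance_Time[OF l[of ?n]] EX[of k] unfolding X_def by (intro mult_right_mono) auto
      also have "\<dots> = ennreal (2 * second_moment * real (K * ?n) * (1 / (real ?n)\<^sup>2))"
        using second_moment_nonneg by (intro ennreal_mult[symmetric]) auto
      also have "2 * second_moment * real (K * ?n) * (1 / (real ?n)\<^sup>2) = 2 * second_moment * real K * inverse (real (Suc k) ^ 2)"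
      proof -
        have "A * real (K * n) * (1 / (real n)\<^sup>2) = A * real K * inverse (real n)" for A :: real and n
          by (cases "n = 0") (simp_all add: power2_eq_square field_simps)
        from this[of "2 * second_moment" "(Suc k)\<^sup>2"] show ?thesis unfolding of_nat_power .
      qed
      finally show ?thesis .
    qed
    have "summable (\<lambda>k. inverse (real (Suc k) ^ 2))"
      using inverse_power_summable[of 2, where 'a = real] by (subst summable_Suc_iff) auto
    thus "summable (\<lambda>k. 2 * second_moment * real K * inverse (real (Suc k) ^ 2))" by (rule summable_mult)
  qed (use second_moment_nonneg in auto)
  thus ?thesis
  proof eventually_elim
    case (elim \<omega>)
    have "(\<lambda>n. g n / real n) \<longlonglongrightarrow> mean_limit v K"
      using mean_time_converges[OF assms] unfolding mean_limit_def g_def convergent_LIMSEQ_iff .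
    moreover have "filterlim (\<lambda>k. (Suc k)\<^sup>2) at_top sequentially"
      by (rule filterlim_subseq) (auto intro!: strict_monoI power_strict_mono)
    ultimately have "(\<lambda>k. g ((Suc k)\<^sup>2) / real ((Suc k)\<^sup>2)) \<longlonglongrightarrow> mean_limit v K"
      by (rule filterlim_compose)
    from tendsto_add[OF elim this] have "(\<lambda>k. X k \<omega> / real ((Suc k)\<^sup>2)) \<longlonglongrightarrow> mean_limit v K"
      by (simp add: diff_divide_distrib)
    thus ?case unfolding X_def by (rule LIMSEQ_imp_Suc)
  qed
qed

end

section \<open>From the bounds to the linear growth of passage times\<close>

text \<open>A fixed realisation, with the two almost sure estimates as hypotheses; what follows in
  this locale is deterministic.\<close>

locale fpp_configuration = lattice_weights w for w :: "(int ^ 'n) set \<Rightarrow> real" +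
  fixes c C :: real
  assumes w_pos: "\<And>e. e \<in> lattice_edges \<Longrightarrow> 0 < w e"
    and c_pos: "0 < c" and C_pos: "0 < C"
    and long_paths: "eventually (\<lambda>k. \<forall>(x :: int ^ 'n) p. l1 x \<le> k\<^sup>2 \<longrightarrow> p \<in> walks k x \<longrightarrow> distinct p \<longrightarrow>
       c * real k \<le> path_cost w p) sequentially"
    and linear_bound: "eventually (\<lambda>k. \<forall>x y. l1 x \<le> k\<^sup>2 \<longrightarrow> l1 (y - x) = k \<longrightarrow>
       passage_time w x y \<le> C * real k) sequentially"
begin

lemma long_pathsE:
  obtains k0 where "\<And>x p y. lattice_path x p y \<Longrightarrow> distinct p \<Longrightarrow> k0 \<le> length p - 1 \<Longrightarrow>
    l1 x \<le> (length p - 1)\<^sup>2 \<Longrightarrow> c * real (length p - 1) \<le> path_cost w p"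
proof -
  obtain k0 where "\<And>k (x :: int ^ 'n) p. k0 \<le> k \<Longrightarrow> l1 x \<le> k\<^sup>2 \<Longrightarrow> p \<in> walks k x \<Longrightarrow> distinct p \<Longrightarrow>
      c * real k \<le> path_cost w p"
    using long_paths by (auto simp: eventually_sequentially)
  thus ?thesis by (intro that[of k0]) (auto simp: walks_def lattice_path_def)
qed

text \<open>At scale \<open>t\<close> the distance \<open>k\<close> is at least of order
  \<open>t\<close> and the size \<open>l\<close> of the starting point at most of order
  \<open>t\<close>, so the quadratic condition \<open>l \<le> k\<^sup>2\<close> that comes with the
  linear bound holds eventually.\<close>

lemma eventually_scale:
  fixes t0 R \<delta> :: real and k0 :: nat
  assumes "0 < \<delta>" "0 \<le> R"
  shows "eventually (\<lambda>t. \<forall>k::nat. \<forall>l::nat. \<delta> * t \<le> real k \<longrightarrow> real l \<le> R * t \<longrightarrow> k0 \<le> k \<and> l \<le> k\<^sup>2 \<and> 1 \<le> \<delta> * t) at_top"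
proof -
  have "eventually (\<lambda>t::real. t \<ge> max (real k0 / \<delta>) (max (R / \<delta>\<^sup>2) (1 / \<delta>))) at_top" by (rule eventually_ge_at_top)
  thus ?thesis
  proof eventually_elim
    case (elim t)
    show ?case
    proof (intro allI impI conjI)
      fix k l :: nat assume kl: "\<delta> * t \<le> real k" "real l \<le> R * t"
      from elim assms have t: "real k0 \<le> \<delta> * t" "R \<le> t * \<delta>\<^sup>2" "1 \<le> \<delta> * t"
        by (auto simp: field_simps power2_eq_square)
      show "1 \<le> \<delta> * t" by fact
      show "k0 \<le> k" using t(1) kl by linarith
      have "0 < t" using t(3) assms by (smt (verit) zero_less_mult_iff)
      have "R * t \<le> (t * \<delta>\<^sup>2) * t" using t(2) \<open>0 < t\<close> by (intro mult_right_mono) auto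
      also have "\<dots> = (\<delta> * t)\<^sup>2" by (simp add: power2_eq_square)
      also have "\<dots> \<le> (real k)\<^sup>2" using t(3) kl by (intro power_mono) auto
      finally show "l \<le> k\<^sup>2" using kl(2) by (metis (no_types, lifting) of_nat_le_iff of_nat_power order_trans)
    qed
  qed
qed

text \<open>The linear bound only controls distant points, so nearby points are joined through a point \<open>z\<close> at
  distance of order \<open>\<delta> * t\<close> from both.\<close>

lemma T_local_bound:
  assumes "0 < \<delta>" "0 \<le> R"
  shows "eventually (\<lambda>t. \<forall>x y. real (l1 x) \<le> R * t \<longrightarrow> real (l1 (y - x)) \<le> \<delta> * t \<longrightarrow> T x y \<le> 7 * C * \<delta> * t) at_top"
proof -
  obtain k0 where k0: "\<And>k x y. k0 \<le> k \<Longrightarrow> l1 x \<le> k\<^sup>2 \<Longrightarrow> l1 (y - x) = k \<Longrightarrow> T x y \<le> C * real k"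
    using linear_bound by (auto simp: eventually_sequentially)
  have "0 \<le> R + 3 * \<delta>" using assms by simp
  from eventually_scale[OF assms(1) this, of k0] show ?thesis
  proof eventually_elim
    case (elim t)
    show ?case
    proof (intro allI impI)
      fix x y :: "int ^ 'n" assume x: "real (l1 x) \<le> R * t" and y: "real (l1 (y - x)) \<le> \<delta> * t"
      \<comment> \<open>\<open>1 \<le> \<delta> * t\<close> stands under the premises of
        \<open>eventually_scale\<close>; the instance \<open>l = 0\<close> with \<open>k\<close> the
        ceiling of \<open>\<delta> * t\<close> releases it.\<close>
      have t: "1 \<le> \<delta> * t" using elim[rule_format, of "nat \<lceil>\<delta> * t\<rceil>" 0] y assms x \<open>0 \<le> R + 3 * \<delta>\<close>
        by (smt (verit) mult_nonneg_nonneg of_nat_0_le_iff real_nat_ceiling_ge zero_le_mult_iff of_nat_0)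
      \<comment> \<open>With \<open>1 \<le> \<delta> * t\<close> rounding costs at most
        \<open>\<delta> * t\<close>. As \<open>m\<close> is at least twice
        \<open>\<delta> * t\<close>, the point \<open>z\<close> stays at distance at least
        \<open>\<delta> * t\<close> from \<open>y\<close>; the two legs have lengths at most
        \<open>3 * \<delta> * t\<close> and \<open>4 * \<delta> * t\<close>, which gives the factor
        \<open>7\<close>.\<close>
      define m where "m = nat \<lceil>2 * \<delta> * t\<rceil>"
      have m: "2 * \<delta> * t \<le> real m" "real m \<le> 3 * \<delta> * t"
        using t unfolding m_def by linarith+
      define z where "z = x + axis undefined (int m)"
      have zx: "l1 (z - x) = m" by (simp add: z_def)
      have "l1 z \<le> l1 x + m" using l1_triangle[of x "axis undefined (int m)"] by (simp add: z_def)
      hence z: "real (l1 z) \<le> (R + 3 * \<delta>) * t" using x m by (simp add: algebra_simps)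
      have "l1 (y - z) \<le> l1 (y - x) + m" "m \<le> l1 (y - x) + l1 (y - z)"
        using l1_triangle_diff[of y z x] l1_triangle_diff[of z x y] zx
        by (simp_all add: l1_minus_commute[of x z] l1_minus_commute[of z y])
      hence yz: "\<delta> * t \<le> real (l1 (y - z))" "real (l1 (y - z)) \<le> 4 * \<delta> * t"
        using m y by linarith+
      have "real (l1 x) \<le> (R + 3 * \<delta>) * t" using x t by (simp add: algebra_simps)
      with m have "T x z \<le> C * real m"
        using elim[rule_format, of m "l1 x"] t by (intro k0 zx) auto
      moreover have "T z y \<le> C * real (l1 (y - z))"
        using elim[rule_format, OF yz(1) z] by (intro k0) auto
      ultimately have "T x y \<le> C * (real m + real (l1 (y - z)))"
        using T_triangle[of x y z] by (simp add: algebra_simps)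
      also have "\<dots> \<le> C * (7 * \<delta> * t)" using m yz C_pos by (intro mult_left_mono) auto
      finally show "T x y \<le> 7 * C * \<delta> * t" by (simp add: algebra_simps)
    qed
  qed
qed

lemma eventually_real_sequentially: "eventually P at_top \<Longrightarrow> eventually (\<lambda>n::nat. P (real n)) sequentially"
  using filterlim_real_sequentially by (auto simp: filterlim_iff)

lemma T_multiple_le:
  "eventually (\<lambda>n. T (of_nat n *s a) (of_nat n *s b) \<le> C * real (l1 (b - a)) * real n) sequentially"
proof (cases "a = b")
  case False
  hence "l1 (b - a) \<noteq> 0" by simp
  hence v: "1 \<le> l1 (b - a)" by linarith
  obtain k0 where k0: "\<And>k x y. k0 \<le> k \<Longrightarrow> l1 x \<le> k\<^sup>2 \<Longrightarrow> l1 (y - x) = k \<Longrightarrow> T x y \<le> C * real k"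
    using linear_bound by (auto simp: eventually_sequentially)
  have "eventually (\<lambda>n. max k0 (l1 a) \<le> n) sequentially" by (rule eventually_ge_at_top)
  thus ?thesis
  proof eventually_elim
    case (elim n)
    have e: "of_nat n *s b - of_nat n *s a = of_nat n *s (b - a)" by (simp add: vec_eq_iff algebra_simps)
    have n: "n \<le> n * l1 (b - a)" using v by simp
    have "T (of_nat n *s a) (of_nat n *s b) \<le> C * real (n * l1 (b - a))"
    proof (rule k0)
      show "k0 \<le> n * l1 (b - a)" using n elim by linarith
      have "n * l1 a \<le> n * n" using elim by simp
      also have "\<dots> \<le> (n * l1 (b - a))\<^sup>2" using n by (auto simp: power2_eq_square intro!: mult_mono)
      finally show "l1 (of_nat n *s a) \<le> (n * l1 (b - a))\<^sup>2" by (simp add: l1_smult)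
      show "l1 (of_nat n *s b - of_nat n *s a) = n * l1 (b - a)" unfolding e by (rule l1_smult)
    qed
    thus ?case by (simp add: mult_ac)
  qed
qed simp

text \<open>A path from \<open>0\<close> to \<open>of_nat n *s v\<close> has at least
  \<open>n * l1 v\<close> edges, and long self-avoiding paths cost on average at least
  \<open>c\<close> per edge.\<close>

lemma T_multiple_ge:
  "eventually (\<lambda>n. c * real (l1 v) * real n \<le> T 0 (of_nat n *s v)) sequentially"
proof (cases "v = 0")
  case False
  hence "l1 v \<noteq> 0" by simp
  hence v: "1 \<le> l1 v" by linarith
  obtain k0 where k0: "\<And>x p y. lattice_path x p y \<Longrightarrow> distinct p \<Longrightarrow> k0 \<le> length p - 1 \<Longrightarrow>
      l1 x \<le> (length p - 1)\<^sup>2 \<Longrightarrow> c * real (length p - 1) \<le> path_cost w p"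
    by (rule long_pathsE) blast
  have "eventually (\<lambda>n. k0 \<le> n) sequentially" by (rule eventually_ge_at_top)
  thus ?thesis
  proof eventually_elim
    case (elim n)
    show ?case
    proof (rule T_greatest_distinct)
      fix p assume p: "lattice_path 0 p (of_nat n *s v)" "distinct p"
      have l: "n * l1 v \<le> length p - 1"
        using l1_lattice_path_le[OF p(1)] by (simp add: l1_minus l1_smult)
      have "n \<le> n * l1 v" using v by simp
      with l elim have "k0 \<le> length p - 1" by linarith
      hence "c * real (length p - 1) \<le> path_cost w p"
        using p by (intro k0[OF p]) auto
      moreover have "c * real (n * l1 v) \<le> c * real (length p - 1)"
        using l c_pos by (intro mult_left_mono of_nat_mono) auto
      ultimately show "c * real (l1 v) * real n \<le> path_cost w p" by (simp add: mult_ac)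
    qed
  qed
qed simp

text \<open>\<open>T\<close> is at most \<open>C * l1 v * n \<le> c * K * n\<close>, while a path
  with more than \<open>K * n\<close> edges costs at least \<open>c * Suc (K * n)\<close>. The
  successor provides the strict inequality.\<close>

lemma T_eq_bounded_time:
  assumes "C * real (l1 v) / c \<le> real K" "l1 v \<le> K" "1 \<le> K"
  shows "eventually (\<lambda>n. bounded_time w (K * n) (of_nat n *s a) (of_nat n *s (a + v))
    = T (of_nat n *s a) (of_nat n *s (a + v))) sequentially"
proof -
  obtain k0 where k0: "\<And>x p y. lattice_path x p y \<Longrightarrow> distinct p \<Longrightarrow> k0 \<le> length p - 1 \<Longrightarrow>
      l1 x \<le> (length p - 1)\<^sup>2 \<Longrightarrow> c * real (length p - 1) \<le> path_cost w p"
    by (rule long_pathsE) blast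
  have "eventually (\<lambda>n. max k0 (l1 a) \<le> n) sequentially" by (rule eventually_ge_at_top)
  with T_multiple_le[of a "a + v"] show ?thesis
  proof eventually_elim
    case (elim n)
    have Kn: "n \<le> K * n" using assms by simp
    show ?case
    proof (rule bounded_time_eq_T)
      have "of_nat n *s a - of_nat n *s (a + v) = - (of_nat n *s v)" by (simp add: vec_eq_iff algebra_simps)
      thus "l1 (of_nat n *s a - of_nat n *s (a + v)) \<le> K * n"
        using assms by (simp add: l1_minus l1_smult)
      have "C * real (l1 v) \<le> c * real K" using assms c_pos by (simp add: field_simps)
      hence "C * real (l1 v) * real n \<le> c * real K * real n" by (intro mult_right_mono) auto
      hence "T (of_nat n *s a) (of_nat n *s (a + v)) \<le> c * real (K * n)" using elim(1) by (simp add: mult_ac)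
      also have "\<dots> < c * real (Suc (K * n))" using c_pos by simp
      finally show "T (of_nat n *s a) (of_nat n *s (a + v)) < c * real (Suc (K * n))" .
      fix p assume p: "lattice_path (of_nat n *s a) p (of_nat n *s (a + v))" "distinct p" "Suc (K * n) < length p"
      have "l1 (of_nat n *s a) \<le> n * n" using elim by (simp add: l1_smult)
      also have "\<dots> \<le> (length p - 1)\<^sup>2"
      proof -
        have "n \<le> length p - 1" using p(3) Kn by linarith
        thus ?thesis unfolding power2_eq_square by (intro mult_mono) auto
      qed
      finally have "c * real (length p - 1) \<le> path_cost w p"
        by (intro k0[OF p(1,2)]) (use p(3) Kn elim(2) in linarith)
      moreover have "c * real (Suc (K * n)) \<le> c * real (length p - 1)"
        using p(3) c_pos by (intro mult_left_mono of_nat_mono) auto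
      ultimately show "c * real (Suc (K * n)) \<le> path_cost w p" by simp
    qed
  qed
qed

text \<open>The gap from \<open>n\<close> to the largest square not exceeding it is at most
  \<open>2 * sqrt n\<close>. Both endpoints therefore move by a distance negligible against
  \<open>n\<close>, and \<open>T_local_bound\<close> turns this into a negligible change of the
  time.\<close>

lemma T_limit_from_squares:
  assumes "(\<lambda>k. T (of_nat (k\<^sup>2) *s a) (of_nat (k\<^sup>2) *s b) / real (k\<^sup>2)) \<longlonglongrightarrow> L"
  shows "(\<lambda>n. T (of_nat n *s a) (of_nat n *s b) / real n) \<longlonglongrightarrow> L"
proof -
  let ?S = "\<lambda>n. T (of_nat n *s a) (of_nat n *s b)"
  define s where "s n = nat \<lfloor>sqrt (real n)\<rfloor>" for n
  have s1: "(s n)\<^sup>2 \<le> n" for n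
  proof -
    have "real (s n) \<le> sqrt (real n)" unfolding s_def by simp
    hence "(real (s n))\<^sup>2 \<le> real n" by (metis of_nat_0_le_iff power_mono real_sqrt_pow2)
    thus ?thesis by (metis of_nat_le_iff of_nat_power)
  qed
  have s2: "real n - real ((s n)\<^sup>2) \<le> 2 * sqrt (real n)" for n
  proof -
    have "sqrt (real n) \<le> real (s n) + 1" unfolding s_def by linarith
    hence "(sqrt (real n) - 1)\<^sup>2 \<le> (real (s n))\<^sup>2 \<or> sqrt (real n) < 1"
      by (smt (verit) power_mono)
    thus ?thesis
    proof
      assume "sqrt (real n) < 1"
      thus ?thesis by (simp add: real_sqrt_lt_1_iff) 
    qed (simp add: power2_diff)
  qed
  have s_inf: "filterlim s at_top sequentially"
  proof -
    have "filterlim (\<lambda>n. nat \<lfloor>sqrt (real n)\<rfloor>) at_top sequentially"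
      by (intro filterlim_compose[OF filterlim_nat_sequentially] filterlim_compose[OF filterlim_floor_sequentially]
         filterlim_compose[OF sqrt_at_top] filterlim_real_sequentially)
    thus ?thesis by (simp add: s_def[abs_def])
  qed
  have ratio: "(\<lambda>n. real ((s n)\<^sup>2) / real n) \<longlonglongrightarrow> 1"
  proof (rule tendsto_sandwich)
    show "eventually (\<lambda>n. 1 - 2 / sqrt (real n) \<le> real ((s n)\<^sup>2) / real n) sequentially"
      using eventually_gt_at_top[of 0]
    proof eventually_elim
      case (elim n)
      have "1 - 2 / sqrt (real n) = (real n - 2 * sqrt (real n)) / real n"
        using elim by (simp add: field_simps)
      also have "\<dots> \<le> real ((s n)\<^sup>2) / real n" using s2[of n] by (intro divide_right_mono) auto
      finally show ?case .
    qed
    show "eventually (\<lambda>n. real ((s n)\<^sup>2) / real n \<le> 1) sequentially"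
      using eventually_gt_at_top[of 0] by eventually_elim (use s1 in \<open>simp add: divide_le_eq_1 of_nat_le_iff flip: of_nat_power\<close>)
    have "(\<lambda>n. 2 / sqrt (real n)) \<longlonglongrightarrow> 0"
      by (intro real_tendsto_divide_at_top[OF tendsto_const] filterlim_compose[OF sqrt_at_top] filterlim_real_sequentially)
    thus "(\<lambda>n. 1 - 2 / sqrt (real n)) \<longlonglongrightarrow> 1" using tendsto_diff[OF tendsto_const[of 1]] by fastforce
  qed auto
  have main: "(\<lambda>n. ?S ((s n)\<^sup>2) / real n) \<longlonglongrightarrow> L"
  proof -
    have "(\<lambda>n. ?S ((s n)\<^sup>2) / real ((s n)\<^sup>2) * (real ((s n)\<^sup>2) / real n)) \<longlonglongrightarrow> L * 1"
      by (intro tendsto_mult ratio filterlim_compose[OF assms s_inf])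
    moreover have "eventually (\<lambda>n. ?S ((s n)\<^sup>2) / real ((s n)\<^sup>2) * (real ((s n)\<^sup>2) / real n)
      = ?S ((s n)\<^sup>2) / real n) sequentially"
      using filterlim_at_top[THEN iffD1, OF s_inf, rule_format, of 1] by eventually_elim auto
    ultimately have "(\<lambda>n. ?S ((s n)\<^sup>2) / real n) \<longlonglongrightarrow> L * 1"
      by (rule Lim_transform_eventually)
    thus ?thesis by simp
  qed
  have diff: "(\<lambda>n. ?S n / real n - ?S ((s n)\<^sup>2) / real n) \<longlonglongrightarrow> 0"
  proof (rule LIMSEQ_I)
    fix \<epsilon> :: real assume "0 < \<epsilon>"
    \<comment> \<open>Each endpoint contributes \<open>7 * C * \<delta> * n\<close>, and
      \<open>14 / 15 < 1\<close> makes the final estimate strict.\<close>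
    define \<delta> where "\<delta> = \<epsilon> / (15 * C)"
    define R where "R = real (l1 a + l1 b)"
    have \<delta>: "0 < \<delta>" "0 \<le> R" using \<open>0 < \<epsilon>\<close> C_pos by (auto simp: \<delta>_def R_def)
    have "(\<lambda>n. (1 - real ((s n)\<^sup>2) / real n) * R) \<longlonglongrightarrow> (1 - 1) * R"
      by (intro tendsto_intros ratio)
    hence "eventually (\<lambda>n. (1 - real ((s n)\<^sup>2) / real n) * R < \<delta>) sequentially"
      using \<delta> by (intro order_tendstoD(2)) auto
    with eventually_real_sequentially[OF T_local_bound[OF \<delta>]] eventually_gt_at_top[of 0]
    have "eventually (\<lambda>n. norm (?S n / real n - ?S ((s n)\<^sup>2) / real n - 0) < \<epsilon>) sequentially"
    proof eventually_elim
      case (elim n)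
      have close: "T (of_nat n *s x) (of_nat ((s n)\<^sup>2) *s x) \<le> 7 * C * \<delta> * real n" if x: "real (l1 x) \<le> R" for x
      proof -
        have "of_nat ((s n)\<^sup>2) *s x - of_nat n *s x = - (of_nat (n - (s n)\<^sup>2) *s x)"
          using s1[of n] by (simp add: vec_eq_iff algebra_simps of_nat_diff)
        hence "l1 (of_nat ((s n)\<^sup>2) *s x - of_nat n *s x) = (n - (s n)\<^sup>2) * l1 x"
          by (simp only: l1_minus l1_smult)
        hence "real (l1 (of_nat ((s n)\<^sup>2) *s x - of_nat n *s x)) = (real n - real ((s n)\<^sup>2)) * real (l1 x)"
          using s1[of n] by (simp only: of_nat_mult of_nat_diff)
        also have "\<dots> \<le> (real n - real ((s n)\<^sup>2)) * R" 
          using x s1[of n] by (intro mult_left_mono) (auto simp flip: of_nat_power)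
        also have "\<dots> \<le> \<delta> * real n" using elim(2,3) by (simp add: field_simps)
        finally have "real (l1 (of_nat ((s n)\<^sup>2) *s x - of_nat n *s x)) \<le> \<delta> * real n" .
        moreover have "real (l1 (of_nat n *s x)) \<le> R * real n" using mult_right_mono[OF x, of "real n"] by (simp add: l1_smult mult.commute)
        ultimately show ?thesis using elim(1) by blast
      qed
      have "\<bar>?S n - ?S ((s n)\<^sup>2)\<bar> \<le> 14 * C * \<delta> * real n"
        using T_diff_le[of "of_nat n *s a" "of_nat n *s b" "of_nat ((s n)\<^sup>2) *s a" "of_nat ((s n)\<^sup>2) *s b"]
          close[of a] close[of b] unfolding R_def by linarith
      also have "\<dots> < \<epsilon> * real n" using \<open>0 < \<epsilon>\<close> C_pos elim(2) by (simp add: \<delta>_def)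
      finally show ?case using elim(2) by (simp add: diff_divide_distrib[symmetric] abs_divide divide_less_eq)
    qed
    thus "\<exists>no. \<forall>n\<ge>no. norm (?S n / real n - ?S ((s n)\<^sup>2) / real n - 0) < \<epsilon>"
      by (simp add: eventually_sequentially)
  qed
  show ?thesis using tendsto_add[OF diff main] by simp
qed

end

section \<open>The asymptotic norm\<close>

text \<open>The constants and \<open>NZ\<close> are chosen before the realisation. Only countably
  many pairs of lattice points \<open>a\<close>, \<open>v\<close> occur, so one null set serves for
  all.\<close>

lemma (in iid_weights) AE_passage_times_converge:
  obtains c C NZ where
    "AE \<omega> in M. fpp_configuration (\<lambda>e. \<tau> e \<omega>) c C \<and>
      (\<forall>a v :: int ^ 'n. (\<lambda>n. passage_time (\<lambda>e. \<tau> e \<omega>) (of_nat n *s a) (of_nat n *s (a + v)) / real n) \<longlonglongrightarrow> NZ v)"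
proof -
  obtain c where c: "0 < c" "AE \<omega> in M. eventually (\<lambda>k. \<forall>(x :: int ^ 'n) p. l1 x \<le> k\<^sup>2 \<longrightarrow> p \<in> walks k x \<longrightarrow> distinct p \<longrightarrow>
       c * real k \<le> path_cost (\<lambda>e. \<tau> e \<omega>) p) sequentially" by (rule AE_long_paths_expensive)
  obtain C where C: "0 < C" "AE \<omega> in M. eventually (\<lambda>k. \<forall>x y. l1 x \<le> k\<^sup>2 \<longrightarrow> l1 (y - x) = k \<longrightarrow>
       passage_time (\<lambda>e. \<tau> e \<omega>) x y \<le> C * real k) sequentially" by (rule AE_T_linear_bound)
  define K where "K v = l1 v + nat \<lceil>C * real (l1 v) / c\<rceil> + 1" for v :: "int ^ 'n"
  have K: "C * real (l1 v) / c \<le> real (K v)" "l1 v \<le> K v" "1 \<le> K v" for v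
  proof -
    have "C * real (l1 v) / c \<le> real (nat \<lceil>C * real (l1 v) / c\<rceil>)" by (rule real_nat_ceiling_ge)
    thus "C * real (l1 v) / c \<le> real (K v)" unfolding K_def by linarith
  qed (auto simp: K_def)
  have "AE \<omega> in M. \<forall>a v. (\<lambda>k. Time (K v * k\<^sup>2) (of_nat (k\<^sup>2) *s a) (of_nat (k\<^sup>2) *s (a + v)) \<omega> / real (k\<^sup>2)) \<longlonglongrightarrow> mean_limit v (K v)"
    unfolding AE_all_countable using AE_Time_squares K(2) by blast
  with c(2) C(2) AE_weights_pos
  have "AE \<omega> in M. fpp_configuration (\<lambda>e. \<tau> e \<omega>) c C \<and>
      (\<forall>a v :: int ^ 'n. (\<lambda>n. passage_time (\<lambda>e. \<tau> e \<omega>) (of_nat n *s a) (of_nat n *s (a + v)) / real n) \<longlonglongrightarrow> mean_limit v (K v))"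
  proof eventually_elim
    case (elim \<omega>)
    interpret fpp_configuration "\<lambda>e. \<tau> e \<omega>" c C
      using elim c(1) C(1) by unfold_locales (auto intro: less_imp_le)
    have "(\<lambda>n. T (of_nat n *s a) (of_nat n *s (a + v)) / real n) \<longlonglongrightarrow> mean_limit v (K v)" for a v
    proof (rule T_limit_from_squares)
      have sq: "filterlim (\<lambda>k::nat. k\<^sup>2) at_top sequentially"
        by (rule filterlim_subseq) (auto intro!: strict_monoI power_strict_mono)
      have "eventually (\<lambda>k. Time (K v * k\<^sup>2) (of_nat (k\<^sup>2) *s a) (of_nat (k\<^sup>2) *s (a + v)) \<omega> / real (k\<^sup>2)
        = T (of_nat (k\<^sup>2) *s a) (of_nat (k\<^sup>2) *s (a + v)) / real (k\<^sup>2)) sequentially"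
        using eventually_compose_filterlim[OF T_eq_bounded_time[OF K[of v], of a] sq] by eventually_elim simp
      with elim(4) show "(\<lambda>k. T (of_nat (k\<^sup>2) *s a) (of_nat (k\<^sup>2) *s (a + v)) / real (k\<^sup>2)) \<longlonglongrightarrow> mean_limit v (K v)"
        by (blast intro: Lim_transform_eventually)
    qed
    thus ?case using fpp_configuration_axioms by blast
  qed
  thus ?thesis by (rule that)
qed

section \<open>Extension of the lattice limits to a norm on the Euclidean space\<close>

definition floor_vec :: "real ^ 'n \<Rightarrow> int ^ 'n" where
  "floor_vec x = (\<chi> i. \<lfloor>x $ i\<rfloor>)"

definition rl1 :: "real ^ 'n \<Rightarrow> real" where
  "rl1 x = (\<Sum>i\<in>UNIV. \<bar>x $ i\<bar>)"

lemma rl1_real_vec: "rl1 (real_vec v) = real (l1 v)"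
  by (simp add: rl1_def real_vec_def l1_def)

lemma rl1_nonneg [simp]: "0 \<le> rl1 x"
  by (simp add: rl1_def sum_nonneg)

lemma rl1_eq_0_iff [simp]: "rl1 x = 0 \<longleftrightarrow> x = 0"
  by (simp add: rl1_def sum_nonneg_eq_0_iff vec_eq_iff)

lemma rl1_0 [simp]: "rl1 0 = 0"
  by simp

lemma rl1_triangle: "rl1 (x + y) \<le> rl1 x + rl1 y"
  unfolding rl1_def sum.distrib[symmetric] by (intro sum_mono) auto

lemma rl1_scaleR [simp]: "rl1 (t *\<^sub>R x) = \<bar>t\<bar> * rl1 x"
  by (simp add: rl1_def sum_distrib_left abs_mult)

lemma rl1_minus [simp]: "rl1 (- x) = rl1 x"
  by (simp add: rl1_def)

lemma rl1_le_card:
  fixes x :: "real ^ 'n"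
  assumes "\<And>i. \<bar>x $ i\<bar> \<le> b"
  shows "rl1 x \<le> real CARD('n) * b"
  unfolding rl1_def using assms by (intro sum_bounded_above) auto

lemma real_vec_diff: "real_vec (u - v) = real_vec u - real_vec v"
  and real_vec_add: "real_vec (u + v) = real_vec u + real_vec v"
  and real_vec_minus: "real_vec (- u) = - real_vec u"
  and real_vec_smult: "real_vec (of_nat n *s u) = real n *\<^sub>R real_vec u"
  and real_vec_0 [simp]: "real_vec 0 = 0"
  by (simp_all add: real_vec_def vec_eq_iff)

lemma rl1_floor_vec:
  fixes x :: "real ^ 'n"
  shows "rl1 (real_vec (floor_vec x) - x) \<le> real CARD('n)"
proof -
  have "\<bar>(real_vec (floor_vec x) - x) $ i\<bar> \<le> 1" for i
    unfolding real_vec_def floor_vec_def by (simp, linarith)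
  thus ?thesis using rl1_le_card[of "real_vec (floor_vec x) - x" 1] by simp
qed

lemma rl1_floor_vec':
  fixes x :: "real ^ 'n"
  shows "rl1 (- (real_vec (floor_vec x) - x)) \<le> real CARD('n)"
  unfolding rl1_minus by (rule rl1_floor_vec)

lemma floor_vec_real_vec [simp]: "floor_vec (real_vec v) = v"
  by (simp add: floor_vec_def real_vec_def vec_eq_iff)

lemma l1_eq_rl1: "real (l1 (u - v)) = rl1 (real_vec u - real_vec v)"
  by (simp add: rl1_real_vec real_vec_diff[symmetric])

text \<open>The limit is required for every base point \<open>a\<close> and does not depend on it.
  This gives symmetry and subadditivity of \<open>NZ\<close> directly, and later the distances
  between two moving points.\<close>

locale fpp_limit = fpp_configuration w c C
  for w :: "(int ^ 'n) set \<Rightarrow> real" and c C +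
  fixes NZ :: "int ^ 'n \<Rightarrow> real"
  assumes T_limit: "\<And>a v. (\<lambda>n. T (of_nat n *s a) (of_nat n *s (a + v)) / real n) \<longlonglongrightarrow> NZ v"
begin

lemma T_limit_0: "(\<lambda>n. T 0 (of_nat n *s v) / real n) \<longlonglongrightarrow> NZ v"
  using T_limit[of 0 v] by simp

lemma NZ_ge: "c * real (l1 v) \<le> NZ v"
proof (rule tendsto_lowerbound[OF T_limit_0])
  show "eventually (\<lambda>n. c * real (l1 v) \<le> T 0 (of_nat n *s v) / real n) sequentially"
    using T_multiple_ge[of v] eventually_gt_at_top[of 0] by eventually_elim (simp add: field_simps)
qed simp

lemma NZ_le: "NZ v \<le> C * real (l1 v)"
proof (rule tendsto_upperbound[OF T_limit_0])
  show "eventually (\<lambda>n. T 0 (of_nat n *s v) / real n \<le> C * real (l1 v)) sequentially"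
    using T_multiple_le[of 0 v] eventually_gt_at_top[of 0] by eventually_elim (simp add: field_simps)
qed simp

lemma NZ_nonneg: "0 \<le> NZ v"
  using NZ_ge[of v] c_pos by (meson less_imp_le mult_nonneg_nonneg of_nat_0_le_iff order_trans)

lemma NZ_add: "NZ (u + v) \<le> NZ u + NZ v"
proof (rule LIMSEQ_le[OF T_limit_0 tendsto_add[OF T_limit_0 T_limit]])
  show "\<exists>N. \<forall>n\<ge>N. T 0 (of_nat n *s (u + v)) / real n
    \<le> T 0 (of_nat n *s u) / real n + T (of_nat n *s u) (of_nat n *s (u + v)) / real n"
    unfolding add_divide_distrib[symmetric] by (intro exI allI impI divide_right_mono T_triangle) simp
qed

lemma NZ_minus: "NZ (- v) = NZ v"
  using LIMSEQ_unique[OF T_limit_0[of v]] T_limit[of v "- v"] by (simp add: T_commute)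

lemma NZ_smult: "NZ (of_nat k *s v) = real k * NZ v"
proof (cases "k = 0")
  case True
  thus ?thesis using NZ_le[of 0] NZ_nonneg[of 0] by simp
next
  case False
  have "(\<lambda>n. T 0 (of_nat (n * k) *s v) / real (n * k)) \<longlonglongrightarrow> NZ v"
    by (rule filterlim_compose[OF T_limit_0]) (use False in \<open>auto intro!: filterlim_subseq strict_monoI\<close>)
  hence "(\<lambda>n. real k * (T 0 (of_nat (n * k) *s v) / real (n * k))) \<longlonglongrightarrow> real k * NZ v"
    by (rule tendsto_mult_left)
  moreover have "real k * (T 0 (of_nat (n * k) *s v) / real (n * k)) = T 0 (of_nat n *s (of_nat k *s v)) / real n" for n
    using False by (simp add: vector_smult_assoc)
  ultimately have "(\<lambda>n. T 0 (of_nat n *s (of_nat k *s v)) / real n) \<longlonglongrightarrow> real k * NZ v" by simp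
  thus ?thesis using LIMSEQ_unique[OF T_limit_0] by blast
qed

lemma NZ_diff: "\<bar>NZ u - NZ v\<bar> \<le> C * real (l1 (u - v))"
  using NZ_add[of "u - v" v] NZ_add[of "v - u" u] NZ_le[of "u - v"] NZ_le[of "v - u"] l1_minus_commute[of u v]
  by simp

text \<open>Homogeneous extension to rational points and continuous extension to real ones in a
  single limit. Only \<open>NZ\<close> enters, so the resulting norm is common to all realisations
  with these limits.\<close>

definition N_approx :: "real ^ 'n \<Rightarrow> nat \<Rightarrow> real" where
  "N_approx x n = NZ (floor_vec (real n *\<^sub>R x)) / real n"

definition N :: "real ^ 'n \<Rightarrow> real" where
  "N x = lim (N_approx x)"

lemma B_pos: "0 < (C * real CARD('n))"
  using C_pos by simp

text \<open>Both \<open>n\<close> times the rounding of \<open>m x\<close> and \<open>m\<close>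
  times the rounding of \<open>n x\<close> approximate \<open>m n x\<close>, with errors at most
  \<open>n\<close> and \<open>m\<close> per coordinate, and \<open>NZ\<close> is homogeneous and
  Lipschitz.\<close>

lemma N_approx_diff:
  assumes "0 < m" "0 < n"
  shows "\<bar>N_approx x m - N_approx x n\<bar> \<le> (C * real CARD('n)) / real m + (C * real CARD('n)) / real n"
proof -
  let ?u = "of_nat n *s floor_vec (real m *\<^sub>R x)" and ?v = "of_nat m *s floor_vec (real n *\<^sub>R x)"
  have "\<bar>(real_vec ?u - real_vec ?v) $ i\<bar> \<le> real m + real n" for i
  proof -
    have a: "real_of_int \<lfloor>real k * y\<rfloor> \<le> real k * y" "real k * y - 1 \<le> real_of_int \<lfloor>real k * y\<rfloor>" for k y
      by linarith+
    have "real n * real_of_int \<lfloor>real m * x $ i\<rfloor> \<le> real n * (real m * x $ i)"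
      "real n * (real m * x $ i - 1) \<le> real n * real_of_int \<lfloor>real m * x $ i\<rfloor>"
      "real m * real_of_int \<lfloor>real n * x $ i\<rfloor> \<le> real m * (real n * x $ i)"
      "real m * (real n * x $ i - 1) \<le> real m * real_of_int \<lfloor>real n * x $ i\<rfloor>"
      by (intro mult_left_mono a; simp)+
    thus ?thesis by (simp add: real_vec_def floor_vec_def algebra_simps abs_le_iff)
  qed
  hence "real (l1 (?u - ?v)) \<le> real CARD('n) * (real m + real n)"
    unfolding l1_eq_rl1 by (rule rl1_le_card)
  hence "\<bar>NZ ?u - NZ ?v\<bar> \<le> C * (real CARD('n) * (real m + real n))"
    using C_pos by (intro order_trans[OF NZ_diff] mult_left_mono) auto
  hence "\<bar>real n * NZ (floor_vec (real m *\<^sub>R x)) - real m * NZ (floor_vec (real n *\<^sub>R x))\<bar> / (real m * real n)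
    \<le> C * (real CARD('n) * (real m + real n)) / (real m * real n)"
    unfolding NZ_smult by (intro divide_right_mono) auto
  also have "\<dots> = (C * real CARD('n)) / real m + (C * real CARD('n)) / real n" using assms by (simp add: field_simps)
  also have "\<bar>real n * NZ (floor_vec (real m *\<^sub>R x)) - real m * NZ (floor_vec (real n *\<^sub>R x))\<bar> / (real m * real n)
    = \<bar>(real n * NZ (floor_vec (real m *\<^sub>R x)) - real m * NZ (floor_vec (real n *\<^sub>R x))) / (real m * real n)\<bar>"
    by (simp add: abs_divide abs_mult)
  also have "(real n * NZ (floor_vec (real m *\<^sub>R x)) - real m * NZ (floor_vec (real n *\<^sub>R x))) / (real m * real n)
    = N_approx x m - N_approx x n"
    using assms by (simp add: N_approx_def field_simps)
  finally show ?thesis .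
qed

lemma N_approx_tendsto: "N_approx x \<longlonglongrightarrow> N x"
proof -
  have "Cauchy (N_approx x)"
  proof (rule CauchyI)
    fix e :: real assume "0 < e"
    obtain M0 :: nat where M0: "2 * (C * real CARD('n)) / e < real M0" using reals_Archimedean2 by blast
    have M0': "0 < real M0" using M0 B_pos \<open>0 < e\<close> by (smt (verit) divide_pos_pos)
    show "\<exists>M. \<forall>m\<ge>M. \<forall>n\<ge>M. norm (N_approx x m - N_approx x n) < e"
    proof (intro exI allI impI)
      fix m n assume mn: "M0 \<le> m" "M0 \<le> n"
      have "\<bar>N_approx x m - N_approx x n\<bar> \<le> (C * real CARD('n)) / real m + (C * real CARD('n)) / real n"
        using mn M0' by (intro N_approx_diff) auto
      also have "\<dots> \<le> (C * real CARD('n)) / real M0 + (C * real CARD('n)) / real M0"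
        using mn M0' B_pos by (intro add_mono divide_left_mono) auto
      also have "\<dots> < e" using M0 M0' \<open>0 < e\<close> by (simp add: field_simps)
      finally show "norm (N_approx x m - N_approx x n) < e" by simp
    qed
  qed
  thus ?thesis unfolding N_def by (simp add: Cauchy_convergent_iff convergent_LIMSEQ_iff)
qed

lemma N_real_vec: "N (real_vec v) = NZ v"
proof -
  have "N_approx (real_vec v) n = NZ v" if "0 < n" for n
    using that by (simp add: N_approx_def NZ_smult flip: real_vec_smult)
  hence "eventually (\<lambda>n. N_approx (real_vec v) n = NZ v) sequentially"
    using eventually_gt_at_top[of 0] by (rule eventually_mono[rotated])
  hence "N_approx (real_vec v) \<longlonglongrightarrow> NZ v" by (rule tendsto_eventually)
  thus ?thesis using LIMSEQ_unique[OF N_approx_tendsto] by blast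
qed

lemma N_approx_lipschitz:
  assumes "0 < n"
  shows "\<bar>N_approx x n - N_approx y n\<bar> \<le> C * rl1 (x - y) + 2 * (C * real CARD('n)) / real n"
proof -
  let ?u = "floor_vec (real n *\<^sub>R x)" and ?v = "floor_vec (real n *\<^sub>R y)"
  have e: "real_vec ?u - real_vec ?v = (real_vec ?u - real n *\<^sub>R x) + real n *\<^sub>R (x - y) + - (real_vec ?v - real n *\<^sub>R y)"
    by (simp add: algebra_simps)
  have "real (l1 (?u - ?v)) \<le> real CARD('n) + real n * rl1 (x - y) + real CARD('n)"
    unfolding l1_eq_rl1 e
    by (intro order_trans[OF rl1_triangle] add_mono rl1_floor_vec rl1_floor_vec') simp
  hence "\<bar>NZ ?u - NZ ?v\<bar> \<le> C * (2 * real CARD('n) + real n * rl1 (x - y))"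
    using C_pos by (intro order_trans[OF NZ_diff] mult_left_mono) auto
  hence "\<bar>NZ ?u - NZ ?v\<bar> / real n \<le> C * (2 * real CARD('n) + real n * rl1 (x - y)) / real n"
    by (intro divide_right_mono) auto
  also have "\<dots> = C * rl1 (x - y) + 2 * (C * real CARD('n)) / real n" using assms by (simp add: field_simps)
  finally show ?thesis unfolding N_approx_def diff_divide_distrib[symmetric] by (simp add: abs_divide)
qed

lemma N_lipschitz: "\<bar>N x - N y\<bar> \<le> C * rl1 (x - y)"
proof (rule tendsto_le[OF sequentially_bot _ tendsto_rabs[OF tendsto_diff[OF N_approx_tendsto N_approx_tendsto]]])
  show "(\<lambda>n. C * rl1 (x - y) + 2 * (C * real CARD('n)) / real n) \<longlonglongrightarrow> C * rl1 (x - y)"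
    using tendsto_add[OF tendsto_const lim_const_over_n[of "2 * (C * real CARD('n))"]] by simp
  show "eventually (\<lambda>n. \<bar>N_approx x n - N_approx y n\<bar> \<le> C * rl1 (x - y) + 2 * (C * real CARD('n)) / real n) sequentially"
    using eventually_gt_at_top[of 0] by eventually_elim (rule N_approx_lipschitz)
qed

lemma N_le: "N x \<le> C * rl1 x"
proof -
  have "N 0 = 0" using N_real_vec[of 0] NZ_smult[of 0 0] by simp
  thus ?thesis using N_lipschitz[of x 0] by simp
qed

lemma N_of_nat: "N (real k *\<^sub>R x) = real k * N x"
proof (cases "k = 0")
  case True
  thus ?thesis using N_real_vec[of 0] NZ_smult[of 0 0] by simp
next
  case False
  have "(\<lambda>n. N_approx x (n * k)) \<longlonglongrightarrow> N x"
    by (rule filterlim_compose[OF N_approx_tendsto]) (use False in \<open>auto intro!: filterlim_subseq strict_monoI\<close>)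
  hence "(\<lambda>n. real k * N_approx x (n * k)) \<longlonglongrightarrow> real k * N x" by (rule tendsto_mult_left)
  moreover have "real k * N_approx x (n * k) = N_approx (real k *\<^sub>R x) n" for n
    using False by (simp add: N_approx_def)
  ultimately have "(\<lambda>n. N_approx (real k *\<^sub>R x) n) \<longlonglongrightarrow> real k * N x" by simp
  thus ?thesis using LIMSEQ_unique[OF N_approx_tendsto] by blast
qed

lemma N_floor_vec: "\<bar>N x - NZ (floor_vec x)\<bar> \<le> C * real CARD('n)"
proof -
  have "\<bar>NZ (floor_vec x) - N x\<bar> \<le> C * rl1 (real_vec (floor_vec x) - x)"
    using N_lipschitz[of "real_vec (floor_vec x)" x] by (simp add: N_real_vec)
  also have "\<dots> \<le> C * real CARD('n)" using rl1_floor_vec C_pos by (intro mult_left_mono) auto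
  finally show ?thesis by (simp add: abs_minus_commute)
qed

text \<open>Discretisation errors do not grow under the scaling \<open>x \<mapsto> n x\<close>, so they are removed by this
  Archimedean argument.\<close>

lemma nonpos_if_multiples_bounded:
  fixes a D :: real
  assumes "\<And>n::nat. real n * a \<le> D"
  shows "a \<le> 0"
  using assms reals_Archimedean3[of a] by (meson leD not_less)

lemma N_ge: "c * rl1 x \<le> N x"
proof -
  have "real n * (c * rl1 x - N x) \<le> (c + C) * real CARD('n)" for n
  proof -
    let ?y = "real n *\<^sub>R x"
    have "rl1 ?y \<le> rl1 (real_vec (floor_vec ?y)) + rl1 (- (real_vec (floor_vec ?y) - ?y))"
      using rl1_triangle[of "real_vec (floor_vec ?y)" "- (real_vec (floor_vec ?y) - ?y)"] by simp
    also have "\<dots> \<le> real (l1 (floor_vec ?y)) + real CARD('n)"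
      using rl1_floor_vec'[of ?y] by (simp add: rl1_real_vec)
    finally have "c * rl1 ?y \<le> c * (real (l1 (floor_vec ?y)) + real CARD('n))" using c_pos by (intro mult_left_mono) auto
    thus ?thesis using NZ_ge[of "floor_vec ?y"] N_floor_vec[of ?y] N_of_nat[of n x] by (simp add: algebra_simps)
  qed
  from nonpos_if_multiples_bounded[OF this] show ?thesis by simp
qed

lemma N_subadd: "N (x + y) \<le> N x + N y"
proof -
  have "real n * (N (x + y) - N x - N y) \<le> 4 * (C * real CARD('n))" for n
  proof -
    let ?x = "real n *\<^sub>R x" and ?y = "real n *\<^sub>R y"
    have "rl1 (?x + ?y - real_vec (floor_vec ?x + floor_vec ?y))
      \<le> rl1 (- (real_vec (floor_vec ?x) - ?x)) + rl1 (- (real_vec (floor_vec ?y) - ?y))"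
      using rl1_triangle[of "- (real_vec (floor_vec ?x) - ?x)" "- (real_vec (floor_vec ?y) - ?y)"]
      by (simp add: real_vec_add algebra_simps)
    hence "rl1 (?x + ?y - real_vec (floor_vec ?x + floor_vec ?y)) \<le> 2 * real CARD('n)"
      using rl1_floor_vec'[of ?x] rl1_floor_vec'[of ?y] by linarith
    hence "C * rl1 (?x + ?y - real_vec (floor_vec ?x + floor_vec ?y)) \<le> C * (2 * real CARD('n))"
      using C_pos by (intro mult_left_mono) auto
    hence "N (?x + ?y) \<le> NZ (floor_vec ?x + floor_vec ?y) + 2 * (C * real CARD('n))"
      using N_lipschitz[of "?x + ?y" "real_vec (floor_vec ?x + floor_vec ?y)"] by (simp add: N_real_vec)
    hence "N (?x + ?y) \<le> N ?x + N ?y + 4 * (C * real CARD('n))"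
      using NZ_add[of "floor_vec ?x" "floor_vec ?y"] N_floor_vec[of ?x] N_floor_vec[of ?y] by linarith
    moreover have "N (?x + ?y) = real n * N (x + y)"
      using N_of_nat[of n "x + y"] by (simp add: scaleR_add_right)
    ultimately show ?thesis by (simp add: N_of_nat algebra_simps)
  qed
  from nonpos_if_multiples_bounded[OF this] show ?thesis by simp
qed

lemma N_minus: "N (- x) = N x"
proof -
  have "N (- x) - N x \<le> 0" for x
  proof (rule nonpos_if_multiples_bounded)
    fix n
    let ?y = "real n *\<^sub>R x"
    have "C * rl1 (- ?y - real_vec (- floor_vec ?y)) \<le> C * real CARD('n)"
      using C_pos rl1_floor_vec[of ?y] by (intro mult_left_mono) (simp_all add: real_vec_minus)
    hence "N (- ?y) \<le> N ?y + 2 * (C * real CARD('n))"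
      using N_lipschitz[of "- ?y" "real_vec (- floor_vec ?y)"] N_floor_vec[of ?y]
      unfolding N_real_vec NZ_minus by linarith
    moreover have "N (- ?y) = real n * N (- x)" using N_of_nat[of n "- x"] by simp
    ultimately show "real n * (N (- x) - N x) \<le> 2 * (C * real CARD('n))" by (simp add: N_of_nat algebra_simps)
  qed
  from this[of x] this[of "- x"] show ?thesis by simp
qed

text \<open>Real factors are reached from integer ones: \<open>k * t\<close> differs from its
  integer part by at most \<open>1\<close>, so \<open>k\<close> times the defect stays below a bound
  independent of \<open>k\<close>.\<close>

lemma N_scaleR_nonneg:
  assumes "0 \<le> t"
  shows "N (t *\<^sub>R x) = t * N x"
proof -
  define D where "D = C * rl1 x + N x"
  have Nx: "0 \<le> N x" using N_ge[of x] c_pos by (meson less_imp_le mult_nonneg_nonneg rl1_nonneg order_trans)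
  have "real k * \<bar>N (t *\<^sub>R x) - t * N x\<bar> \<le> D" for k
  proof -
    define q where "q = nat \<lfloor>real k * t\<rfloor>"
    have q: "\<bar>real k * t - real q\<bar> \<le> 1" using assms unfolding q_def by (simp add: abs_le_iff) linarith
    have "\<bar>N (real k *\<^sub>R t *\<^sub>R x) - N (real q *\<^sub>R x)\<bar> \<le> C * rl1 ((real k * t - real q) *\<^sub>R x)"
      using N_lipschitz[of "real k *\<^sub>R t *\<^sub>R x" "real q *\<^sub>R x"] by (simp add: algebra_simps)
    also have "\<dots> \<le> C * rl1 x" using q C_pos by (simp add: mult_left_le_one_le)
    finally have "\<bar>real k * N (t *\<^sub>R x) - real q * N x\<bar> \<le> C * rl1 x" unfolding N_of_nat .
    moreover have "\<bar>real q * N x - real k * t * N x\<bar> \<le> 1 * N x"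
      unfolding left_diff_distrib[symmetric] abs_mult using q Nx by (intro mult_mono) auto
    ultimately have "\<bar>real k * N (t *\<^sub>R x) - real k * t * N x\<bar> \<le> D" unfolding D_def by linarith
    thus ?thesis by (simp add: abs_mult[of "real k", simplified, symmetric] algebra_simps)
  qed
  from nonpos_if_multiples_bounded[OF this] show ?thesis by simp
qed

lemma N_is_norm: "is_norm N"
  unfolding is_norm_def
proof (intro conjI allI)
  fix x y and t :: real
  show nn: "0 \<le> N x" using N_ge[of x] c_pos by (meson less_imp_le mult_nonneg_nonneg rl1_nonneg order_trans)
  show "N x = 0 \<longleftrightarrow> x = 0"
  proof
    assume "N x = 0"
    hence "c * rl1 x \<le> 0" using N_ge[of x] by simp
    hence "rl1 x \<le> 0" using c_pos by (simp add: mult_le_0_iff)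
    thus "x = 0" using rl1_nonneg[of x] rl1_eq_0_iff[of x] by linarith
  next
    assume "x = 0"
    thus "N x = 0" using N_le[of 0] N_ge[of 0] by simp
  qed
  show "N (t *\<^sub>R x) = \<bar>t\<bar> * N x"
    using N_scaleR_nonneg[of t x] N_scaleR_nonneg[of "- t" x] N_minus[of "t *\<^sub>R x"] by (cases "0 \<le> t") auto
  show "N (x + y) \<le> N x + N y" by (rule N_subadd)
qed

text \<open>A grid of mesh \<open>n\<close>, the integer part of \<open>\<delta> * t\<close>, covers
  the box of size \<open>R * t\<close> by points \<open>of_nat n *s a\<close> with \<open>a\<close>
  in a finite set \<open>S\<close> that does not depend on \<open>t\<close>. Convergence for the
  finitely many pairs from \<open>S\<close> is automatically uniform, and rounding to the grid costs
  a multiple of \<open>\<delta> * t\<close> in \<open>T\<close> and in \<open>N\<close>.\<close>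

lemma T_uniform:
  assumes "0 < \<epsilon>" "0 \<le> R"
  shows "eventually (\<lambda>t. \<forall>x y. real (l1 x) \<le> R * t \<longrightarrow> real (l1 y) \<le> R * t \<longrightarrow>
    \<bar>T x y - N (real_vec x - real_vec y)\<bar> \<le> \<epsilon> * t) at_top"
proof -
  define d where "d = real CARD('n)"
  have d: "1 \<le> d" unfolding d_def by (simp add: Suc_le_eq)
  \<comment> \<open>Error budget: \<open>14 * C * d * \<delta>\<close> for moving both endpoints to
    the grid, \<open>2 * C * d * \<delta>\<close> for the corresponding change of \<open>N\<close>,
    and \<open>\<delta>\<close> for the convergence on the grid.\<close>
  define \<delta> where "\<delta> = \<epsilon> / (16 * C * d + 1)"
  have Cd: "0 < 16 * C * d + 1" using C_pos d by (intro add_pos_pos mult_pos_pos) auto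
  have \<delta>: "0 < \<delta>" using assms Cd by (simp add: \<delta>_def)
  \<comment> \<open>If \<open>l1 x \<le> R * t\<close>, the grid point next to \<open>x\<close> has
    size at most \<open>(R + d * \<delta>) * t\<close>, and \<open>t \<le> 2 * n / \<delta>\<close>;
    dividing by \<open>n\<close> gives the radius.\<close>
  define S where "S = {a :: int ^ 'n. l1 a \<le> nat \<lceil>2 * (R + d * \<delta>) / \<delta>\<rceil>}"
  have S: "finite S" unfolding S_def by (rule finite_l1_ball)
  have "eventually (\<lambda>n. \<forall>a\<in>S. \<forall>b\<in>S. \<bar>T (of_nat n *s a) (of_nat n *s b) / real n - NZ (b - a)\<bar> < 1) sequentially"
  proof (intro eventually_ball_finite S ballI)
    fix a b
    show "eventually (\<lambda>n. \<bar>T (of_nat n *s a) (of_nat n *s b) / real n - NZ (b - a)\<bar> < 1) sequentially"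
      using tendstoD[OF T_limit[of a "b - a"], of 1] by (simp add: dist_real_def)
  qed
  hence "eventually (\<lambda>n. 1 \<le> n \<and> (\<forall>a\<in>S. \<forall>b\<in>S. \<bar>T (of_nat n *s a) (of_nat n *s b) - real n * NZ (b - a)\<bar> \<le> real n)) sequentially"
    using eventually_ge_at_top[of 1]
  proof eventually_elim
    case (elim n)
    have "\<bar>T (of_nat n *s a) (of_nat n *s b) - real n * NZ (b - a)\<bar> \<le> real n" if "a \<in> S" "b \<in> S" for a b
    proof -
      have "T (of_nat n *s a) (of_nat n *s b) - real n * NZ (b - a)
        = real n * (T (of_nat n *s a) (of_nat n *s b) / real n - NZ (b - a))"
        using elim(2) by (simp add: field_simps)
      moreover have "\<bar>T (of_nat n *s a) (of_nat n *s b) / real n - NZ (b - a)\<bar> < 1" using elim that by blast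
      ultimately show ?thesis by (simp add: abs_mult mult_left_le)
    qed
    thus ?case using elim(2) by blast
  qed
  moreover have "filterlim (\<lambda>t. nat \<lfloor>\<delta> * t\<rfloor>) at_top (at_top :: real filter)"
    using \<delta> by (intro filterlim_compose[OF filterlim_nat_sequentially] filterlim_compose[OF filterlim_floor_sequentially]
         filterlim_tendsto_pos_mult_at_top[OF tendsto_const] filterlim_ident)
  ultimately have "eventually (\<lambda>t. 1 \<le> nat \<lfloor>\<delta> * t\<rfloor> \<and> (\<forall>a\<in>S. \<forall>b\<in>S. \<bar>T (of_nat (nat \<lfloor>\<delta> * t\<rfloor>) *s a) (of_nat (nat \<lfloor>\<delta> * t\<rfloor>) *s b)
      - real (nat \<lfloor>\<delta> * t\<rfloor>) * NZ (b - a)\<bar> \<le> real (nat \<lfloor>\<delta> * t\<rfloor>))) at_top"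
    by (rule eventually_compose_filterlim)
  moreover have "eventually (\<lambda>t. \<forall>x y. real (l1 x) \<le> R * t \<longrightarrow> real (l1 (y - x)) \<le> (d * \<delta>) * t \<longrightarrow> T x y \<le> 7 * C * (d * \<delta>) * t) at_top"
    using \<delta> d assms by (intro T_local_bound) auto
  ultimately show ?thesis
  proof eventually_elim
    case (elim t)
    define n where "n = nat \<lfloor>\<delta> * t\<rfloor>"
    have n1: "1 \<le> n" using elim unfolding n_def by blast
    have nt: "real n \<le> \<delta> * t" "\<delta> * t \<le> 2 * real n"
      using n1 unfolding n_def by linarith+
    have "0 < \<delta> * t" using nt n1 by linarith
    hence t: "0 < t" using \<delta> by (simp add: zero_less_mult_iff)
    define g where "g x = (\<chi> i. x $ i div int n)" for x :: "int ^ 'n"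
    have close: "real (l1 (of_nat n *s g x - x)) \<le> d * \<delta> * t" for x
    proof -
      have "\<bar>(real_vec (of_nat n *s g x) - real_vec x) $ i\<bar> \<le> real n" for i
      proof -
        have "int n * (x $ i div int n) - x $ i = - (x $ i mod int n)"
          by (simp add: minus_mod_eq_mult_div[symmetric])
        moreover have "(real_vec (of_nat n *s g x) - real_vec x) $ i = real_of_int (int n * (x $ i div int n) - x $ i)"
          by (simp add: real_vec_def g_def)
        ultimately have "(real_vec (of_nat n *s g x) - real_vec x) $ i = - real_of_int (x $ i mod int n)"
          by (simp only: of_int_minus)
        moreover have "0 \<le> x $ i mod int n" "x $ i mod int n \<le> int n" using n1 by (auto intro: order.strict_implies_order)
        ultimately show ?thesis by simp
      qed
      hence "real (l1 (of_nat n *s g x - x)) \<le> d * real n"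
        unfolding l1_eq_rl1 d_def by (rule rl1_le_card)
      also have "\<dots> \<le> d * (\<delta> * t)" using d nt by (intro mult_left_mono) auto
      finally show ?thesis by simp
    qed
    have gS: "g x \<in> S" if "real (l1 x) \<le> R * t" for x
    proof -
      have "real (n * l1 (g x)) \<le> real (l1 (of_nat n *s g x - x)) + real (l1 x)"
        using l1_triangle[of "of_nat n *s g x - x" x] unfolding l1_smult[symmetric] by simp
      also have "\<dots> \<le> (R + d * \<delta>) * t" using close[of x] that by (simp add: algebra_simps)
      also have "\<dots> \<le> (R + d * \<delta>) * (2 * real n / \<delta>)"
        using nt \<delta> d assms by (intro mult_left_mono) (auto simp: field_simps)
      finally have "real n * real (l1 (g x)) \<le> real n * (2 * (R + d * \<delta>) / \<delta>)" by (simp add: algebra_simps)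
      hence "real (l1 (g x)) \<le> 2 * (R + d * \<delta>) / \<delta>"
        by (rule mult_left_le_imp_le) (use n1 in simp)
      hence "real (l1 (g x)) \<le> real (nat \<lceil>2 * (R + d * \<delta>) / \<delta>\<rceil>)" using real_nat_ceiling_ge order_trans by blast
      thus ?thesis by (simp add: S_def)
    qed
    show ?case
    proof (intro allI impI)
      fix x y :: "int ^ 'n" assume x: "real (l1 x) \<le> R * t" and y: "real (l1 y) \<le> R * t"
      have "T x (of_nat n *s g x) \<le> 7 * C * (d * \<delta>) * t" "T y (of_nat n *s g y) \<le> 7 * C * (d * \<delta>) * t"
        using elim x y close by blast+
      hence 1: "\<bar>T x y - T (of_nat n *s g x) (of_nat n *s g y)\<bar> \<le> 14 * (C * d * \<delta> * t)"
        using T_diff_le[of x y "of_nat n *s g x" "of_nat n *s g y"] by simp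
      have 2: "\<bar>T (of_nat n *s g x) (of_nat n *s g y) - real n * NZ (g y - g x)\<bar> \<le> \<delta> * t"
      proof -
        have "\<bar>T (of_nat n *s g x) (of_nat n *s g y) - real n * NZ (g y - g x)\<bar> \<le> real n"
          using elim(1) gS[OF x] gS[OF y] unfolding n_def by blast
        thus ?thesis using nt(1) by linarith
      qed
      have "real n * NZ (g y - g x) = N (real_vec (of_nat n *s (g x - g y)))"
        unfolding N_real_vec NZ_smult using NZ_minus[of "g x - g y"] by simp
      moreover have "\<bar>N (real_vec (of_nat n *s (g x - g y))) - N (real_vec x - real_vec y)\<bar>
        \<le> C * rl1 (real_vec (of_nat n *s (g x - g y)) - (real_vec x - real_vec y))" by (rule N_lipschitz)
      moreover have "rl1 (real_vec (of_nat n *s (g x - g y)) - (real_vec x - real_vec y)) \<le> d * \<delta> * t + d * \<delta> * t"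
      proof -
        have "real_vec (of_nat n *s (g x - g y)) - (real_vec x - real_vec y)
          = (real_vec (of_nat n *s g x) - real_vec x) + - (real_vec (of_nat n *s g y) - real_vec y)"
          by (simp add: real_vec_smult real_vec_diff algebra_simps)
        also have "rl1 \<dots> \<le> rl1 (real_vec (of_nat n *s g x) - real_vec x) + rl1 (- (real_vec (of_nat n *s g y) - real_vec y))"
          by (rule rl1_triangle)
        also have "\<dots> \<le> d * \<delta> * t + d * \<delta> * t"
          unfolding rl1_minus l1_eq_rl1[symmetric] by (intro add_mono close)
        finally show ?thesis .
      qed
      ultimately have 3: "\<bar>real n * NZ (g y - g x) - N (real_vec x - real_vec y)\<bar> \<le> C * (d * \<delta> * t + d * \<delta> * t)"
        using C_pos mult_left_mono[of "rl1 (real_vec (of_nat n *s (g x - g y)) - (real_vec x - real_vec y))"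
          "d * \<delta> * t + d * \<delta> * t" C] by linarith
      have "\<bar>T x y - N (real_vec x - real_vec y)\<bar> \<le> 14 * (C * d * \<delta> * t) + \<delta> * t + C * (d * \<delta> * t + d * \<delta> * t)"
        using 1 2 3 by linarith
      also have "\<dots> = (16 * C * d + 1) * \<delta> * t" by (simp add: algebra_simps)
      also have "(16 * C * d + 1) * \<delta> = \<epsilon>" using Cd by (simp add: \<delta>_def)
      finally show "\<bar>T x y - N (real_vec x - real_vec y)\<bar> \<le> \<epsilon> * t" .
    qed
  qed
qed

text \<open>A self-avoiding path of cost below \<open>t\<close> has fewer than \<open>k0\<close>
  edges or at most \<open>t / c\<close>. The term \<open>k0\<close> covers small \<open>t\<close>,
  as every ball has to be finite.\<close>

lemma fpp_ball_l1_le: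
  obtains k0 where "\<And>t y. y \<in> fpp_ball w t \<Longrightarrow> real (l1 y) \<le> max (real k0) (t / c)"
proof -
  obtain k0 where k0: "\<And>x p y. lattice_path x p y \<Longrightarrow> distinct p \<Longrightarrow> k0 \<le> length p - 1 \<Longrightarrow>
      l1 x \<le> (length p - 1)\<^sup>2 \<Longrightarrow> c * real (length p - 1) \<le> path_cost w p"
    by (rule long_pathsE) blast
  have "real (l1 y) \<le> max (real k0) (t / c)" if "y \<in> fpp_ball w t" for t y
  proof -
    have "T 0 y < t" using that by (simp add: fpp_ball_def)
    then obtain p where p: "lattice_path 0 p y" "distinct p" "path_cost w p < t" by (rule T_lessE)
    have l: "l1 y \<le> length p - 1" using l1_lattice_path_le[OF p(1)] by (simp add: l1_minus)
    show ?thesis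
    proof (cases "k0 \<le> length p - 1")
      case True
      hence "c * real (length p - 1) \<le> path_cost w p" by (intro k0[OF p(1,2)]) auto
      hence "real (length p - 1) \<le> t / c" using p(3) c_pos by (simp add: field_simps)
      with l show ?thesis by linarith
    qed (use l in linarith)
  qed
  thus ?thesis by (rule that)
qed

lemma finite_fpp_ball: "finite (fpp_ball w t)"
proof -
  obtain k0 where k0: "\<And>t y. y \<in> fpp_ball w t \<Longrightarrow> real (l1 y) \<le> max (real k0) (t / c)"
    by (rule fpp_ball_l1_le) blast
  have "fpp_ball w t \<subseteq> {y. l1 y \<le> k0 + nat \<lceil>t / c\<rceil>}"
  proof
    fix y assume "y \<in> fpp_ball w t"
    from k0[OF this] show "y \<in> {y. l1 y \<le> k0 + nat \<lceil>t / c\<rceil>}" by simp linarith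
  qed
  thus ?thesis using finite_l1_ball finite_subset by blast
qed

lemma fpp_ball_l1_bound:
  "eventually (\<lambda>t. \<forall>y\<in>fpp_ball w t. real (l1 y) \<le> 1 / c * t) at_top"
proof -
  obtain k0 where k0: "\<And>t y. y \<in> fpp_ball w t \<Longrightarrow> real (l1 y) \<le> max (real k0) (t / c)"
    by (rule fpp_ball_l1_le) blast
  show ?thesis using eventually_ge_at_top[of "c * real k0"]
  proof eventually_elim
    case (elim t)
    hence "real k0 \<le> t / c" using c_pos by (simp add: field_simps)
    thus ?case using k0[of _ t] by fastforce
  qed
qed

end

section \<open>Measured Gromov--Hausdorff convergence\<close>

lemma eps_isometry_mono:
  "eps_isometry \<epsilon> X dX Y dY h \<Longrightarrow> \<epsilon> \<le> \<epsilon>' \<Longrightarrow> eps_isometry \<epsilon>' X dX Y dY h"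
  unfolding eps_isometry_def by (meson less_le_trans)

text \<open>The infimum of the admissible \<open>\<epsilon>\<close> need not be admissible, whence the summand \<open>1 / t\<close>.\<close>

lemma eps_isometry_rate:
  fixes X :: "real \<Rightarrow> 'a set" and h :: "real \<Rightarrow> 'a \<Rightarrow> 'b"
  assumes ex: "\<And>t. 0 < t \<Longrightarrow> \<exists>\<epsilon>>0. eps_isometry \<epsilon> (X t) (dX t) Y dY (h t)"
    and ev: "\<And>\<epsilon>. 0 < \<epsilon> \<Longrightarrow> eventually (\<lambda>t. eps_isometry \<epsilon> (X t) (dX t) Y dY (h t)) at_top"
  shows "\<exists>\<epsilon>. (\<epsilon> \<longlongrightarrow> 0) at_top \<and> (\<forall>t>0. eps_isometry (\<epsilon> t) (X t) (dX t) Y dY (h t))"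
proof -
  define S where "S t = {\<epsilon>. 0 < \<epsilon> \<and> eps_isometry \<epsilon> (X t) (dX t) Y dY (h t)}" for t
  have bdd: "bdd_below (S t)" for t by (rule bdd_belowI[of _ 0]) (auto simp: S_def)
  define \<epsilon> where "\<epsilon> t = Inf (S t) + 1 / t" for t
  have "eps_isometry (\<epsilon> t) (X t) (dX t) Y dY (h t)" if t: "0 < t" for t
  proof -
    have "S t \<noteq> {}" using ex[OF t] by (auto simp: S_def)
    moreover have "Inf (S t) < \<epsilon> t" using t by (simp add: \<epsilon>_def)
    ultimately obtain \<eta> where "\<eta> \<in> S t" "\<eta> < \<epsilon> t" using cInf_lessD by blast
    hence "eps_isometry \<eta> (X t) (dX t) Y dY (h t)" by (simp add: S_def)
    thus ?thesis using \<open>\<eta> < \<epsilon> t\<close> by (rule eps_isometry_mono[OF _ less_imp_le])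
  qed
  moreover have "(\<epsilon> \<longlongrightarrow> 0) at_top"
  proof (rule tendstoI)
    fix e :: real assume "0 < e"
    show "eventually (\<lambda>t. dist (\<epsilon> t) 0 < e) at_top"
      using ev[of "e / 2", OF half_gt_zero[OF \<open>0 < e\<close>]] eventually_gt_at_top[of "2 / e"] eventually_gt_at_top[of 0]
    proof eventually_elim
      case (elim t)
      have "e / 2 \<in> S t" using elim \<open>0 < e\<close> by (simp add: S_def)
      hence "Inf (S t) \<le> e / 2" by (intro cInf_lower bdd)
      moreover have "1 / t < e / 2" using elim \<open>0 < e\<close> by (simp add: field_simps)
      moreover have "0 \<le> Inf (S t)" 
        by (rule cInf_greatest) (use \<open>e / 2 \<in> S t\<close> in blast, simp add: S_def)
      ultimately show ?case using elim by (simp add: \<epsilon>_def)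
    qed
  qed
  ultimately show ?thesis by blast
qed

lemma norm_le_rl1: "norm x \<le> rl1 x"
  unfolding rl1_def by (rule norm_le_l1_cart)

lemma rl1_le_norm:
  fixes x :: "real ^ 'n"
  shows "rl1 x \<le> real CARD('n) * norm x"
  by (intro rl1_le_card component_le_norm_cart)

section \<open>Rescaled lattice points and their cells\<close>

lemma inj_rescale: "0 < t \<Longrightarrow> inj (rescale t)"
  by (auto intro!: injI simp: rescale_def real_vec_def vec_eq_iff)

lemma inv_rescale [simp]: "0 < t \<Longrightarrow> inv (rescale t) (rescale t x) = x"
  using inj_rescale by (rule inv_f_f)

text \<open>The cell is a half-open cube; its measure is squeezed between those of the open and the
  closed box, which agree.\<close>

lemma floor_cell:
  fixes x :: "int ^ 'n"
  assumes "0 < t"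
  shows "{z. floor_vec (t *\<^sub>R z) = x} \<in> sets borel"
    and "emeasure lborel {z. floor_vec (t *\<^sub>R z) = x} = ennreal ((1 / t) ^ CARD('n))"
proof -
  have cell: "{z. floor_vec (t *\<^sub>R z) = x} = {z. \<forall>i. real_of_int (x $ i) \<le> t * z $ i \<and> t * z $ i < real_of_int (x $ i) + 1}"
    by (auto simp: floor_vec_def vec_eq_iff floor_eq_iff)
  show meas: "{z. floor_vec (t *\<^sub>R z) = x} \<in> sets borel"
    unfolding cell by measurable
  define l u :: "real ^ 'n" where "l = (1 / t) *\<^sub>R real_vec x" and "u = (1 / t) *\<^sub>R (real_vec x + 1)"
  have ul: "(u - l) \<bullet> b = 1 / t" if "b \<in> Basis" for b
    using that by (auto simp: u_def l_def Basis_vec_def inner_axis algebra_simps)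
  have lu: "l \<bullet> b \<le> u \<bullet> b" if "b \<in> Basis" for b
    using ul[OF that] assms by (simp add: inner_diff_left) (smt (verit) divide_nonneg_nonneg)
  have vol: "(\<Prod>b\<in>Basis. (u - l) \<bullet> b) = (1 / t) ^ CARD('n)" using ul by simp
  have "box l u \<subseteq> {z. floor_vec (t *\<^sub>R z) = x}" "{z. floor_vec (t *\<^sub>R z) = x} \<subseteq> cbox l u"
    unfolding cell using assms
    by (auto simp: mem_box_cart u_def l_def real_vec_def field_simps less_imp_le)
  hence "emeasure lborel (box l u) \<le> emeasure lborel {z. floor_vec (t *\<^sub>R z) = x}"
    "emeasure lborel {z. floor_vec (t *\<^sub>R z) = x} \<le> emeasure lborel (cbox l u)"
    using meas by (auto intro!: emeasure_mono)
  thus "emeasure lborel {z. floor_vec (t *\<^sub>R z) = x} = ennreal ((1 / t) ^ CARD('n))"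
    using lu by (simp add: vol)
qed

lemma integral_floor_cells:
  fixes \<phi> :: "int ^ 'n \<Rightarrow> real"
  assumes t: "0 < t" and S: "finite S"
  shows "(\<lambda>z. if floor_vec (t *\<^sub>R z) \<in> S then \<phi> (floor_vec (t *\<^sub>R z)) else 0) \<in> borel_measurable lborel"
    and "(\<integral>z. (if floor_vec (t *\<^sub>R z) \<in> S then \<phi> (floor_vec (t *\<^sub>R z)) else 0) \<partial>lborel)
      = (\<Sum>x\<in>S. \<phi> x) * (1 / t) ^ CARD('n)"
proof -
  note [measurable] = floor_cell(1)[OF t]
  have eq: "(\<lambda>z. if floor_vec (t *\<^sub>R z) \<in> S then \<phi> (floor_vec (t *\<^sub>R z)) else 0)
    = (\<lambda>z. \<Sum>x\<in>S. indicator {z. floor_vec (t *\<^sub>R z) = x} z * \<phi> x)"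
    using S by (auto simp: fun_eq_iff indicator_def sum.delta)
  show "(\<lambda>z. if floor_vec (t *\<^sub>R z) \<in> S then \<phi> (floor_vec (t *\<^sub>R z)) else 0) \<in> borel_measurable lborel"
    unfolding eq by measurable
  have int: "integrable lborel (indicat_real {z. floor_vec (t *\<^sub>R z) = x})" for x :: "int ^ 'n"
    using floor_cell[OF t, of x] by (intro integrable_real_indicator) auto
  have "(\<integral>z. (\<Sum>x\<in>S. indicator {z. floor_vec (t *\<^sub>R z) = x} z * \<phi> x) \<partial>lborel)
    = (\<Sum>x\<in>S. \<integral>z. indicator {z. floor_vec (t *\<^sub>R z) = x} z * \<phi> x \<partial>lborel)"
    using int by (intro Bochner_Integration.integral_sum integrable_mult_left)
  also have "\<dots> = (\<Sum>x\<in>S. (1 / t) ^ CARD('n) * \<phi> x)"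
    using t int by (intro sum.cong refl) (simp add: measure_def floor_cell[OF t])
  finally show "(\<integral>z. (if floor_vec (t *\<^sub>R z) \<in> S then \<phi> (floor_vec (t *\<^sub>R z)) else 0) \<partial>lborel)
      = (\<Sum>x\<in>S. \<phi> x) * (1 / t) ^ CARD('n)"
    unfolding eq by (simp add: sum_distrib_right mult.commute)
qed

section \<open>The unit ball of the norm as a compact metric probability space\<close>

context fpp_limit
begin

definition shape :: "(real ^ 'n) set" where
  "shape = {x. N x \<le> 1}"

lemma N_nonneg [simp]: "0 \<le> N x" and N_eq_0_iff [simp]: "N x = 0 \<longleftrightarrow> x = 0"
  and N_scaleR [simp]: "N (a *\<^sub>R x) = \<bar>a\<bar> * N x" and N_triangle: "N (x + y) \<le> N x + N y"
  using N_is_norm unfolding is_norm_def by blast+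

lemma N_zero [simp]: "N 0 = 0"
  by simp

lemma N_minus_commute: "N (x - y) = N (y - x)"
  using N_minus[of "x - y"] by simp

lemma N_triangle_diff: "N (x - z) \<le> N (x - y) + N (y - z)"
  using N_triangle[of "x - y" "y - z"] by simp

lemma N_reverse_triangle: "\<bar>N x - N y\<bar> \<le> N (x - y)"
  using N_triangle[of "x - y" y] N_triangle[of "y - x" x] N_minus_commute[of x y] by simp

lemma N_le_norm: "N x \<le> C * real CARD('n) * norm x"
  using mult_left_mono[OF rl1_le_norm[of x] less_imp_le[OF C_pos]] N_le[of x] by (simp add: mult.assoc)

lemma norm_le_N: "c * norm x \<le> N x"
  using mult_left_mono[OF norm_le_rl1[of x] less_imp_le[OF c_pos]] N_ge[of x] by simp

lemma continuous_on_N: "continuous_on A N"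
proof (rule continuous_onI)
  fix x e assume "x \<in> A" "0 < (e :: real)"
  show "\<exists>d>0. \<forall>x'\<in>A. dist x' x < d \<longrightarrow> dist (N x') (N x) \<le> e"
  proof (intro exI[of _ "e / (C * real CARD('n))"] conjI ballI impI)
    show "0 < e / (C * real CARD('n))" using \<open>0 < e\<close> C_pos by simp
    fix x' assume "dist x' x < e / (C * real CARD('n))"
    hence "C * real CARD('n) * norm (x' - x) \<le> e" using C_pos by (simp add: dist_norm field_simps)
    thus "dist (N x') (N x) \<le> e"
      using N_reverse_triangle[of x' x] N_le_norm[of "x' - x"] by (simp add: dist_real_def)
  qed
qed

lemma compact_shape: "compact shape"
proof -
  have "closed shape"
    unfolding shape_def by (intro closed_Collect_le continuous_on_N continuous_on_const)
  moreover have "bounded shape"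
    unfolding bounded_iff
  proof (intro exI[of _ "1 / c"] ballI)
    fix x assume "x \<in> shape"
    thus "norm x \<le> 1 / c" using norm_le_N[of x] c_pos by (simp add: shape_def field_simps)
  qed
  ultimately show ?thesis by (simp add: compact_eq_bounded_closed)
qed

lemma borel_shape [measurable]: "shape \<in> sets borel"
  using compact_shape by (simp add: compact_imp_closed)

lemma convex_shape: "convex shape"
proof (rule convexI)
  fix x y and a b :: real assume "x \<in> shape" "y \<in> shape" "0 \<le> a" "0 \<le> b" "a + b = 1"
  thus "a *\<^sub>R x + b *\<^sub>R y \<in> shape"
    using N_triangle[of "a *\<^sub>R x" "b *\<^sub>R y"] mult_left_le[of "N x" a] mult_left_le[of "N y" b]
    by (simp add: shape_def)
qed

text \<open>Any dilation by a factor above \<open>1\<close> moves a point of the sphere out of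
  \<open>shape\<close>, so the sphere lies in the frontier of a convex set, which is
  negligible.\<close>

lemma AE_not_unit_sphere: "AE z in lborel. N z \<noteq> 1"
proof -
  have "{z. N z = 1} \<subseteq> frontier shape"
  proof
    fix z assume "z \<in> {z. N z = 1}"
    hence z: "N z = 1" by simp
    hence "z \<in> shape" by (simp add: shape_def)
    hence "z \<in> closure shape" by (rule subsetD[OF closure_subset])
    moreover have "z \<notin> interior shape"
    proof
      assume "z \<in> interior shape"
      then obtain e where e: "0 < e" "ball z e \<subseteq> shape" by (meson mem_interior)
      \<comment> \<open>Small enough that the dilated point stays in \<open>ball z e\<close>; the
        \<open>+ 1\<close> keeps the denominator positive.\<close>
      define s where "s = e / (2 * (norm z + 1))"
      have s: "0 < s" using e by (simp add: s_def add_nonneg_pos)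
      have "dist z ((1 + s) *\<^sub>R z) = s * norm z" using s by (simp add: dist_norm algebra_simps)
      also have "\<dots> \<le> s * (norm z + 1)" using s by simp
      also have "\<dots> = e / 2" unfolding s_def by (simp add: add_nonneg_eq_0_iff field_simps)
      finally have "(1 + s) *\<^sub>R z \<in> shape" using e by auto
      thus False using z s by (simp add: shape_def)
    qed
    ultimately show "z \<in> frontier shape" by (simp add: frontier_def)
  qed
  hence "negligible {z. N z = 1}" using negligible_convex_frontier[OF convex_shape] negligible_subset by blast
  moreover have "{z. N z = 1} \<in> sets lborel"
    by (simp, intro borel_closed closed_Collect_eq continuous_on_N continuous_on_const)
  ultimately have "{z. N z = 1} \<in> null_sets lborel"
    by (simp add: negligible_iff_null_sets null_sets_completion_iff)
  thus ?thesis by (rule AE_I') auto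
qed

lemma emeasure_shape: "emeasure lborel shape \<noteq> 0" "emeasure lborel shape \<noteq> \<infinity>"
proof -
  show fin: "emeasure lborel shape \<noteq> \<infinity>"
    using emeasure_bounded_finite[OF compact_imp_bounded[OF compact_shape]] by simp
  define r where "r = 1 / (C * real CARD('n))"
  have "0 < r" using C_pos by (simp add: r_def)
  have "cball 0 r \<subseteq> shape"
  proof
    fix x :: "real ^ 'n" assume "x \<in> cball 0 r"
    hence "C * real CARD('n) * norm x \<le> 1" using C_pos by (simp add: r_def field_simps)
    thus "x \<in> shape" using N_le_norm[of x] by (simp add: shape_def)
  qed
  hence "emeasure lborel (cball (0 :: real ^ 'n) r) \<le> emeasure lborel shape" by (rule emeasure_mono) simp
  moreover have "emeasure lborel (cball (0 :: real ^ 'n) r) \<noteq> 0"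
    using content_cball_pos[OF \<open>0 < r\<close>, of "0 :: real ^ 'n"] by (auto simp: measure_def)
  ultimately show "emeasure lborel shape \<noteq> 0" by auto
qed

abbreviation "dN \<equiv> \<lambda>s s'. N (s - s')"

lemma Metric_space_shape: "Metric_space shape dN"
  by unfold_locales (auto simp: N_minus_commute N_triangle_diff)

text \<open>Equivalence of norms: \<open>N_le_norm\<close> gives one inclusion of neighbourhoods and
  \<open>norm_le_N\<close> the other. Compactness and Borel sets can then be handled in the
  Euclidean topology.\<close>

lemma mtopology_shape: "Metric_space.mtopology shape dN = top_of_set shape"
proof -
  interpret Metric_space shape dN by (rule Metric_space_shape)
  have Cd: "0 < C * real CARD('n)" using C_pos by simp
  show ?thesis
  proof (rule topology_eq[THEN iffD2], intro allI iffI)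
    fix U assume U: "openin mtopology U"
    show "openin (top_of_set shape) U"
      unfolding openin_euclidean_subtopology_iff
    proof (intro conjI ballI)
      show "U \<subseteq> shape" using U by (simp add: openin_mtopology)
      fix x assume "x \<in> U"
      then obtain r where r: "0 < r" "mball x r \<subseteq> U" using U by (auto simp: openin_mtopology)
      show "\<exists>e>0. \<forall>x'\<in>shape. dist x' x < e \<longrightarrow> x' \<in> U"
      proof (intro exI[of _ "r / (C * real CARD('n))"] conjI ballI impI)
        show "0 < r / (C * real CARD('n))" using r Cd by simp
        fix x' assume x': "x' \<in> shape" "dist x' x < r / (C * real CARD('n))"
        hence "C * real CARD('n) * norm (x - x') < r" using Cd by (simp add: dist_norm norm_minus_commute field_simps)
        hence "N (x - x') < r" using N_le_norm[of "x - x'"] by linarith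
        hence "x' \<in> mball x r" using x'(1) \<open>x \<in> U\<close> \<open>U \<subseteq> shape\<close> by (simp add: in_mball subsetD)
        thus "x' \<in> U" using r(2) by (rule subsetD[rotated])
      qed
    qed
  next
    fix U assume U: "openin (top_of_set shape) U"
    hence sub: "U \<subseteq> shape" by (simp add: openin_euclidean_subtopology_iff)
    show "openin mtopology U"
      unfolding openin_mtopology
    proof (intro conjI allI impI sub)
      fix x assume "x \<in> U"
      then obtain e where e: "0 < e" "\<And>x'. x' \<in> shape \<Longrightarrow> dist x' x < e \<Longrightarrow> x' \<in> U"
        using U by (auto simp: openin_euclidean_subtopology_iff)
      have "mball x (c * e) \<subseteq> U"
      proof
        fix x' assume x': "x' \<in> mball x (c * e)"
        hence "c * norm (x - x') < c * e" using norm_le_N[of "x - x'"] by (simp add: in_mball)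
        hence "dist x' x < e" using c_pos by (simp add: dist_norm norm_minus_commute)
        thus "x' \<in> U" using e x' by (auto simp: in_mball)
      qed
      thus "\<exists>r>0. mball x r \<subseteq> U" using e c_pos by (intro exI[of _ "c * e"]) auto
    qed
  qed
qed

definition shape_measure :: "(real ^ 'n) measure" where
  "shape_measure = uniform_measure (restrict_space lborel shape) shape"

lemma shape_measure_simps [simp]:
  "space shape_measure = shape" "sets shape_measure = sets (restrict_space borel shape)"
  by (auto simp: shape_measure_def space_restrict_space sets_restrict_space)

lemma emeasure_restrict_shape: "emeasure (restrict_space lborel shape) shape = emeasure lborel shape"
  by (subst emeasure_restrict_space) auto

lemma prob_space_shape_measure: "prob_space shape_measure"
  unfolding shape_measure_def
  using emeasure_shape by (intro prob_space_uniform_measure) (simp_all add: emeasure_restrict_shape)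

lemma compact_metric_prob_space_shape: "compact_metric_prob_space shape dN shape_measure"
  unfolding compact_metric_prob_space_def mtopology_shape
proof (intro conjI)
  show "compact_space (top_of_set shape)"
    by (intro compact_space_subtopology) (simp add: compact_shape)
  have "sets shape_measure = (\<inter>) shape ` sigma_sets UNIV (Collect open)"
    by (simp add: sets_restrict_space borel_def)
  also have "\<dots> = sigma_sets shape ((\<inter>) shape ` Collect open)"
    using borel_shape by (intro sigma_sets_Int) (simp_all add: borel_def)
  also have "(\<inter>) shape ` Collect open = {U. openin (top_of_set shape) U}"
    by (auto simp: openin_open)
  finally show "sets shape_measure = sigma_sets shape {U. openin (top_of_set shape) U}" .
qed (simp_all add: Metric_space_shape prob_space_shape_measure)

section \<open>Rescaled balls and almost isometries\<close>

lemma rescaled_dist_rescale: "0 < t \<Longrightarrow> rescaled_dist w t (rescale t x) (rescale t y) = T x y / t"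
  by (simp add: rescaled_dist_def)

lemma finite_rescaled_ball: "0 < t \<Longrightarrow> finite (rescaled_ball w t)"
  by (simp add: rescaled_ball_def finite_fpp_ball)

lemma rescaled_ball_nonempty: "0 < t \<Longrightarrow> rescaled_ball w t \<noteq> {}"
  using T_refl[of 0] by (auto simp: rescaled_ball_def fpp_ball_def intro!: exI[of _ 0])

text \<open>A finite metric space is discrete, so it is compact and all its subsets are Borel.
  Positive weights make \<open>T\<close> a metric instead of a pseudometric.\<close>

lemma compact_metric_prob_space_rescaled:
  assumes t: "0 < t"
  shows "compact_metric_prob_space (rescaled_ball w t) (rescaled_dist w t) (rescaled_measure w t)"
proof -
  let ?X = "rescaled_ball w t" and ?d = "rescaled_dist w t"
  interpret Metric_space ?X ?d
  proof
    fix x y show "0 \<le> ?d x y" using t by (simp add: rescaled_dist_def)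
    show "?d x y = ?d y x" by (simp add: rescaled_dist_def T_commute)
  next
    fix x y assume "x \<in> ?X" "y \<in> ?X"
    then obtain a b where "x = rescale t a" "y = rescale t b" by (auto simp: rescaled_ball_def)
    thus "?d x y = 0 \<longleftrightarrow> x = y"
      using t T_pos[of a b] w_pos inj_eq[OF inj_rescale[OF t]] by (cases "a = b") (auto simp: rescaled_dist_rescale)
  next
    fix x y z show "?d x z \<le> ?d x y + ?d y z"
      unfolding rescaled_dist_def add_divide_distrib[symmetric] using t
      by (intro divide_right_mono T_triangle) auto
  qed
  have fin: "finite ?X" using finite_rescaled_ball[OF t] .
  have disc: "mtopology = discrete_topology ?X"
    using fin by (intro finite_t1_space_imp_discrete_topology t1_space_mtopology) simp_all
  have "compact_space mtopology" unfolding disc using fin by (simp add: compact_space_discrete_topology)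
  moreover have "sigma_sets ?X {U. openin mtopology U} = Pow ?X"
    unfolding disc
  proof
    show "sigma_sets ?X {U. openin (discrete_topology ?X) U} \<subseteq> Pow ?X"
      using sigma_sets_into_sp[of "{U. openin (discrete_topology ?X) U}" ?X] by auto
  qed auto
  moreover have "prob_space (rescaled_measure w t)"
    unfolding rescaled_measure_def using fin rescaled_ball_nonempty[OF t] by (rule prob_space_uniform_count_measure)
  ultimately show ?thesis
    unfolding compact_metric_prob_space_def
    using Metric_space_axioms
    by (simp add: rescaled_measure_def space_uniform_count_measure sets_uniform_count_measure)
qed

text \<open>Almost isometries must map into \<open>shape\<close>, but the rescaled ball may stick
  out of it slightly. Points inside stay where they are, and the same map serves for all
  \<open>t\<close>.\<close>

definition radial_retraction :: "real ^ 'n \<Rightarrow> real ^ 'n" where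
  "radial_retraction s = (if N s \<le> 1 then s else (1 / N s) *\<^sub>R s)"

lemma radial_retraction_in_shape: "radial_retraction s \<in> shape"
  by (auto simp: radial_retraction_def shape_def)

lemma radial_retraction_dist: "N (radial_retraction s - s) \<le> max 0 (N s - 1)"
proof (cases "N s \<le> 1")
  case False
  have "radial_retraction s - s = (1 / N s - 1) *\<^sub>R s" using False by (simp add: radial_retraction_def algebra_simps)
  hence "N (radial_retraction s - s) = \<bar>1 / N s - 1\<bar> * N s" by simp
  also have "\<bar>1 / N s - 1\<bar> = 1 - 1 / N s" using False by simp
  also have "(1 - 1 / N s) * N s = N s - 1" using False N_eq_0_iff[of s] by (cases "s = 0") (simp_all add: field_simps)
  finally show ?thesis by simp
qed (simp add: radial_retraction_def)

lemma radial_retraction_measurable: "radial_retraction \<in> rescaled_measure w t \<rightarrow>\<^sub>M shape_measure"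
  unfolding measurable_def rescaled_measure_def
  by (auto simp: space_uniform_count_measure sets_uniform_count_measure radial_retraction_in_shape)

text \<open>Convergence asks for an almost isometry at every \<open>t > 0\<close>, not only at large
  \<open>t\<close>. Finiteness of the rescaled ball provides a crude constant.\<close>

lemma eps_isometry_exists:
  assumes t: "0 < t"
  shows "\<exists>\<epsilon>>0. eps_isometry \<epsilon> (rescaled_ball w t) (rescaled_dist w t) shape dN radial_retraction"
proof -
  let ?X = "rescaled_ball w t"
  define D where "D = (\<lambda>(x, x'). \<bar>rescaled_dist w t x x' - N (radial_retraction x - radial_retraction x')\<bar>) ` (?X \<times> ?X)"
  have fin: "finite D" unfolding D_def using finite_rescaled_ball[OF t] by simp
  \<comment> \<open>\<open>Max D + 1\<close> makes the distortion bound strict; two points of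
    \<open>shape\<close> are at distance at most \<open>2 < 3\<close>.\<close>
  have "eps_isometry (max 3 (Max D + 1)) ?X (rescaled_dist w t) shape dN radial_retraction"
    unfolding eps_isometry_def
  proof (intro conjI ballI)
    show "radial_retraction ` ?X \<subseteq> shape" using radial_retraction_in_shape by auto
    fix x x' assume "x \<in> ?X" "x' \<in> ?X"
    hence "\<bar>rescaled_dist w t x x' - N (radial_retraction x - radial_retraction x')\<bar> \<in> D" by (force simp: D_def)
    hence "\<bar>rescaled_dist w t x x' - N (radial_retraction x - radial_retraction x')\<bar> \<le> Max D" using fin by (rule Max_ge[rotated])
    thus "\<bar>rescaled_dist w t x x' - N (radial_retraction x - radial_retraction x')\<bar> < max 3 (Max D + 1)" by linarith
  next
    fix y assume "y \<in> shape"
    obtain x where "x \<in> ?X" using rescaled_ball_nonempty[OF t] by blast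
    moreover have "N (y - radial_retraction x) \<le> N y + N (radial_retraction x)" using N_triangle[of y "- radial_retraction x"] by (simp add: N_minus)
    ultimately show "\<exists>x\<in>?X. N (y - radial_retraction x) < max 3 (Max D + 1)"
      using \<open>y \<in> shape\<close> radial_retraction_in_shape[of x] by (intro bexI[of _ x]) (auto simp: shape_def)
  qed
  thus ?thesis by (intro exI[of _ "max 3 (Max D + 1)"]) auto
qed

lemma N_rescale: "0 < t \<Longrightarrow> N (rescale t x) = N (real_vec x) / t"
  by (simp add: rescale_def)

lemma rescale_floor_vec_dist:
  fixes z :: "real ^ 'n"
  assumes t: "0 < t"
  shows "rl1 (rescale t (floor_vec (t *\<^sub>R z)) - z) \<le> real CARD('n) / t"
proof -
  have "rescale t (floor_vec (t *\<^sub>R z)) - z = (1 / t) *\<^sub>R (real_vec (floor_vec (t *\<^sub>R z)) - t *\<^sub>R z)"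
    using t by (simp add: rescale_def algebra_simps)
  thus ?thesis using rl1_floor_vec[of "t *\<^sub>R z"] t by (simp add: divide_right_mono)
qed

lemma N_rescale_floor_vec_dist:
  assumes t: "0 < t"
  shows "N (rescale t (floor_vec (t *\<^sub>R z)) - z) \<le> C * real CARD('n) / t"
  using mult_left_mono[OF rescale_floor_vec_dist[OF t, of z], of C] C_pos
    N_le[of "rescale t (floor_vec (t *\<^sub>R z)) - z"] by simp

lemma l1_le_N: "real (l1 x) \<le> N (real_vec x) / c"
  using N_ge[of "real_vec x"] c_pos by (simp add: rl1_real_vec field_simps)

text \<open>For the covering condition, a point \<open>y\<close> of \<open>shape\<close> is first
  shrunk and then rounded to the lattice: lattice points near the boundary of \<open>shape\<close>
  need not belong to the ball, but those well inside do for large \<open>t\<close>.\<close>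

lemma eventually_eps_isometry:
  assumes \<epsilon>: "0 < \<epsilon>"
  shows "eventually (\<lambda>t. eps_isometry \<epsilon> (rescaled_ball w t) (rescaled_dist w t) shape dN radial_retraction) at_top"
proof -
  \<comment> \<open>The distortion is at most \<open>3 * \<delta>\<close>, one
    \<open>\<delta>\<close> from the uniform convergence and one from each retraction; covering
    costs \<open>2 * \<delta> + \<delta> / 2\<close>. The bound \<open>1 / 4\<close> keeps
    \<open>1 - 2 * \<delta>\<close> positive.\<close>
  define \<delta> where "\<delta> = min (\<epsilon> / 8) (1 / 4)"
  have \<delta>: "0 < \<delta>" "4 * \<delta> < \<epsilon>" "\<delta> \<le> 1 / 4" using \<epsilon> by (auto simp: \<delta>_def)
  have "0 \<le> 1 / c" using c_pos by simp
  from T_uniform[OF \<delta>(1) this] fpp_ball_l1_bound eventually_gt_at_top[of "max 0 (2 * (C * real CARD('n)) / \<delta>)"]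
  show ?thesis
  proof eventually_elim
    case (elim t)
    have t: "0 < t" using elim by simp
    have Cd: "C * real CARD('n) / t \<le> \<delta> / 2" using elim(3) t \<delta> by (simp add: field_simps)
    have close: "\<bar>T x y / t - N (rescale t x - rescale t y)\<bar> \<le> \<delta>"
      if "real (l1 x) \<le> 1 / c * t" "real (l1 y) \<le> 1 / c * t" for x y
    proof -
      have "rescale t x - rescale t y = (1 / t) *\<^sub>R (real_vec x - real_vec y)" by (simp add: rescale_def algebra_simps)
      hence "T x y / t - N (rescale t x - rescale t y) = (T x y - N (real_vec x - real_vec y)) / t"
        using t by (simp add: diff_divide_distrib)
      moreover have "\<bar>T x y - N (real_vec x - real_vec y)\<bar> / t \<le> \<delta> * t / t"
        using elim(1) that t by (intro divide_right_mono) auto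
      ultimately show ?thesis using t by (simp add: abs_divide)
    qed
    have retr: "N (radial_retraction (rescale t x) - rescale t x) \<le> \<delta>" if "x \<in> fpp_ball w t" for x
    proof -
      have "\<bar>T 0 x / t - N (rescale t 0 - rescale t x)\<bar> \<le> \<delta>" using elim(2) that t c_pos by (intro close) auto
      moreover have "N (rescale t 0 - rescale t x) = N (rescale t x)" by (simp add: rescale_def N_minus)
      moreover have "T 0 x / t < 1" using that t by (simp add: fpp_ball_def)
      ultimately have "N (rescale t x) - 1 \<le> \<delta>" by linarith
      thus ?thesis using radial_retraction_dist[of "rescale t x"] \<delta> by linarith
    qed
    show ?case unfolding eps_isometry_def
    proof (intro conjI ballI)
      show "radial_retraction ` rescaled_ball w t \<subseteq> shape" using radial_retraction_in_shape by auto
      fix s s' assume "s \<in> rescaled_ball w t" "s' \<in> rescaled_ball w t"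
      then obtain x x' where x: "s = rescale t x" "s' = rescale t x'" "x \<in> fpp_ball w t" "x' \<in> fpp_ball w t"
        by (auto simp: rescaled_ball_def)
      have "\<bar>T x x' / t - N (s - s')\<bar> \<le> \<delta>" unfolding x(1,2) using elim(2) x by (intro close) auto
      moreover have "\<bar>N (s - s') - N (radial_retraction s - radial_retraction s')\<bar> \<le> N (radial_retraction s - s) + N (radial_retraction s' - s')"
        using N_reverse_triangle[of "s - s'" "radial_retraction s - radial_retraction s'"]
          N_triangle[of "- (radial_retraction s - s)" "radial_retraction s' - s'"] N_minus[of "radial_retraction s - s"]
        by (simp add: algebra_simps)
      ultimately have "\<bar>T x x' / t - N (radial_retraction s - radial_retraction s')\<bar> \<le> 3 * \<delta>"
        using retr[OF x(3)] retr[OF x(4)] unfolding x(1,2) by linarith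
      thus "\<bar>rescaled_dist w t s s' - N (radial_retraction s - radial_retraction s')\<bar> < \<epsilon>"
        using \<delta> t unfolding x(1,2) by (simp add: rescaled_dist_rescale)
    next
      fix y assume "y \<in> shape"
      hence y: "N y \<le> 1" by (simp add: shape_def)
      \<comment> \<open>Rounding adds at most \<open>\<delta> / 2\<close> to the norm and passing
        from \<open>N\<close> to \<open>T / t\<close> at most \<open>\<delta>\<close>, so shrinking
        by \<open>2 * \<delta>\<close> leaves \<open>T 0 x / t\<close> below
        \<open>1\<close>.\<close>
      define x where "x = floor_vec (t *\<^sub>R (1 - 2 * \<delta>) *\<^sub>R y)"
      have x1: "N (rescale t x - (1 - 2 * \<delta>) *\<^sub>R y) \<le> \<delta> / 2"
        unfolding x_def using N_rescale_floor_vec_dist[OF t] Cd by (rule order_trans)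
      have "N ((1 - 2 * \<delta>) *\<^sub>R y) \<le> 1 - 2 * \<delta>" using y \<delta> by (simp add: mult_left_le)
      hence x2: "N (rescale t x) \<le> 1 - 3 / 2 * \<delta>"
        using x1 N_triangle[of "rescale t x - (1 - 2 * \<delta>) *\<^sub>R y" "(1 - 2 * \<delta>) *\<^sub>R y"] by simp
      hence "N (real_vec x) \<le> t" using t \<delta> by (simp add: N_rescale field_simps) (smt (verit) mult_nonneg_nonneg)
      hence "real (l1 x) \<le> 1 / c * t"
        using l1_le_N[of x] c_pos by (simp add: field_simps)
      hence "\<bar>T 0 x / t - N (rescale t 0 - rescale t x)\<bar> \<le> \<delta>" using t c_pos by (intro close) auto
      moreover have "N (rescale t 0 - rescale t x) = N (rescale t x)" by (simp add: rescale_def N_minus)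
      ultimately have "T 0 x / t < 1" using x2 \<delta> by linarith
      hence "rescale t x \<in> rescaled_ball w t" using t by (simp add: rescaled_ball_def fpp_ball_def)
      moreover have "N (y - radial_retraction (rescale t x)) < \<epsilon>"
      proof -
        have ret: "radial_retraction (rescale t x) = rescale t x" using x2 \<delta> by (simp add: radial_retraction_def)
        have "N (y - rescale t x) \<le> N (y - (1 - 2 * \<delta>) *\<^sub>R y) + N ((1 - 2 * \<delta>) *\<^sub>R y - rescale t x)"
          by (rule N_triangle_diff)
        moreover have "N (y - (1 - 2 * \<delta>) *\<^sub>R y) \<le> 2 * \<delta>"
        proof -
          have "y - (1 - 2 * \<delta>) *\<^sub>R y = (2 * \<delta>) *\<^sub>R y" by (simp add: algebra_simps)
          thus ?thesis using y \<delta> by (simp add: mult_left_le)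
        qed
        ultimately show ?thesis unfolding ret using x1 \<delta> N_minus_commute[of "rescale t x" "(1 - 2 * \<delta>) *\<^sub>R y"] by linarith
      qed
      ultimately show "\<exists>s\<in>rescaled_ball w t. N (y - radial_retraction s) < \<epsilon>" by blast
    qed
  qed
qed

text \<open>A sum over rescaled lattice points is the integral of a function that is constant on cubes of side
  \<open>1 / t\<close>; it converges by dominated convergence, the unit sphere of the norm being a null set.\<close>

lemma rescaled_weakly_converges:
  "weakly_converges (Metric_space.mtopology shape dN)
    (\<lambda>t. distr (rescaled_measure w t) shape_measure radial_retraction) shape_measure"
  unfolding weakly_converges_def mtopology_shape
proof (intro allI impI, elim conjE)
  fix f :: "real ^ 'n \<Rightarrow> real"
  assume "continuous_map (top_of_set shape) euclideanreal f" and bdd: "bounded (f ` topspace (top_of_set shape))"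
  hence f: "continuous_on shape f" by simp
  obtain b where b: "\<And>s. s \<in> shape \<Longrightarrow> \<bar>f s\<bar> \<le> b" using bdd by (auto simp: bounded_iff)
  have f_meas: "f \<in> borel_measurable (restrict_space borel shape)"
    using f by (rule borel_measurable_continuous_on_restrict)
  define I where "I g = (\<integral>z. indicator shape z * g z \<partial>lborel)" for g :: "real ^ 'n \<Rightarrow> real"
  have lim: "((\<lambda>t. (\<Sum>x\<in>fpp_ball w t. g (radial_retraction (rescale t x))) * (1 / t) ^ CARD('n)) \<longlongrightarrow> I g) at_top"
    if g: "continuous_on shape g" and b: "\<And>s. s \<in> shape \<Longrightarrow> \<bar>g s\<bar> \<le> b" for g b
  proof -
    \<comment> \<open>Bounds the points whose cell belongs to the ball, once \<open>t\<close> is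
      large: \<open>1 / c\<close> for the corner of the cell, \<open>CARD('n)\<close> for the
      distance to it.\<close>
    define r where "r = 1 / c + real CARD('n)"
    have b0: "0 \<le> b" using b[OF radial_retraction_in_shape[of 0]] by linarith
    \<comment> \<open>The value \<open>0\<close> for \<open>t \<le> 0\<close> makes measurability
      trivial there; only large \<open>t\<close> matter in the limit.\<close>
    define G where "G t z = (if 0 < t \<and> floor_vec (t *\<^sub>R z) \<in> fpp_ball w t then g (radial_retraction (rescale t (floor_vec (t *\<^sub>R z)))) else 0)" for t z
    have G: "G t \<in> borel_measurable lborel"
      "0 < t \<Longrightarrow> (\<integral>z. G t z \<partial>lborel) = (\<Sum>x\<in>fpp_ball w t. g (radial_retraction (rescale t x))) * (1 / t) ^ CARD('n)" for t
    proof -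
      show "G t \<in> borel_measurable lborel"
        using integral_floor_cells(1)[where t = t and S = "fpp_ball w t" and \<phi> = "\<lambda>x. g (radial_retraction (rescale t x))"] finite_fpp_ball
        by (cases "0 < t") (simp_all add: G_def[abs_def])
      show "(\<integral>z. G t z \<partial>lborel) = (\<Sum>x\<in>fpp_ball w t. g (radial_retraction (rescale t x))) * (1 / t) ^ CARD('n)" if "0 < t"
        using integral_floor_cells(2)[OF that finite_fpp_ball, where \<phi> = "\<lambda>x. g (radial_retraction (rescale t x))"] that
        by (simp add: G_def[abs_def])
    qed
    have "((\<lambda>t. \<integral>z. G t z \<partial>lborel) \<longlongrightarrow> (\<integral>z. indicator shape z * g z \<partial>lborel)) at_top"
    proof (rule integral_dominated_convergence_at_top[where w = "\<lambda>z. indicator (cball (0 :: real ^ 'n) r) z * b"])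
      show "(\<lambda>z. indicator shape z * g z) \<in> borel_measurable lborel"
        using borel_measurable_continuous_on_restrict[OF g] borel_measurable_restrict_space_iff[of shape borel g]
        by simp
      show "integrable lborel (\<lambda>z. indicator (cball (0 :: real ^ 'n) r) z * b :: real)"
        using emeasure_bounded_finite[OF bounded_cball[of "0 :: real ^ 'n" r]]
        by (intro integrable_mult_left integrable_real_indicator) simp_all
      show "G t \<in> borel_measurable lborel" for t by (rule G)
      show "eventually (\<lambda>t. AE z in lborel. norm (G t z) \<le> indicator (cball (0 :: real ^ 'n) r) z * b) at_top"
        using fpp_ball_l1_bound eventually_ge_at_top[of 1]
      proof eventually_elim
        case (elim t)
        have "norm (G t z) \<le> indicator (cball (0 :: real ^ 'n) r) z * b" for z
        proof (cases "floor_vec (t *\<^sub>R z) \<in> fpp_ball w t")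
          case True
          let ?x = "floor_vec (t *\<^sub>R z)"
          have "rl1 (real_vec ?x) \<le> 1 / c * t" using elim(1) True by (simp add: rl1_real_vec)
          hence "rl1 (rescale t ?x) \<le> 1 / c" using elim(2) by (simp add: rescale_def field_simps)
          moreover have "rl1 (- (rescale t ?x - z)) \<le> real CARD('n)"
          proof -
            have "real CARD('n) / t \<le> real CARD('n)" using elim(2) by (simp add: field_simps)
            thus ?thesis unfolding rl1_minus using rescale_floor_vec_dist[of t z] elim(2) by linarith
          qed
          moreover have "rl1 z \<le> rl1 (rescale t ?x) + rl1 (- (rescale t ?x - z))"
            using rl1_triangle[of "rescale t ?x" "- (rescale t ?x - z)"] by simp
          ultimately have "norm z \<le> r" using norm_le_rl1[of z] unfolding r_def by linarith
          thus ?thesis using b0 b[OF radial_retraction_in_shape] by (simp add: G_def)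
        next
          case False
          thus ?thesis using b0 by (simp add: G_def)
        qed
        thus ?case by simp
      qed
      show "AE z in lborel. ((\<lambda>t. G t z) \<longlongrightarrow> indicator shape z * g z) at_top"
        using AE_not_unit_sphere
      proof eventually_elim
        case (elim z)
        define R where "R = (N z + C * real CARD('n)) / c"
        have R: "0 \<le> R" using c_pos C_pos by (simp add: R_def add_nonneg_nonneg)
        \<comment> \<open>The passage time divided by \<open>t\<close> approximates
          \<open>N z\<close> up to \<open>2 * \<delta>\<close>, less than the distance
          \<open>3 * \<delta>\<close> from \<open>N z\<close> to \<open>1\<close>, so whether the
          cell of \<open>z\<close> belongs to the ball is eventually decided by
          \<open>N z < 1\<close>.\<close>
        define \<delta> where "\<delta> = \<bar>N z - 1\<bar> / 3"
        have \<delta>: "0 < \<delta>" "3 * \<delta> = \<bar>N z - 1\<bar>" using elim by (simp_all add: \<delta>_def)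
        let ?x = "\<lambda>t. floor_vec (t *\<^sub>R z)"
        have ev: "eventually (\<lambda>t. \<bar>T 0 (?x t) / t - N z\<bar> \<le> 2 * \<delta> \<and> \<bar>N (rescale t (?x t)) - N z\<bar> \<le> \<delta> \<and> 0 < t) at_top"
          using T_uniform[OF \<delta>(1) R] eventually_ge_at_top[of "max 1 (C * real CARD('n) / \<delta>)"]
        proof eventually_elim
          case (elim t)
          have t: "1 \<le> t" "C * real CARD('n) / t \<le> \<delta>" using elim(2) \<delta> by (auto simp: field_simps)
          have near: "\<bar>N (rescale t (?x t)) - N z\<bar> \<le> C * real CARD('n) / t"
            using N_reverse_triangle[of "rescale t (?x t)" z] N_rescale_floor_vec_dist[of t z] t by linarith
          have "N (rescale t (?x t)) \<le> N z + C * real CARD('n)"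
          proof -
            have "C * real CARD('n) / t \<le> C * real CARD('n) / 1" using t C_pos by (intro divide_left_mono) auto
            thus ?thesis using near by linarith
          qed
          hence "N (real_vec (?x t)) \<le> (N z + C * real CARD('n)) * t"
            using t by (simp add: N_rescale field_simps)
          hence "N (real_vec (?x t)) / c \<le> (N z + C * real CARD('n)) * t / c"
            using c_pos by (intro divide_right_mono) auto
          hence "real (l1 (?x t)) \<le> R * t"
            using l1_le_N[of "?x t"] by (simp add: R_def)
          hence "\<bar>T 0 (?x t) - N (real_vec 0 - real_vec (?x t))\<bar> \<le> \<delta> * t"
            using R t by (intro elim(1)[rule_format]) auto
          hence "\<bar>T 0 (?x t) - N (real_vec (?x t))\<bar> / t \<le> \<delta> * t / t"
            using t by (intro divide_right_mono) (auto simp: N_minus)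
          moreover have "\<bar>T 0 (?x t) - N (real_vec (?x t))\<bar> / t = \<bar>T 0 (?x t) / t - N (rescale t (?x t))\<bar>"
            using t by (simp add: N_rescale diff_divide_distrib[symmetric] abs_divide)
          ultimately have "\<bar>T 0 (?x t) / t - N (rescale t (?x t))\<bar> \<le> \<delta>" using t by simp
          thus ?case using near t by linarith
        qed
        show ?case
        proof (cases "N z < 1")
          case True
          have ev': "eventually (\<lambda>t. G t z = g (rescale t (?x t)) \<and> rescale t (?x t) \<in> shape) at_top"
            using ev
          proof eventually_elim
            case (elim t)
            have "T 0 (?x t) / t < 1" "N (rescale t (?x t)) \<le> 1" using elim True \<delta> by linarith+
            thus ?case using elim by (simp add: G_def fpp_ball_def radial_retraction_def shape_def)
          qed
          have "((\<lambda>t. rescale t (?x t)) \<longlongrightarrow> z) at_top"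
          proof (rule Lim_null[THEN iffD2], rule Lim_null_comparison)
            show "eventually (\<lambda>t. norm (rescale t (?x t) - z) \<le> real CARD('n) / t) at_top"
              using eventually_gt_at_top[of 0]
              by eventually_elim (rule order_trans[OF norm_le_rl1 rescale_floor_vec_dist])
            show "((\<lambda>t. real CARD('n) / t) \<longlongrightarrow> 0) at_top"
              by (intro real_tendsto_divide_at_top[OF tendsto_const] filterlim_ident)
          qed
          moreover have "z \<in> shape" using True by (simp add: shape_def)
          moreover have "eventually (\<lambda>t. rescale t (?x t) \<in> shape) at_top" using ev' by eventually_elim simp
          ultimately have "((\<lambda>t. g (rescale t (?x t))) \<longlongrightarrow> g z) at_top"
            by (rule continuous_on_tendsto_compose[OF g])
          moreover have "eventually (\<lambda>t. g (rescale t (?x t)) = G t z) at_top" using ev' by eventually_elim simp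
          ultimately have "((\<lambda>t. G t z) \<longlongrightarrow> g z) at_top" by (rule Lim_transform_eventually)
          thus ?thesis using \<open>z \<in> shape\<close> by simp
        next
          case False
          have "eventually (\<lambda>t. G t z = 0) at_top"
            using ev
          proof eventually_elim
            case (elim t)
            have "1 < T 0 (?x t) / t" using elim False \<delta> by linarith
            thus ?case using elim by (simp add: G_def fpp_ball_def)
          qed
          hence "((\<lambda>t. G t z) \<longlongrightarrow> 0) at_top" by (rule tendsto_eventually)
          moreover have "z \<notin> shape" using False elim by (simp add: shape_def)
          ultimately show ?thesis by simp
        qed
      qed
    qed
    moreover have "eventually (\<lambda>t. (\<integral>z. G t z \<partial>lborel) = (\<Sum>x\<in>fpp_ball w t. g (radial_retraction (rescale t x))) * (1 / t) ^ CARD('n)) at_top"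
      using eventually_gt_at_top[of 0] by eventually_elim (rule G)
    ultimately show ?thesis unfolding I_def by (rule Lim_transform_eventually)
  qed
  have vol: "I (\<lambda>_. 1) = measure lborel shape" "0 < measure lborel shape"
    using emeasure_shape by (auto simp: I_def measure_def enn2real_positive_iff less_top zero_less_iff_neq_zero)
  \<comment> \<open>The cardinality of the ball is the same sum for the constant function
    \<open>1\<close>; the volume factors cancel in the quotient.\<close>
  have "((\<lambda>t. ((\<Sum>x\<in>fpp_ball w t. f (radial_retraction (rescale t x))) * (1 / t) ^ CARD('n))
      / ((\<Sum>x\<in>fpp_ball w t. 1) * (1 / t) ^ CARD('n))) \<longlongrightarrow> I f / I (\<lambda>_. 1)) at_top"
    using vol by (intro tendsto_divide lim[OF f b] lim[of "\<lambda>_. 1" 1]) auto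
  moreover have "eventually (\<lambda>t. ((\<Sum>x\<in>fpp_ball w t. f (radial_retraction (rescale t x))) * (1 / t) ^ CARD('n))
      / ((\<Sum>x\<in>fpp_ball w t. 1) * (1 / t) ^ CARD('n)) = integral\<^sup>L (distr (rescaled_measure w t) shape_measure radial_retraction) f) at_top"
    using eventually_gt_at_top[of 0]
  proof eventually_elim
    case (elim t)
    have inj: "inj_on (rescale t) (fpp_ball w t)" using inj_rescale[OF elim] by (rule inj_on_subset) simp
    have "f \<in> borel_measurable shape_measure"
      using f_meas by (simp add: measurable_cong_sets[OF shape_measure_simps(2) refl])
    hence "integral\<^sup>L (distr (rescaled_measure w t) shape_measure radial_retraction) f
      = integral\<^sup>L (rescaled_measure w t) (\<lambda>s. f (radial_retraction s))"
      using radial_retraction_measurable by (intro integral_distr)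
    also have "\<dots> = (\<Sum>s\<in>rescaled_ball w t. f (radial_retraction s)) / real (card (rescaled_ball w t))"
      unfolding rescaled_measure_def by (rule integral_uniform_count_measure[OF finite_rescaled_ball[OF elim]])
    also have "\<dots> = (\<Sum>x\<in>fpp_ball w t. f (radial_retraction (rescale t x))) / real (card (fpp_ball w t))"
      unfolding rescaled_ball_def by (simp add: sum.reindex[OF inj] card_image[OF inj])
    finally show ?case using elim by simp
  qed
  moreover have "I f / I (\<lambda>_. 1) = integral\<^sup>L shape_measure f"
  proof -
    let ?v = "measure lborel shape"
    have ev: "emeasure (restrict_space lborel shape) shape = ennreal ?v"
      unfolding emeasure_restrict_shape using emeasure_shape by (simp add: emeasure_eq_ennreal_measure)
    have "shape_measure = density (restrict_space lborel shape) (\<lambda>z. ennreal (indicator shape z / ?v))"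
      unfolding shape_measure_def uniform_measure_def ev using vol(2) divide_ennreal[of 1 ?v]
      by (intro arg_cong2[where f = density]) (auto simp: fun_eq_iff indicator_def)
    hence "integral\<^sup>L shape_measure f = integral\<^sup>L (density (restrict_space lborel shape) (\<lambda>z. ennreal (indicator shape z / ?v))) f"
      by simp
    also have "\<dots> = (\<integral>z. (indicator shape z / ?v) *\<^sub>R f z \<partial>restrict_space lborel shape)"
    proof (rule integral_density)
      show "f \<in> borel_measurable (restrict_space lborel shape)"
        using f_meas measurable_cong_sets[OF sets_restrict_space_cong[OF sets_lborel] refl] by blast
      show "(\<lambda>z. indicator shape z / ?v) \<in> borel_measurable (restrict_space lborel shape)"
        by (intro borel_measurable_divide borel_measurable_const measurable_restrict_space1) simp
    qed auto
    also have "\<dots> = (\<integral>z. indicator shape z *\<^sub>R ((indicator shape z / ?v) *\<^sub>R f z) \<partial>lborel)"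
      by (rule integral_restrict_space) simp
    also have "\<dots> = (\<integral>z. (indicator shape z * f z) / ?v \<partial>lborel)"
      by (intro Bochner_Integration.integral_cong) (auto simp: indicator_def)
    also have "\<dots> = I f / ?v" unfolding I_def by simp
    finally show ?thesis unfolding vol(1) by simp
  qed
  ultimately show "((\<lambda>t. integral\<^sup>L (distr (rescaled_measure w t) shape_measure radial_retraction) f) \<longlongrightarrow> integral\<^sup>L shape_measure f) at_top"
    using Lim_transform_eventually by fastforce
qed

theorem mGH_converges_shape:
  "mGH_converges (rescaled_ball w) (rescaled_dist w) (rescaled_measure w) shape dN shape_measure"
proof -
  obtain \<epsilon> where "(\<epsilon> \<longlongrightarrow> 0) at_top"
    "\<forall>t>0. eps_isometry (\<epsilon> t) (rescaled_ball w t) (rescaled_dist w t) shape dN radial_retraction"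
    using eps_isometry_rate[where h = "\<lambda>_. radial_retraction", OF eps_isometry_exists eventually_eps_isometry] by blast
  thus ?thesis
    unfolding mGH_converges_def
    using compact_metric_prob_space_rescaled compact_metric_prob_space_shape radial_retraction_measurable rescaled_weakly_converges
    by (intro conjI exI[of _ \<epsilon>] exI[of _ "\<lambda>_. radial_retraction"]) auto
qed

end

section \<open>Uniqueness and identification of the norm\<close>

lemma is_norm_approx:
  fixes N :: "real ^ 'n \<Rightarrow> real"
  assumes "is_norm N"
  shows "(\<lambda>n. N (real_vec (floor_vec (real n *\<^sub>R x))) / real n) \<longlonglongrightarrow> N x"
proof -
  have N: "\<And>x. 0 \<le> N x" "\<And>c x. N (c *\<^sub>R x) = \<bar>c\<bar> * N x" "\<And>x y. N (x + y) \<le> N x + N y"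
    using assms by (auto simp: is_norm_def)
  \<comment> \<open>Any norm is bounded by a multiple of \<open>rl1\<close>, by expansion in the
    standard basis, so rounding changes it by a bounded amount.\<close>
  define K where "K = (\<Sum>i\<in>UNIV. N (axis i 1))"
  have "N y \<le> K * rl1 y" for y
  proof -
    have sum_le: "N (\<Sum>i\<in>S. g i) \<le> (\<Sum>i\<in>S. N (g i))" if "finite S" for S and g :: "'n \<Rightarrow> real ^ 'n"
      using that
    proof induction
      case empty
      show ?case using N(2)[of 0 0] by simp
    next
      case (insert i S)
      thus ?case using N(3)[of "g i" "\<Sum>i\<in>S. g i"] by simp
    qed
    have "N y = N (\<Sum>i\<in>UNIV. y $ i *\<^sub>R axis i 1)"
      using basis_expansion[of y] by (simp add: scalar_mult_eq_scaleR)
    also have "\<dots> \<le> (\<Sum>i\<in>UNIV. \<bar>y $ i\<bar> * N (axis i 1))" using sum_le[of UNIV "\<lambda>i. y $ i *\<^sub>R axis i 1"] by (simp add: N(2))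
    also have "\<dots> \<le> (\<Sum>i\<in>UNIV. rl1 y * N (axis i 1))"
      unfolding rl1_def by (intro sum_mono mult_right_mono N(1) member_le_sum) auto
    finally show ?thesis by (simp add: K_def sum_distrib_left mult.commute)
  qed
  note Nle = this
  have "K \<ge> 0" unfolding K_def by (intro sum_nonneg N(1))
  have Nm: "N (- y) = N y" for y using N(2)[of "-1" y] by simp
  have "norm (N (real_vec (floor_vec (real n *\<^sub>R x))) / real n - N x) \<le> K * real CARD('n) / real n" if "0 < n" for n
  proof -
    let ?u = "real_vec (floor_vec (real n *\<^sub>R x))" and ?v = "real n *\<^sub>R x"
    have "\<bar>N ?u - N ?v\<bar> \<le> N (?u - ?v)"
      using N(3)[of "?u - ?v" ?v] N(3)[of "- (?u - ?v)" ?u] Nm[of "?u - ?v"] by (simp add: abs_le_iff)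
    also have "\<dots> \<le> K * real CARD('n)"
      using mult_left_mono[OF rl1_floor_vec \<open>0 \<le> K\<close>] by (rule order_trans[OF Nle])
    finally have "\<bar>N ?u - real n * N x\<bar> / real n \<le> K * real CARD('n) / real n"
      unfolding N(2) by (intro divide_right_mono) auto
    moreover have "\<bar>N ?u - real n * N x\<bar> / real n = \<bar>N ?u / real n - N x\<bar>"
    proof -
      have "N ?u / real n - N x = (N ?u - real n * N x) / real n" using that by (simp add: field_simps)
      thus ?thesis by (simp add: abs_divide)
    qed
    ultimately show ?thesis by simp
  qed
  hence "eventually (\<lambda>n. norm (N (real_vec (floor_vec (real n *\<^sub>R x))) / real n - N x) \<le> K * real CARD('n) / real n) sequentially"
    using eventually_gt_at_top[of 0] by (rule eventually_mono[rotated])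
  from LIM_zero_cancel[OF Lim_null_comparison[OF this lim_const_over_n]] show ?thesis .
qed

lemma is_norm_unique:
  assumes "is_norm N" "is_norm N'" "\<And>v. N (real_vec v) = N' (real_vec v)"
  shows "N = N'"
proof
  fix x
  show "N x = N' x"
    using LIMSEQ_unique[OF is_norm_approx[OF assms(1)]] is_norm_approx[OF assms(2)] assms(3) by simp
qed

text \<open>Two deterministic limits of the same sequence agree almost surely, and an almost sure
  statement free of \<open>\<omega>\<close> is true in a probability space.\<close>

lemma (in prob_space) fpp_norm_eq:
  assumes "is_norm N"
    and lim: "\<And>x. AE \<omega> in M. (\<lambda>n. passage_time (\<lambda>e. \<tau> e \<omega>) 0 (of_nat n *s x) / real n) \<longlonglongrightarrow> N (real_vec x)"
  shows "fpp_norm M \<tau> = N"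
  unfolding fpp_norm_def
proof (rule the_equality)
  fix N' assume N': "is_norm N' \<and> (\<forall>x. AE \<omega> in M. (\<lambda>n. passage_time (\<lambda>e. \<tau> e \<omega>) 0 (of_nat n *s x) / real n) \<longlonglongrightarrow> N' (real_vec x))"
  have "N' (real_vec x) = N (real_vec x)" for x
  proof -
    have "AE \<omega> in M. (\<lambda>n. passage_time (\<lambda>e. \<tau> e \<omega>) 0 (of_nat n *s x) / real n) \<longlonglongrightarrow> N' (real_vec x)" using N' by blast
    with lim[of x] have "AE \<omega> in M. N' (real_vec x) = N (real_vec x)"
      by eventually_elim (rule LIMSEQ_unique)
    thus ?thesis by simp
  qed
  thus "N' = N" using N' assms(1) by (intro is_norm_unique) auto
qed (use assms in blast)

theorem theorem3p17:
  fixes M :: "'w measure"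
    and \<tau> :: "(int ^ 'n) set \<Rightarrow> 'w \<Rightarrow> real"
    and f :: "real \<Rightarrow> ennreal"
    and \<alpha> :: real
  assumes "prob_space M"
    and "prob_space.indep_vars M (\<lambda>_. borel) \<tau> lattice_edges"
    and "\<And>e. e \<in> lattice_edges \<Longrightarrow> distributed M lborel (\<tau> e) f"
    and "\<And>e. e \<in> lattice_edges \<Longrightarrow> AE \<omega> in M. 0 \<le> \<tau> e \<omega>"
    and "\<alpha> > 0"
    and "\<And>e. e \<in> lattice_edges \<Longrightarrow> integrable M (\<lambda>\<omega>. exp (\<alpha> * \<tau> e \<omega>))"
  shows "AE \<omega> in M.
    mGH_converges
      (rescaled_ball (\<lambda>e. \<tau> e \<omega>)) (rescaled_dist (\<lambda>e. \<tau> e \<omega>)) (rescaled_measure (\<lambda>e. \<tau> e \<omega>))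
      (limit_shape M \<tau>) (limit_dist M \<tau>) (limit_measure M \<tau>)"
proof -
  interpret prob_space M by fact
  \<comment> \<open>The common law is read off from some edge; the index type is nonempty, so one
    exists.\<close>
  obtain e0 :: "(int ^ 'n) set" where e0: "e0 \<in> lattice_edges"
    using time_edges_subset[where 'a = 'n] time_edges_nonempty by blast
  define \<nu> where "\<nu> = density lborel f"
  have f: "f \<in> borel_measurable lborel" using assms(3)[OF e0] by (simp add: distributed_def)
  have rv: "\<tau> e \<in> borel_measurable M" if "e \<in> lattice_edges" for e
    using assms(3)[OF that] by (simp add: distributed_def)
  have law: "distr M borel (\<tau> e) = \<nu>" if "e \<in> lattice_edges" for e
  proof -
    have "distr M borel (\<tau> e) = distr M lborel (\<tau> e)" by (rule distr_cong) simp_all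
    thus ?thesis using assms(3)[OF that] by (simp add: distributed_def \<nu>_def)
  qed
  have "AE x in \<nu>. 0 \<le> x"
    unfolding law[OF e0, symmetric] using rv[OF e0] assms(4)[OF e0] by (subst AE_distr_iff) auto
  \<comment> \<open>The density gives no mass to a single point.\<close>
  moreover have "AE x in \<nu>. x \<noteq> 0"
    unfolding \<nu>_def using f AE_lborel_singleton[of 0] by (subst AE_density) auto
  ultimately have pos: "AE x in \<nu>. 0 < x" by eventually_elim simp
  interpret iid_weights M \<tau> \<nu> \<alpha>
  proof (intro iid_weights.intro iid_weights_axioms.intro)
    show "prob_space \<nu>" unfolding law[OF e0, symmetric] by (rule prob_space_distr[OF rv[OF e0]])
    show "integrable \<nu> (\<lambda>x. exp (\<alpha> * x))"
      unfolding law[OF e0, symmetric] using rv[OF e0] assms(6)[OF e0] by (subst integrable_distr_eq) auto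
  qed (use assms law pos in \<open>auto simp: \<nu>_def\<close>)
  obtain c C NZ where conv: "AE \<omega> in M. fpp_configuration (\<lambda>e. \<tau> e \<omega>) c C \<and>
      (\<forall>a v :: int ^ 'n. (\<lambda>n. passage_time (\<lambda>e. \<tau> e \<omega>) (of_nat n *s a) (of_nat n *s (a + v)) / real n) \<longlonglongrightarrow> NZ v)"
    by (rule AE_passage_times_converge)
  have lim: "AE \<omega> in M. fpp_limit (\<lambda>e. \<tau> e \<omega>) c C NZ"
    using conv by eventually_elim (simp add: fpp_limit_def fpp_limit_axioms_def)
  \<comment> \<open>A single good realisation serves to form the norm. Its construction involves
    \<open>NZ\<close> only, so the conclusions for all other good realisations speak of the same
    \<open>L0.N\<close>.\<close>
  obtain \<omega>0 where "fpp_limit (\<lambda>e. \<tau> e \<omega>0) c C NZ"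
    using eventually_happens'[OF ae_filter_bot lim] by blast
  then interpret L0: fpp_limit "\<lambda>e. \<tau> e \<omega>0" c C NZ .
  have norm: "fpp_norm M \<tau> = L0.N"
  proof (rule fpp_norm_eq[OF L0.N_is_norm])
    fix x
    show "AE \<omega> in M. (\<lambda>n. passage_time (\<lambda>e. \<tau> e \<omega>) 0 (of_nat n *s x) / real n) \<longlonglongrightarrow> L0.N (real_vec x)"
      using lim unfolding L0.N_real_vec by eventually_elim (rule fpp_limit.T_limit_0)
  qed
  have shape: "limit_shape M \<tau> = L0.shape"
    by (simp add: limit_shape_def L0.shape_def norm)
  have dist: "limit_dist M \<tau> = (\<lambda>s s'. L0.N (s - s'))"
    by (simp add: limit_dist_def[abs_def] norm fun_eq_iff)
  have measure: "limit_measure M \<tau> = L0.shape_measure"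
    by (simp add: limit_measure_def L0.shape_measure_def shape)
  show ?thesis
    using lim unfolding shape dist measure by eventually_elim (rule fpp_limit.mGH_converges_shape)
qed

end
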